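(* Let $B$ be a stationary Bratteli diagram such that the tail equivalence relation $\mathcal R$ on $X_B$ is aperiodic and the incidence matrix $F$ satisfies condition (P). Then the set of ergodic infinite ($\sigma$-finite) $\mathcal R$-invariant measures on $X_B$ which are positive and finite on at least one open set (depending on the measure), modulo a constant multiple, is in one-to-one correspondence with the set of non-distinguished vertices of the reduced graph $R(A)$, where $A=F^T$.
   Context: A Bratteli diagram $B=(V,E)$ is an infinite graph with vertex set $V=\bigsqcup_{i\ge 0}V_i$ and edge set $E=\bigsqcup_{i\ge1}E_i$, all $V_i,E_i$ finite, $V_0=\{v_0\}$, with range and source maps $r,s:E\to V$ such that $r(E_i)=V_i$, $s(E_i)=V_{i-1}$, $s^{-1}(v)\ne\emptyset$ for all $v\in V$ and $r^{-1}(v')\neq\emptyset$ for all $v'\in V\setminus V_0$. $X_B$ is the set of infinite paths $x=(x_i)_{i\ge1}$, $x_i\in E_i$, $r(x_i)=s(x_{i+1})$, starting at $v_0$, with the topology generated by cylinder sets (sets of paths with prescribed first $n$ edges); it is assumed to have no isolated points. The incidence matrix $F_n$ ($n\ge1$) has $(v,w)$ entry ($v\in V_{n+1}$, $w\in V_n$) equal to the number of edges $e\in E_{n+1}$ with $r(e)=v$, $s(e)=w$. $B$ is stationary if $F_n=F_1=:F$ for all $n\ge1$; then every $V_n$, $n\ge1$, is identified with $\{1,\dots,N\}$. Paths $x,y\in X_B$ are tail equivalent, $(x,y)\in\mathcal R$, if there is $i_0$ with $x_i=y_i$ for all $i\ge i_0$. $\mathcal R$ is aperiodic if all its classes are infinite.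 A Borel measure on $X_B$ is $\mathcal R$-invariant if it is invariant under the Borel action of any countable group on $X_B$ whose orbits generate $\mathcal R$ (e.g. the group of finite coordinate changes). It is ergodic if for every $\mathcal R$-saturated Borel set, the set or its complement is null. The term "infinite measure" means a $\sigma$-finite infinite non-atomic measure. Classes and condition (P): Let $G(F)$ be the directed graph on $\{1,\dots,N\}$ with an arrow $i\to j$ iff $F_{ij}>0$; $i,j$ are equivalent if $i=j$ or there are paths in $G(F)$ from $i$ to $j$ and from $j$ to $i$. Let $\mathcal E_1,\dots,\mathcal E_m$ be the equivalence classes, $F_\alpha$ the restriction of $F$ to $\mathcal E_\alpha$ (some $F_\alpha$ may be zero), and $A_\alpha=F_\alpha^T$. Condition (P) says that the vertices and classes are numbered so that $F$ is block lower triangular with diagonal blocks $F_1,\dots,F_m$, where exactly the first $s$ classes have no arrows of $G(F)$ to other classes, and every nonzero $F_\alpha$ is primitive. The reduced graph $R(A)$ has vertices $1,\dots,m$ (the classes), with a directed edge from $\beta$ to $\alpha$ iff there is an arrow from a vertex of $\mathcal E_\beta$ to a vertex of $\mathcal E_\alpha$ in the graph $G(A)$ (arrows $i\to j$ iff $A_{ij}>0$). A class $\beta$ has access to $\alpha$ in $R(A)$ if $\beta=\alpha$ or there is a path in $G(A)$ from $\mathcal E_\beta$ to $\mathcal E_\alpha$; write $\beta\succ\alpha$ if moreover $\beta\ne\alpha$. With $\rho_\alpha$ the spectral radius of $A_\alpha$, the vertex $\alpha$ is distinguished (in $R(A)$) if $\rho_\alpha>\rho_\beta$ whenever $\beta\succ\alpha$,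 and non-distinguished otherwise.
   Formalization: Only non-distinguished vertices with spectral radius greater than 1 are counted: a non-distinguished vertex with block [0] or [1] carries no non-atomic infinite measure, so the claim as stated fails, e.g. for F with rows (2,0,0), (1,0,0), (0,1,3). *)

theory Defs
  imports
    "HOL-Analysis.Analysis"
    "HOL-Algebra.Bij"
    "Jordan_Normal_Form.Spectral_Radius"
    "Jordan_Normal_Form.DL_Submatrix"
begin

section \<open>Bratteli diagrams and their path spaces\<close>

text \<open>\<open>edges B n\<close> is the set $E_{n+1}$ of edges going from level \<open>n\<close> to level \<open>n + 1\<close>;
  correspondingly the entry \<open>x n\<close> of a path is the edge $x_{n+1}$.\<close>

record ('v, 'e) bratteli =
  verts :: "nat \<Rightarrow> 'v set"
  edges :: "nat \<Rightarrow> 'e set"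
  src :: "'e \<Rightarrow> 'v"
  rng :: "'e \<Rightarrow> 'v"

text \<open>The two image equations also say that every vertex emits an edge and that every vertex
  outside level 0 receives one.\<close>

definition bratteli_diagram :: "('v, 'e) bratteli \<Rightarrow> bool" where
  "bratteli_diagram B \<longleftrightarrow>
     (\<forall>n. finite (verts B n)) \<and> (\<forall>n. finite (edges B n)) \<and>
     disjoint_family (verts B) \<and> disjoint_family (edges B) \<and>
     (\<exists>v0. verts B 0 = {v0}) \<and>
     (\<forall>n. src B ` edges B n = verts B n) \<and>
     (\<forall>n. rng B ` edges B n = verts B (Suc n))"

definition path_space :: "('v, 'e) bratteli \<Rightarrow> (nat \<Rightarrow> 'e) set" where
  "path_space B = {x. \<forall>n. x n \<in> edges B n \<and> rng B (x n) = src B (x (Suc n))}"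

definition cylinder :: "('v, 'e) bratteli \<Rightarrow> (nat \<Rightarrow> 'e) \<Rightarrow> nat \<Rightarrow> (nat \<Rightarrow> 'e) set" where
  "cylinder B x n = {y \<in> path_space B. \<forall>i<n. y i = x i}"

definition path_topology :: "('v, 'e) bratteli \<Rightarrow> (nat \<Rightarrow> 'e) topology" where
  "path_topology B = topology_generated_by {cylinder B x n | x n. True}"

definition no_isolated_points :: "('v, 'e) bratteli \<Rightarrow> bool" where
  "no_isolated_points B \<longleftrightarrow> (\<forall>x\<in>path_space B. \<not> openin (path_topology B) {x})"

definition path_borel :: "('v, 'e) bratteli \<Rightarrow> (nat \<Rightarrow> 'e) measure" where
  "path_borel B = sigma (path_space B) {U. openin (path_topology B) U}"

definition tail_rel :: "('v, 'e) bratteli \<Rightarrow> ((nat \<Rightarrow> 'e) \<times> (nat \<Rightarrow> 'e)) set" where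
  "tail_rel B = {(x, y). x \<in> path_space B \<and> y \<in> path_space B \<and> (\<exists>i0. \<forall>i\<ge>i0. x i = y i)}"

definition aperiodic :: "('v, 'e) bratteli \<Rightarrow> bool" where
  "aperiodic B \<longleftrightarrow> (\<forall>x\<in>path_space B. infinite (tail_rel B `` {x}))"

text \<open>\<open>\<nu> n\<close> identifies \<open>{..<N}\<close> with the vertices of level \<open>n \<ge> 1\<close>; the vertices are numbered
  from 0.\<close>

definition incidence_matrix ::
    "('v, 'e) bratteli \<Rightarrow> nat \<Rightarrow> (nat \<Rightarrow> nat \<Rightarrow> 'v) \<Rightarrow> nat \<Rightarrow> nat mat" where
  "incidence_matrix B N \<nu> n =
     mat N N (\<lambda>(i, j). card {e \<in> edges B n. rng B e = \<nu> (Suc n) i \<and> src B e = \<nu> n j})"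

definition stationary :: "('v, 'e) bratteli \<Rightarrow> nat \<Rightarrow> (nat \<Rightarrow> nat \<Rightarrow> 'v) \<Rightarrow> bool" where
  "stationary B N \<nu> \<longleftrightarrow>
     (\<forall>n\<ge>1. bij_betw (\<nu> n) {..<N} (verts B n)) \<and>
     (\<forall>n\<ge>1. incidence_matrix B N \<nu> n = incidence_matrix B N \<nu> 1)"


section \<open>Invariant measures\<close>

text \<open>A Borel action of a countable group matters only through its image, a countable group of
  Borel bijections of the path space.\<close>

definition generates_tail_rel ::
    "('v, 'e) bratteli \<Rightarrow> ((nat \<Rightarrow> 'e) \<Rightarrow> (nat \<Rightarrow> 'e)) set \<Rightarrow> bool" where
  "generates_tail_rel B \<Gamma> \<longleftrightarrow>
     subgroup \<Gamma> (BijGroup (path_space B)) \<and> countable \<Gamma> \<and>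
     \<Gamma> \<subseteq> measurable (path_borel B) (path_borel B) \<and>
     tail_rel B = {(x, g x) | x g. x \<in> path_space B \<and> g \<in> \<Gamma>}"

definition tail_invariant :: "('v, 'e) bratteli \<Rightarrow> (nat \<Rightarrow> 'e) measure \<Rightarrow> bool" where
  "tail_invariant B M \<longleftrightarrow> (\<forall>\<Gamma>. generates_tail_rel B \<Gamma> \<longrightarrow> (\<forall>g\<in>\<Gamma>. distr M M g = M))"

definition tail_ergodic :: "('v, 'e) bratteli \<Rightarrow> (nat \<Rightarrow> 'e) measure \<Rightarrow> bool" where
  "tail_ergodic B M \<longleftrightarrow>
     (\<forall>S\<in>sets M. tail_rel B `` S = S \<longrightarrow> S \<in> null_sets M \<or> space M - S \<in> null_sets M)"

definition nonatomic :: "'a measure \<Rightarrow> bool" where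
  "nonatomic M \<longleftrightarrow>
     (\<forall>S\<in>sets M. emeasure M S > 0 \<longrightarrow>
        (\<exists>T\<in>sets M. T \<subseteq> S \<and> 0 < emeasure M T \<and> emeasure M T < emeasure M S))"

definition infinite_measure :: "'a measure \<Rightarrow> bool" where
  "infinite_measure M \<longleftrightarrow>
     sigma_finite_measure M \<and> emeasure M (space M) = \<infinity> \<and> nonatomic M"

definition infinite_ergodic_measures :: "('v, 'e) bratteli \<Rightarrow> (nat \<Rightarrow> 'e) measure set" where
  "infinite_ergodic_measures B =
     {M. space M = path_space B \<and> sets M = sets (path_borel B) \<and>
         tail_invariant B M \<and> tail_ergodic B M \<and> infinite_measure M \<and>
         (\<exists>U. openin (path_topology B) U \<and> 0 < emeasure M U \<and> emeasure M U < \<infinity>)}"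

definition proportional :: "('a measure \<times> 'a measure) set" where
  "proportional = {(M, M'). \<exists>c::real. c > 0 \<and> M' = scale_measure (ennreal c) M}"


section \<open>Classes of a nonnegative integer matrix\<close>

definition matrix_graph :: "nat mat \<Rightarrow> (nat \<times> nat) set" where
  "matrix_graph M = {(i, j). i < dim_row M \<and> j < dim_col M \<and> M $$ (i, j) > 0}"

definition class_rel :: "nat mat \<Rightarrow> (nat \<times> nat) set" where
  "class_rel M = {(i, j). i < dim_row M \<and> j < dim_row M \<and>
     (i = j \<or> (i, j) \<in> (matrix_graph M)\<^sup>+ \<and> (j, i) \<in> (matrix_graph M)\<^sup>+)}"

abbreviation block :: "'a mat \<Rightarrow> nat set \<Rightarrow> 'a mat" where
  "block M I \<equiv> submatrix M I I"

definition primitive :: "nat mat \<Rightarrow> bool" where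
  "primitive M \<longleftrightarrow> square_mat M \<and>
     (\<exists>k\<ge>1. \<forall>i<dim_row M. \<forall>j<dim_row M. (M ^\<^sub>m k) $$ (i, j) > 0)"

text \<open>\<open>C 0, \<dots>, C (m - 1)\<close> is the numbering of the classes; the condition \<open>i < j\<close> makes every
  class an interval of \<open>{..<N}\<close>, so that the classes are genuine diagonal blocks.\<close>

definition condition_P :: "nat mat \<Rightarrow> nat \<Rightarrow> nat \<Rightarrow> (nat \<Rightarrow> nat set) \<Rightarrow> bool" where
  "condition_P F s m C \<longleftrightarrow>
     bij_betw C {..<m} ({..<dim_row F} // class_rel F) \<and>
     (\<forall>\<alpha><m. \<forall>\<beta><m. \<alpha> < \<beta> \<longrightarrow> (\<forall>i\<in>C \<alpha>. \<forall>j\<in>C \<beta>. i < j \<and> F $$ (i, j) = 0)) \<and>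
     s \<le> m \<and>
     (\<forall>\<alpha><m. \<alpha> < s \<longleftrightarrow> (\<forall>(i, j)\<in>matrix_graph F. i \<in> C \<alpha> \<longrightarrow> j \<in> C \<alpha>)) \<and>
     (\<forall>\<alpha><m. block F (C \<alpha>) \<noteq> 0\<^sub>m (card (C \<alpha>)) (card (C \<alpha>)) \<longrightarrow> primitive (block F (C \<alpha>)))"

text \<open>In the following, \<open>A\<close> is the transposed matrix $F^T$; the vertex \<open>\<alpha> < m\<close> of the reduced
  graph stands for the class \<open>C \<alpha>\<close>.\<close>

definition has_access :: "nat mat \<Rightarrow> (nat \<Rightarrow> nat set) \<Rightarrow> nat \<Rightarrow> nat \<Rightarrow> bool" where
  "has_access A C \<beta> \<alpha> \<longleftrightarrow> \<beta> = \<alpha> \<or> (\<exists>i\<in>C \<beta>. \<exists>j\<in>C \<alpha>. (i, j) \<in> (matrix_graph A)\<^sup>+)"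

definition class_radius :: "nat mat \<Rightarrow> nat set \<Rightarrow> real" where
  "class_radius A I = spectral_radius (map_mat of_nat (block A I))"

definition distinguished :: "nat mat \<Rightarrow> nat \<Rightarrow> (nat \<Rightarrow> nat set) \<Rightarrow> nat \<Rightarrow> bool" where
  "distinguished A m C \<alpha> \<longleftrightarrow>
     (\<forall>\<beta><m. \<beta> \<noteq> \<alpha> \<and> has_access A C \<beta> \<alpha> \<longrightarrow> class_radius A (C \<alpha>) > class_radius A (C \<beta>))"

definition nondistinguished_vertices :: "nat mat \<Rightarrow> nat \<Rightarrow> (nat \<Rightarrow> nat set) \<Rightarrow> nat set" where
  "nondistinguished_vertices A m C = {\<alpha>. \<alpha> < m \<and> \<not> distinguished A m C \<alpha>}"

text \<open>Non-distinguished vertices whose block \<open>F\<^sub>\<alpha>\<close> is \<open>[0]\<close> or \<open>[1]\<close> (that is, of spectral radius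
  at most 1) carry no infinite measure: no infinite path stays in a class with block \<open>[0]\<close>, and
  only countably many paths end up in a class with block \<open>[1]\<close>, so that an invariant measure
  on them is atomic. Both kinds can occur under the standing assumptions, e.g. as the middle
  vertex for the incidence matrices with rows \<open>(2,0,0), (1,0,0), (0,1,3)\<close> and
  \<open>(2,0,0), (1,1,0), (0,1,3)\<close>, where the other two vertices are distinguished and there is no
  ergodic infinite measure as above. The correspondence therefore has to leave them out.\<close>

definition nondegenerate_vertices :: "nat mat \<Rightarrow> nat \<Rightarrow> (nat \<Rightarrow> nat set) \<Rightarrow> nat set" where
  "nondegenerate_vertices A m C = {\<alpha>. \<alpha> < m \<and> class_radius A (C \<alpha>) > 1}"

end

(*
  Let p n v be the mass that an invariant measure gives to the cylinders of length n ending at the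
  vertex v; then p n v = (SUM u. A v u * p (n + 1) u).  Along a path the class of the vertex never
  decreases, so an ergodic measure lives on the paths that end up in a single class alpha.  There
  p n = A_alpha (p (n + 1)), and primitivity forces p n = c x / rho_alpha^n with x the Perron vector
  of A_alpha, so that alpha determines the measure up to a constant as soon as one cylinder has
  finite mass.  The measure with these masses exists; it is atomic if rho_alpha <= 1 and
  non-atomic otherwise.  If alpha is distinguished then it is finite, because p is dominated by a
  supersolution built from the Perron vectors of the classes with access to alpha.  If some beta
  with access to alpha has rho_beta >= rho_alpha, then pairing p with the left Perron vector of
  A_beta shows that the flow out of beta would exhaust any finite mass.
*)
theory Submission
  imports Defs "HOL-Probability.Probability"
begin

text \<open>Two obstacles shape the proof. First, invariance is quantified over every countable
  group that generates the tail relation. It is reduced to one testable condition: exchanging two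
  finite prefixes with the same end vertex (\<open>switch\<close>) preserves the measure. The finite
  coordinate changes form such a group, and conversely every member of such a group is a switch on
  each of countably many pieces. Second, the measures are infinite, and cylinders that have not yet
  entered the class may have infinite mass, so a generating family of cylinders does not determine
  them at once. Usable masses belong to cylinders whose last vertex lies in the class; they suffice
  because a path that ends up in the class stays there once it has entered. Ergodicity is a
  by-product of uniqueness: the restriction to a saturated set gives equal mass to cylinders of
  equal length and end vertex, so it is a multiple \<open>c\<close> of the measure, and either
  \<open>c = 0\<close> or the complement is null.\<close>

section \<open>Nonnegative matrices\<close>

text \<open>Matrices are real functions of two indices, restricted to a finite index set \<open>I\<close>; this
  avoids the renumbering of the rows that \<open>block\<close> performs.\<close>

primrec mpow :: "('i \<Rightarrow> 'i \<Rightarrow> real) \<Rightarrow> 'i set \<Rightarrow> nat \<Rightarrow> 'i \<Rightarrow> 'i \<Rightarrow> real" where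
  "mpow a I 0 v u = (if v = u then 1 else 0)"
| "mpow a I (Suc k) v u = (\<Sum>w\<in>I. a v w * mpow a I k w u)"

lemma sum_ident_mult:
  "finite I \<Longrightarrow> v \<in> I \<Longrightarrow> (\<Sum>u\<in>I. (if v = u then 1 else 0) * f u) = (f v :: real)"
  by (subst sum.remove[of I v]) (auto intro!: sum.neutral split: if_splits)

lemma mpow_nonneg: "(\<And>v u. v \<in> I \<Longrightarrow> u \<in> I \<Longrightarrow> a v u \<ge> 0) \<Longrightarrow> v \<in> I \<Longrightarrow> mpow a I k v u \<ge> 0"
  by (induction k arbitrary: v) (auto intro!: sum_nonneg)

lemma mpow_Suc_right:
  assumes "finite I" "v \<in> I" "u \<in> I"
  shows "mpow a I (Suc k) v u = (\<Sum>w\<in>I. mpow a I k v w * a w u)"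
  using assms(2)
proof (induction k arbitrary: v)
  case 0
  have "(\<Sum>w\<in>I. a v w * (if w = u then 1 else 0)) = a v u"
    "(\<Sum>w\<in>I. (if v = w then 1 else 0) * a w u) = a v u"
    using assms 0 by (simp_all add: if_distrib if_distribR sum.delta cong: if_cong)
  then show ?case by simp
next
  case (Suc k)
  have "mpow a I (Suc (Suc k)) v u = (\<Sum>w\<in>I. a v w * (\<Sum>z\<in>I. mpow a I k w z * a z u))"
    by (subst mpow.simps(2)) (intro sum.cong refl, use Suc.IH in simp)
  also have "\<dots> = (\<Sum>z\<in>I. (\<Sum>w\<in>I. a v w * mpow a I k w z) * a z u)"
    by (simp add: sum_distrib_left sum_distrib_right mult.assoc) (rule sum.swap)
  finally show ?case by simp
qed

lemma mpow_transpose: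
  assumes "finite I" "v \<in> I" "u \<in> I"
  shows "mpow (\<lambda>v u. a u v) I k v u = mpow a I k u v"
  using assms(2,3)
proof (induction k arbitrary: v u)
  case (Suc k)
  have "mpow (\<lambda>v u. a u v) I (Suc k) v u = (\<Sum>w\<in>I. mpow a I k u w * a w v)"
    using Suc by (auto intro!: sum.cong)
  with mpow_Suc_right[OF assms(1), of u v a k] Suc.prems show ?case by simp
qed auto

definition primitive_on :: "'i set \<Rightarrow> ('i \<Rightarrow> 'i \<Rightarrow> real) \<Rightarrow> bool" where
  "primitive_on I a \<longleftrightarrow> finite I \<and> I \<noteq> {} \<and> (\<forall>v\<in>I. \<forall>u\<in>I. a v u \<ge> 0) \<and>
     (\<exists>k\<ge>1. \<forall>v\<in>I. \<forall>u\<in>I. mpow a I k v u > 0)"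

lemma primitive_on_transpose: "primitive_on I a \<Longrightarrow> primitive_on I (\<lambda>v u. a u v)"
  unfolding primitive_on_def by (metis mpow_transpose)

lemma mpow_backward:
  assumes "finite I" and p: "\<And>n v. n \<ge> n0 \<Longrightarrow> v \<in> I \<Longrightarrow> p n v = (\<Sum>u\<in>I. a v u * p (Suc n) u)"
    and "n \<ge> n0" "v \<in> I"
  shows "p n v = (\<Sum>u\<in>I. mpow a I k v u * (p (n + k) u :: real))"
  using assms(3,4)
proof (induction k arbitrary: n v)
  case 0
  then show ?case using assms(1) by (simp add: sum_ident_mult)
next
  case (Suc k)
  have "p n v = (\<Sum>w\<in>I. a v w * (\<Sum>u\<in>I. mpow a I k w u * p (Suc n + k) u))"
    using p[of n v] Suc.IH[of "Suc n"] Suc.prems by (auto intro!: sum.cong)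
  also have "\<dots> = (\<Sum>u\<in>I. (\<Sum>w\<in>I. a v w * mpow a I k w u) * p (n + Suc k) u)"
    by (simp add: sum_distrib_left sum_distrib_right mult.assoc) (rule sum.swap)
  finally show ?case by simp
qed

lemma mpow_eigen:
  assumes "finite I" "\<And>v. v \<in> I \<Longrightarrow> (\<Sum>u\<in>I. a v u * x u) = r * (x v :: real)" "v \<in> I"
  shows "(\<Sum>u\<in>I. mpow a I k v u * x u) = r ^ k * x v"
  using assms(3)
proof (induction k arbitrary: v)
  case 0
  then show ?case using assms(1) by (simp add: sum_ident_mult)
next
  case (Suc k)
  have "(\<Sum>u\<in>I. mpow a I (Suc k) v u * x u) = (\<Sum>w\<in>I. a v w * (\<Sum>u\<in>I. mpow a I k w u * x u))"
    by (simp add: sum_distrib_left sum_distrib_right mult.assoc) (rule sum.swap)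
  also have "\<dots> = (\<Sum>w\<in>I. a v w * (r ^ k * x w))"
    using Suc.IH by (auto intro!: sum.cong)
  also have "\<dots> = r ^ k * (r * x v)"
    using assms(2)[OF Suc.prems] by (simp add: sum_distrib_left[symmetric] mult.left_commute)
  finally show ?case by simp
qed

text \<open>The positive power gives \<open>r ^ k > 0\<close>, which for even \<open>k\<close> only
  excludes 0; the sign comes from \<open>r * x v\<close> being a sum of nonnegative terms.\<close>

lemma primitive_eigenvalue_pos:
  assumes "primitive_on I a" "\<And>v. v \<in> I \<Longrightarrow> x v > (0::real)"
    "\<And>v. v \<in> I \<Longrightarrow> (\<Sum>u\<in>I. a v u * x u) = r * x v"
  shows "r > 0"
proof -
  have fin: "finite I" and ne: "I \<noteq> {}" and a: "\<And>v u. v \<in> I \<Longrightarrow> u \<in> I \<Longrightarrow> a v u \<ge> 0"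
    using assms(1) by (auto simp: primitive_on_def)
  obtain k where k: "k \<ge> 1" "\<And>v u. v \<in> I \<Longrightarrow> u \<in> I \<Longrightarrow> mpow a I k v u > 0"
    using assms(1) unfolding primitive_on_def by metis
  obtain v where v: "v \<in> I" using ne by auto
  have "(\<Sum>u\<in>I. mpow a I k v u * x u) > 0"
    using fin ne v k assms(2) by (intro sum_pos) auto
  then have "r ^ k * x v > 0" using mpow_eigen[OF fin assms(3) v, of k] by simp
  then have "r \<noteq> 0" using k(1) by (auto simp: power_0_left)
  moreover have "r * x v \<ge> 0"
    unfolding assms(3)[OF v, symmetric] using a v assms(2) by (intro sum_nonneg) (simp add: less_imp_le)
  ultimately show ?thesis using assms(2)[OF v] by (simp add: zero_le_mult_iff order_less_le)
qed

text \<open>After normalisation by the eigenvector the matrix becomes stochastic and \<open>q n\<close> is a convex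
  combination, with weights bounded below, of the values of \<open>q (n + k)\<close>. So the oscillation of
  \<open>q n\<close> is bounded in \<open>n\<close> but grows geometrically unless it is zero.\<close>

lemma primitive_backward_unique:
  assumes prim: "primitive_on I a"
    and x: "\<And>v. v \<in> I \<Longrightarrow> x v > (0::real)" "\<And>v. v \<in> I \<Longrightarrow> (\<Sum>u\<in>I. a v u * x u) = r * x v"
    and p: "\<And>n v. n \<ge> n0 \<Longrightarrow> v \<in> I \<Longrightarrow> p n v \<ge> 0"
      "\<And>n v. n \<ge> n0 \<Longrightarrow> v \<in> I \<Longrightarrow> p n v = (\<Sum>u\<in>I. a v u * p (Suc n) u)"
  shows "\<exists>c\<ge>0. \<forall>n\<ge>n0. \<forall>v\<in>I. p n v = c * x v / r ^ n"
proof -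
  have fin: "finite I" and ne: "I \<noteq> {}" and a: "\<And>v u. v \<in> I \<Longrightarrow> u \<in> I \<Longrightarrow> a v u \<ge> 0"
    using prim by (auto simp: primitive_on_def)
  obtain k where k: "k \<ge> 1" "\<And>v u. v \<in> I \<Longrightarrow> u \<in> I \<Longrightarrow> mpow a I k v u > 0"
    using prim unfolding primitive_on_def by metis
  have r: "r > 0" by (rule primitive_eigenvalue_pos[OF prim x])
  \<comment> \<open>\<open>q\<close> compares \<open>p\<close> with the expected solution
    \<open>x v / r ^ n\<close>; the claim is that \<open>q\<close> is one constant.
    \<open>P j\<close> is the stochastic matrix that expresses \<open>q n\<close> by
    \<open>q (n + j)\<close>.\<close>
  define q where "q n v = r ^ n * p n v / x v" for n v
  define P where "P j v u = mpow a I j v u * x u / (r ^ j * x v)" for j v u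
  have q0: "q n v \<ge> 0" if "n \<ge> n0" "v \<in> I" for n v
    unfolding q_def using that p(1) r x(1) by (simp add: less_imp_le)
  have P0: "P j v u \<ge> 0" if "v \<in> I" "u \<in> I" for j v u
    unfolding P_def using that r x(1) mpow_nonneg[of I a v j u] a by (simp add: less_imp_le)
  have P1: "(\<Sum>u\<in>I. P j v u) = 1" if "v \<in> I" for j v
    using r x(1)[OF that] mpow_eigen[OF fin x(2) that, of j]
    by (simp add: P_def sum_divide_distrib[symmetric])
  have qP: "q n v = (\<Sum>u\<in>I. P j v u * q (n + j) u)" if "n \<ge> n0" "v \<in> I" for n v j
  proof -
    have "q n v = (\<Sum>u\<in>I. r ^ n * (mpow a I j v u * p (n + j) u) / x v)"
      unfolding q_def using mpow_backward[where p = p, OF fin p(2) that, of j]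
      by (simp add: sum_distrib_left sum_divide_distrib)
    also have "\<dots> = (\<Sum>u\<in>I. P j v u * q (n + j) u)"
    proof (rule sum.cong)
      fix u assume "u \<in> I"
      then show "r ^ n * (mpow a I j v u * p (n + j) u) / x v = P j v u * q (n + j) u"
        using x(1)[of u] x(1)[of v] r that by (simp add: P_def q_def power_add field_simps)
    qed simp
    finally show ?thesis .
  qed
  define \<delta> where "\<delta> = Min ((\<lambda>(v,u). P k v u) ` (I \<times> I))"
  have \<delta>: "\<delta> > 0" "\<And>v u. v \<in> I \<Longrightarrow> u \<in> I \<Longrightarrow> \<delta> \<le> P k v u"
  proof -
    have "P k v u > 0" if "v \<in> I" "u \<in> I" for v u
      using that k r x(1) by (simp add: P_def)
    then show "\<delta> > 0" unfolding \<delta>_def using fin ne by auto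
    show "\<delta> \<le> P k v u" if "v \<in> I" "u \<in> I" for v u
      unfolding \<delta>_def using fin that by (intro Min_le) (auto intro: image_eqI[of _ _ "(v, u)"])
  qed
  define M where "M n = Max (q n ` I)" for n
  define m where "m n = Min (q n ` I)" for n
  have Mm: "m n \<le> q n v" "q n v \<le> M n" if "v \<in> I" for n v
    unfolding m_def M_def using fin that by (auto intro: Min_le Max_ge)
  have Mex: "\<exists>v\<in>I. M n = q n v" and mex: "\<exists>v\<in>I. m n = q n v" for n
    using Max_in[of "q n ` I"] Min_in[of "q n ` I"] fin ne unfolding m_def M_def image_iff by blast+
  have m0: "m n \<ge> 0" if "n \<ge> n0" for n using mex[of n] q0[OF that] by auto
  have mM: "m n \<le> M n" for n using mex[of n] Mm by auto
  have low: "m (n + j) \<le> q n v" and up: "q n v \<le> M (n + j)" if "n \<ge> n0" "v \<in> I" for n v j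
  proof -
    have "(\<Sum>u\<in>I. P j v u) * m (n + j) \<le> (\<Sum>u\<in>I. P j v u * q (n + j) u)"
      unfolding sum_distrib_right using P0 Mm that by (intro sum_mono mult_left_mono) auto
    then show "m (n + j) \<le> q n v" unfolding qP[OF that, of j] P1[OF that(2)] by simp
    have "(\<Sum>u\<in>I. P j v u * q (n + j) u) \<le> (\<Sum>u\<in>I. P j v u) * M (n + j)"
      unfolding sum_distrib_right using P0 Mm that by (intro sum_mono mult_left_mono) auto
    then show "q n v \<le> M (n + j)" unfolding qP[OF that, of j] P1[OF that(2)] by simp
  qed
  \<comment> \<open>A Harnack inequality: since every weight is at least \<delta>, the largest later
    value controls every earlier one. It yields the uniform bound \<open>Mbd\<close>, against which
    the growth of the oscillation is played off.\<close>
  have bd: "\<delta> * M (n + k) \<le> q n v" if "n \<ge> n0" "v \<in> I" for n v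
  proof -
    obtain u where u: "u \<in> I" "M (n + k) = q (n + k) u" using Mex by blast
    have "\<delta> * M (n + k) \<le> P k v u * q (n + k) u"
      using u \<delta>(2)[OF that(2) u(1)] q0[of "n + k" u] that by (auto intro!: mult_right_mono)
    also have "\<dots> \<le> (\<Sum>u\<in>I. P k v u * q (n + k) u)"
      using fin u that P0 q0 by (intro member_le_sum) auto
    finally show ?thesis using qP[OF that, of k] by simp
  qed
  \<comment> \<open>Each average at level \<open>n\<close> puts weight at least \<delta> on a point
    where the minimum at level \<open>n + k\<close> is attained, and minima can only decrease as the
    level grows.\<close>
  have osc: "M n - m n \<le> (1 - \<delta>) * (M (n + k) - m (n + k))" if n: "n \<ge> n0" for n
  proof -
    obtain v where v: "v \<in> I" "M n = q n v" using Mex by blast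
    obtain u where u: "u \<in> I" "m (n + k) = q (n + k) u" using mex by blast
    have "M (n + k) - q n v = (\<Sum>w\<in>I. P k v w * (M (n + k) - q (n + k) w))"
      by (simp add: right_diff_distrib sum_subtractf qP[OF n v(1), of k] sum_distrib_right[symmetric] P1[OF v(1)])
    also have "\<dots> \<ge> P k v u * (M (n + k) - q (n + k) u)"
      using fin u v P0 Mm by (intro member_le_sum) auto
    also have "P k v u * (M (n + k) - q (n + k) u) \<ge> \<delta> * (M (n + k) - q (n + k) u)"
      using \<delta>(2)[OF v(1) u(1)] Mm(2)[OF u(1)] by (intro mult_right_mono) auto
    finally have "M n \<le> M (n + k) - \<delta> * (M (n + k) - m (n + k))" using v(2) unfolding u(2) by linarith
    moreover have "m (n + k) \<le> m n" using mex[of n] low[OF n] by auto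
    ultimately show ?thesis by (simp add: algebra_simps)
  qed
  have \<delta>1: "\<delta> \<le> 1"
  proof -
    obtain v where v: "v \<in> I" using ne by auto
    have "\<delta> \<le> P k v v" using \<delta>(2) v by auto
    also have "\<dots> \<le> (\<Sum>u\<in>I. P k v u)" using fin v P0 by (intro member_le_sum) auto
    finally show ?thesis using P1[OF v] by simp
  qed
  have oscj: "M n - m n \<le> (1 - \<delta>) ^ j * (M (n + j * k) - m (n + j * k))" if n: "n \<ge> n0" for n j
  proof (induction j)
    case (Suc j)
    have "(1 - \<delta>) ^ j * (M (n + j * k) - m (n + j * k))
      \<le> (1 - \<delta>) ^ j * ((1 - \<delta>) * (M (n + j * k + k) - m (n + j * k + k)))"
      using osc[of "n + j * k"] n \<delta>1 by (intro mult_left_mono) auto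
    with Suc show ?case by (simp add: algebra_simps)
  qed auto
  obtain v0 where v0: "v0 \<in> I" using ne by auto
  have Mbd: "M n \<le> q n0 v0 / \<delta>" if "n \<ge> n0" for n
  proof -
    obtain v where v: "v \<in> I" "M n = q n v" using Mex by blast
    obtain u where u: "u \<in> I" "m n = q n u" using mex by blast
    have "\<delta> * M n \<le> \<delta> * M (n + k)" using up[OF that v(1), of k] \<delta>(1) unfolding v(2)
      by (intro mult_left_mono) auto
    also have "\<dots> \<le> m n" using bd[OF that u(1)] unfolding u(2) .
    also have "\<dots> \<le> q n0 v0" using low[OF order.refl v0, of "n - n0"] that by simp
    finally show ?thesis using \<delta>(1) by (simp add: field_simps)
  qed
  have eq: "M n = m n" if n: "n \<ge> n0" for n
  proof -
    have lim: "(\<lambda>j. (1 - \<delta>) ^ j * (q n0 v0 / \<delta>)) \<longlonglongrightarrow> 0"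
      using \<delta>(1) \<delta>1 by (intro tendsto_mult_left_zero LIMSEQ_power_zero) auto
    have "M n - m n \<le> (1 - \<delta>) ^ j * (q n0 v0 / \<delta>)" for j
    proof -
      have "M (n + j * k) - m (n + j * k) \<le> q n0 v0 / \<delta>"
        using Mbd[of "n + j * k"] m0[of "n + j * k"] n by linarith
      then have "(1 - \<delta>) ^ j * (M (n + j * k) - m (n + j * k)) \<le> (1 - \<delta>) ^ j * (q n0 v0 / \<delta>)"
        using \<delta>1 by (intro mult_left_mono) auto
      then show ?thesis using oscj[OF n, of j] by linarith
    qed
    then have "M n - m n \<le> 0" by (intro LIMSEQ_le_const[OF lim] exI allI impI)
    with mM[of n] show ?thesis by simp
  qed
  have qm: "q n v = m n" if "n \<ge> n0" "v \<in> I" for n v using eq[OF that(1)] Mm[OF that(2), of n] by simp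
  have "m (n0 + j) = m n0" for j
    using low[OF order.refl v0, of j] up[OF order.refl v0, of j] qm[OF order.refl v0] eq[of "n0 + j"] by linarith
  then have const: "m n = m n0" if "n \<ge> n0" for n using that by (metis le_add_diff_inverse)
  show ?thesis
  proof (intro exI[of _ "m n0"] conjI allI ballI impI)
    fix n v assume nv: "n \<ge> n0" "v \<in> I"
    have "q n v = m n0" using qm[OF nv] const[OF nv(1)] by (rule trans)
    then show "p n v = m n0 * x v / r ^ n" using r x(1)[OF nv(2)] by (auto simp: q_def field_simps)
  qed (use m0[of n0] in simp)
qed

text \<open>The homomorphism \<open>h\<close> serves two uses: \<open>real\<close> for the natural
  number matrices in \<open>primitive\<close>, and the identity for the real matrix in
  \<open>perron_vector\<close>.\<close>

lemma mat_pow_eq_mpow: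
  assumes "A \<in> carrier_mat n n" "i < n" "j < n"
    and h: "\<And>x y. h (x + y) = h x + h y" "\<And>x y. h (x * y) = h x * h y" "h 0 = 0" "h 1 = (1 :: real)"
  shows "h ((A ^\<^sub>m k) $$ (i, j)) = mpow (\<lambda>i j. h (A $$ (i, j))) {..<n} k i j"
  using assms(2,3)
proof (induction k arbitrary: i j)
  case 0
  then show ?case using assms(1) h by auto
next
  case (Suc k)
  have hs: "h (\<Sum>w\<in>W. f w) = (\<Sum>w\<in>W. h (f w))" if "finite W" for f and W :: "nat set"
    using that by induction (auto simp: h)
  have "(A ^\<^sub>m Suc k) $$ (i, j) = (\<Sum>w\<in>{..<n}. (A ^\<^sub>m k) $$ (i, w) * A $$ (w, j))"
    using Suc.prems assms(1) pow_carrier_mat[OF assms(1), of k]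
    by (auto simp: scalar_prod_def lessThan_atLeast0 intro!: sum.cong)
  then have "h ((A ^\<^sub>m Suc k) $$ (i, j)) = (\<Sum>w\<in>{..<n}. mpow (\<lambda>i j. h (A $$ (i, j))) {..<n} k i w * h (A $$ (w, j)))"
    using Suc by (simp add: hs h)
  also have "\<dots> = mpow (\<lambda>i j. h (A $$ (i, j))) {..<n} (Suc k) i j"
    using Suc.prems by (subst mpow_Suc_right) auto
  finally show ?case .
qed

lemma mpow_reindex:
  assumes "bij_betw h J I" "finite I" "i \<in> J" "j \<in> J"
  shows "mpow (\<lambda>i j. a (h i) (h j)) J k i j = mpow a I k (h i) (h j)"
  using assms(3,4)
proof (induction k arbitrary: i j)
  case 0
  then show ?case using assms(1) by (auto simp: bij_betw_def inj_on_def)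
next
  case (Suc k)
  then show ?case using sum.reindex_bij_betw[OF assms(1), of "\<lambda>w. a (h i) w * mpow a I k w (h j)"]
    by (auto intro!: sum.cong)
qed

section \<open>Perron vectors of primitive matrices\<close>

lemma mpow_scale: "mpow (\<lambda>i j. s * a i j) I k v u = s ^ k * mpow a I k v u"
  by (induction k arbitrary: v) (auto simp: sum_distrib_left mult_ac)

text \<open>An eigenvalue \<open>e\<close> of \<open>M / s\<close> gives the eigenvalue
  \<open>s * e\<close> of \<open>M\<close>. Radius below 1 is the form in which boundedness of the
  powers is used in \<open>perron_vector\<close>.\<close>

lemma spectral_radius_smult_less_1:
  assumes M: "M \<in> carrier_mat n n" "n > 0" and s: "s > spectral_radius M" "s > 0"
  shows "spectral_radius (complex_of_real (1 / s) \<cdot>\<^sub>m M) < 1"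
proof -
  let ?N = "complex_of_real (1 / s) \<cdot>\<^sub>m M"
  have N: "?N \<in> carrier_mat n n" using M by simp
  obtain e where e: "e \<in> spectrum ?N" "spectral_radius ?N = cmod e"
    using spectral_radius_mem_max(1)[OF N M(2)] by auto
  obtain v where v: "v \<in> carrier_vec n" "v \<noteq> 0\<^sub>v n" "?N *\<^sub>v v = e \<cdot>\<^sub>v v"
    using e(1) N by (auto simp: spectrum_def eigenvalue_def eigenvector_def)
  have "M *\<^sub>v v = (of_real s * e) \<cdot>\<^sub>v v"
  proof (rule eq_vecI)
    fix i assume "i < dim_vec ((of_real s * e) \<cdot>\<^sub>v v)"
    then have i: "i < n" using v by simp
    have "(?N *\<^sub>v v) $ i = (1 / s) * (M *\<^sub>v v) $ i"
      using M v(1) i by (simp add: scalar_prod_def sum_distrib_left sum_divide_distrib)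
    moreover have "(?N *\<^sub>v v) $ i = e * v $ i" unfolding v(3) using i v by simp
    ultimately show "(M *\<^sub>v v) $ i = ((of_real s * e) \<cdot>\<^sub>v v) $ i"
      using i v s by (simp add: field_simps)
  qed (use M v in auto)
  then have "of_real s * e \<in> spectrum M"
    using M v by (auto simp: spectrum_def eigenvalue_def eigenvector_def)
  then have "cmod (of_real s * e) \<le> spectral_radius M"
    using spectral_radius_mem_max(2)[OF M] by blast
  then have "s * cmod e \<le> spectral_radius M" using s by (simp add: norm_mult)
  moreover have "s * 1 \<le> s * cmod e" if "cmod e \<ge> 1" using s that by (intro mult_left_mono) auto
  ultimately show ?thesis using s unfolding e(2) by linarith
qed

text \<open>The moduli \<open>y\<close> of an eigenvector for an eigenvalue of maximal modulus \<open>\<rho>\<close> satisfy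
  \<open>b y \<ge> \<rho> y\<close>. If this were not an equality then multiplication by a positive power of \<open>b\<close>
  would make it strict, and the powers of \<open>b\<close> would grow faster than \<open>\<rho>\<close> permits.\<close>

lemma perron_vector:
  fixes b :: "nat \<Rightarrow> nat \<Rightarrow> real"
  assumes prim: "primitive_on {..<n} b"
  defines "M \<equiv> mat n n (\<lambda>(i, j). complex_of_real (b i j))"
  shows "\<exists>x. (\<forall>i<n. x i > 0) \<and> (\<forall>i<n. (\<Sum>j<n. b i j * x j) = spectral_radius M * x i)"
proof -
  let ?I = "{..<n}"
  define \<rho> where "\<rho> = spectral_radius M"
  have b0: "\<And>v u. v < n \<Longrightarrow> u < n \<Longrightarrow> b v u \<ge> 0" and n: "n > 0"
    using prim by (auto simp: primitive_on_def)
  obtain k where k: "\<And>v u. v < n \<Longrightarrow> u < n \<Longrightarrow> mpow b ?I k v u > 0"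
    using prim unfolding primitive_on_def by (metis lessThan_iff)
  have M: "M \<in> carrier_mat n n" by (simp add: M_def)
  obtain e where e: "e \<in> spectrum M" "\<rho> = cmod e"
    using spectral_radius_mem_max(1)[OF M n] unfolding \<rho>_def by blast
  have \<rho>0: "\<rho> \<ge> 0" using e by simp
  obtain v where v: "v \<in> carrier_vec n" "v \<noteq> 0\<^sub>v n" "M *\<^sub>v v = e \<cdot>\<^sub>v v"
    using e(1) M by (auto simp: spectrum_def eigenvalue_def eigenvector_def)
  define y where "y i = cmod (v $ i)" for i
  have y0: "y i \<ge> 0" for i by (simp add: y_def)
  obtain i0 where i0: "i0 < n" "y i0 > 0"
    using v(1,2) by (metis carrier_vecD eq_vecI index_zero_vec(1) index_zero_vec(2) y_def zero_less_norm_iff)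
  have ge: "\<rho> * y i \<le> (\<Sum>j<n. b i j * y j)" if i: "i < n" for i
  proof -
    have "e * v $ i = (\<Sum>j<n. of_real (b i j) * v $ j)"
      using arg_cong[OF v(3), of "\<lambda>w. w $ i"] i v(1)
      by (auto simp: M_def scalar_prod_def lessThan_atLeast0 intro!: sum.cong)
    then have "\<rho> * y i = cmod (\<Sum>j<n. of_real (b i j) * v $ j)" by (simp add: e(2) y_def norm_mult[symmetric])
    also have "\<dots> \<le> (\<Sum>j<n. cmod (of_real (b i j) * v $ j))" by (rule norm_sum)
    also have "\<dots> = (\<Sum>j<n. b i j * y j)"
      using b0 i by (auto simp: norm_mult y_def intro!: sum.cong)
    finally show ?thesis .
  qed
  have eq: "(\<Sum>j<n. b i j * y j) = \<rho> * y i" if i: "i < n" for i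
  proof (rule ccontr)
    assume neq: "\<not> ?thesis"
    \<comment> \<open>The defect \<open>w\<close> is nonnegative and positive at \<open>i\<close>.
      Applying the positive \<open>k\<close>-th power to \<open>y\<close> gives a vector
      \<open>z\<close> whose defect is positive in every coordinate.\<close>
    define w where "w i = (\<Sum>j<n. b i j * y j) - \<rho> * y i" for i
    define z where "z i = (\<Sum>j<n. mpow b ?I k i j * y j)" for i
    have w0: "w j \<ge> 0" if "j < n" for j using ge[OF that] by (simp add: w_def)
    have wi: "w i > 0" using neq ge[OF i] by (simp add: w_def)
    have z0: "z j > 0" if "j < n" for j
      unfolding z_def using k[OF that] y0 i0
      by (intro sum_pos2[where i = i0]) (auto simp: less_imp_le)
    have bz: "(\<Sum>u<n. b j u * z u) = \<rho> * z j + (\<Sum>u<n. mpow b ?I k j u * w u)" if j: "j < n" for j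
    proof -
      have "(\<Sum>u<n. b j u * z u) = (\<Sum>t<n. mpow b ?I (Suc k) j t * y t)"
        by (simp add: z_def sum_distrib_left sum_distrib_right mult.assoc) (rule sum.swap)
      also have "\<dots> = (\<Sum>t<n. (\<Sum>u<n. mpow b ?I k j u * b u t) * y t)"
        using j by (intro sum.cong refl arg_cong2[where f = "(*)"] mpow_Suc_right) auto
      also have "\<dots> = (\<Sum>u<n. mpow b ?I k j u * (\<Sum>t<n. b u t * y t))"
        by (simp add: sum_distrib_left sum_distrib_right mult.assoc) (rule sum.swap)
      also have "\<dots> = (\<Sum>u<n. mpow b ?I k j u * (\<rho> * y u + w u))" by (simp add: w_def)
      finally show ?thesis by (simp add: z_def algebra_simps sum.distrib sum_distrib_left)
    qed
    have gt: "(\<Sum>u<n. b j u * z u) > \<rho> * z j" if j: "j < n" for j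
    proof -
      have "(\<Sum>u<n. mpow b ?I k j u * w u) > 0"
        using k[OF j] w0 wi i by (intro sum_pos2[where i = i]) (auto simp: less_imp_le)
      with bz[OF j] show ?thesis by simp
    qed
    \<comment> \<open>Finitely many strict inequalities leave room for a factor
      \<open>s > \<rho>\<close>. With \<open>t\<close> strictly between them, the powers of
      \<open>b / t\<close> are bounded since \<open>t > \<rho>\<close>, but along \<open>z\<close>
      they grow at least like \<open>(s / t) ^ l\<close>.\<close>
    define s where "s = Min ((\<lambda>j. (\<Sum>u<n. b j u * z u) / z j) ` ?I)"
    have s: "s > \<rho>" "\<And>j. j < n \<Longrightarrow> s * z j \<le> (\<Sum>u<n. b j u * z u)"
    proof -
      show "s > \<rho>" unfolding s_def using n gt z0 by (subst Min_gr_iff) (auto simp: field_simps)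
      fix j assume j: "j < n"
      have "s \<le> (\<Sum>u<n. b j u * z u) / z j" unfolding s_def using j by (intro Min_le) auto
      then show "s * z j \<le> (\<Sum>u<n. b j u * z u)" using z0[OF j] by (simp add: field_simps)
    qed
    define t where "t = (\<rho> + s) / 2"
    have t: "t > \<rho>" "t > 0" "s > t" using s(1) \<rho>0 by (auto simp: t_def)
    define N where "N = complex_of_real (1 / t) \<cdot>\<^sub>m M"
    have N: "N \<in> carrier_mat n n" using M by (simp add: N_def)
    obtain c where c: "\<And>k. norm_bound (N ^\<^sub>m k) c"
      using spectral_radius_jnf_norm_bound_less_1_upper_triangular[OF N]
        spectral_radius_smult_less_1[OF M n] t unfolding N_def \<rho>_def by blast
    have growth: "s ^ l * z j \<le> (\<Sum>u<n. mpow b ?I l j u * z u)" if "j < n" for j l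
      using that
    proof (induction l arbitrary: j)
      case 0
      then show ?case by (simp add: sum_ident_mult)
    next
      case (Suc l)
      have "s ^ Suc l * z j = s ^ l * (s * z j)" by simp
      also have "\<dots> \<le> s ^ l * (\<Sum>u<n. b j u * z u)"
        using s t Suc.prems by (intro mult_left_mono) auto
      also have "\<dots> = (\<Sum>u<n. b j u * (s ^ l * z u))" by (simp add: sum_distrib_left mult_ac)
      also have "\<dots> \<le> (\<Sum>u<n. b j u * (\<Sum>r<n. mpow b ?I l u r * z r))"
        using b0 Suc by (intro sum_mono mult_left_mono) auto
      also have "\<dots> = (\<Sum>r<n. mpow b ?I (Suc l) j r * z r)"
        by (simp add: sum_distrib_left sum_distrib_right mult.assoc) (rule sum.swap)
      finally show ?case .
    qed
    have entry: "(N ^\<^sub>m l) $$ (i, u) = complex_of_real (mpow b ?I l i u / t ^ l)" if "u < n" for l u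
    proof -
      have Nre: "N = map_mat complex_of_real (mat n n (\<lambda>(i, j). b i j / t))"
        by (rule eq_matI) (auto simp: N_def M_def)
      let ?R = "mat n n (\<lambda>(i, j). b i j / t) :: real mat"
      have R: "?R \<in> carrier_mat n n" by simp
      have "N ^\<^sub>m l = map_mat complex_of_real (?R ^\<^sub>m l)"
        unfolding Nre by (rule of_real_hom.mat_hom_pow[OF R, symmetric])
      then have "(N ^\<^sub>m l) $$ (i, u) = complex_of_real ((?R ^\<^sub>m l) $$ (i, u))"
        using i that pow_carrier_mat[OF R, of l] by simp
      also have "(?R ^\<^sub>m l) $$ (i, u) = mpow (\<lambda>i j. ?R $$ (i, j)) ?I l i u"
        using mat_pow_eq_mpow[OF R i that, of "\<lambda>x. x"] by simp
      also have "\<dots> = mpow (\<lambda>i j. (1 / t) * b i j) ?I l i u"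
      proof -
        have "mpow (\<lambda>i j. ?R $$ (i, j)) ?I l i' u = mpow (\<lambda>i j. (1 / t) * b i j) ?I l i' u" if "i' < n" for i'
          using that by (induction l arbitrary: i') (auto intro!: sum.cong)
        then show ?thesis using i by blast
      qed
      finally show ?thesis unfolding mpow_scale by (simp add: field_simps)
    qed
    define Z where "Z = (\<Sum>u<n. c * z u)"
    have bound: "(s / t) ^ l * z i \<le> Z" for l
    proof -
      have "mpow b ?I l i u / t ^ l \<le> c" if "u < n" for u
      proof -
        have "cmod ((N ^\<^sub>m l) $$ (i, u)) \<le> c"
          using c[of l] carrier_matD[OF pow_carrier_mat[OF N, of l]] i that
          unfolding norm_bound_def by metis
        then show ?thesis unfolding entry[OF that] norm_of_real by linarith
      qed
      then have "(\<Sum>u<n. mpow b ?I l i u / t ^ l * z u) \<le> Z"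
        unfolding Z_def using z0 by (intro sum_mono mult_right_mono) (auto simp: less_imp_le)
      moreover have "s ^ l * z i / t ^ l \<le> (\<Sum>u<n. mpow b ?I l i u / t ^ l * z u)"
        using divide_right_mono[OF growth[OF i, of l], of "t ^ l"] t by (simp add: sum_divide_distrib)
      ultimately show ?thesis by (simp add: power_divide)
    qed
    obtain l where "Z / z i < (s / t) ^ l"
      using real_arch_pow[of "s / t" "Z / z i"] t by auto
    then show False using bound[of l] z0[OF i] by (simp add: field_simps)
  qed
  \<comment> \<open>So far only the coordinate \<open>i0\<close> is known to be positive; the
    positive \<open>k\<close>-th power spreads this to all coordinates.\<close>
  have "y i > 0" if i: "i < n" for i
  proof -
    have "(\<Sum>u<n. mpow b ?I k i u * y u) = \<rho> ^ k * y i"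
      using mpow_eigen[of ?I b y \<rho> i k] eq i by auto
    moreover have "(\<Sum>u<n. mpow b ?I k i u * y u) > 0"
      using k[OF i] y0 i0 by (intro sum_pos2[where i = i0]) (auto simp: less_imp_le)
    ultimately show ?thesis using y0[of i] by (cases "y i = 0") auto
  qed
  with eq show ?thesis unfolding \<rho>_def by blast
qed

lemma primitive_on_cong:
  assumes "\<And>v u. v \<in> I \<Longrightarrow> u \<in> I \<Longrightarrow> a v u = b v u" "primitive_on I a"
  shows "primitive_on I b"
proof -
  have "mpow a I k v u = mpow b I k v u" if "v \<in> I" "u \<in> I" for k v u
    using that by (induction k arbitrary: v) (auto intro!: sum.cong simp: assms(1))
  then show ?thesis using assms unfolding primitive_on_def by metis
qed

section \<open>Transfer to the diagonal blocks of a matrix\<close>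

lemma bij_betw_pick: "finite I \<Longrightarrow> bij_betw (pick I) {..<card I} I"
proof -
  assume fin: "finite I"
  have inj: "inj_on (pick I) {..<card I}"
    by (rule inj_onI) (metis lessThan_iff nat_neq_iff pick_mono_le)
  have "pick I ` {..<card I} \<subseteq> I" by (auto simp: pick_in_set_le)
  then have "pick I ` {..<card I} = I" using card_subset_eq[OF fin] card_image[OF inj] by simp
  with inj show ?thesis by (simp add: bij_betw_def)
qed

lemma block_eq_mat:
  assumes "A \<in> carrier_mat N N" "I \<subseteq> {..<N}"
  shows "block A I = mat (card I) (card I) (\<lambda>(i, j). A $$ (pick I i, pick I j))"
proof -
  have "{i. i < N \<and> i \<in> I} = I" using assms(2) by auto
  then show ?thesis using assms(1) unfolding submatrix_def by auto
qed

lemma primitive_block: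
  assumes A: "A \<in> carrier_mat N N" "I \<subseteq> {..<N}" "I \<noteq> {}" and prim: "primitive (block A I)"
  shows "primitive_on I (\<lambda>v u. real (A $$ (v, u)))"
proof -
  let ?n = "card I" and ?a = "\<lambda>v u. real (A $$ (v, u))"
  have fin: "finite I" using A(2) finite_subset by blast
  note bij = bij_betw_pick[OF fin]
  have B: "block A I \<in> carrier_mat ?n ?n" unfolding block_eq_mat[OF A(1,2)] by simp
  obtain k where k: "k \<ge> 1" "\<And>i j. i < ?n \<Longrightarrow> j < ?n \<Longrightarrow> (block A I ^\<^sub>m k) $$ (i, j) > 0"
    using prim B unfolding primitive_def by auto
  have "mpow ?a I k v u > 0" if vu: "v \<in> I" "u \<in> I" for v u
  proof -
    obtain i j where ij: "i < ?n" "pick I i = v" "j < ?n" "pick I j = u"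
      using vu bij unfolding bij_betw_def by (metis imageE lessThan_iff)
    have "mpow (\<lambda>i j. real (block A I $$ (i, j))) {..<?n} l i' j = mpow (\<lambda>i j. ?a (pick I i) (pick I j)) {..<?n} l i' j"
      if "i' < ?n" for l i'
      using that by (induction l arbitrary: i') (auto simp: block_eq_mat[OF A(1,2)] intro!: sum.cong)
    then have "real ((block A I ^\<^sub>m k) $$ (i, j)) = mpow ?a I k v u"
      using mat_pow_eq_mpow[OF B ij(1,3), of real k] mpow_reindex[OF bij fin, of i j ?a k] ij by simp
    then show ?thesis using k(2)[OF ij(1,3)] by linarith
  qed
  with k(1) A(3) fin show ?thesis unfolding primitive_on_def by auto
qed

lemma map_block:
  assumes "A \<in> carrier_mat N N" "I \<subseteq> {..<N}"
  shows "map_mat of_nat (block A I) =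
    mat (card I) (card I) (\<lambda>(i, j). complex_of_real (real (A $$ (pick I i, pick I j))))"
  unfolding block_eq_mat[OF assms] by (rule eq_matI) auto

text \<open>\<open>class_radius\<close> is defined through the renumbered block, while masses are
  indexed by vertices; the eigenvector is carried back along the inverse of
  \<open>pick\<close>.\<close>

lemma class_perron_vector:
  assumes A: "A \<in> carrier_mat N N" "I \<subseteq> {..<N}" and prim: "primitive_on I (\<lambda>v u. real (A $$ (v, u)))"
  shows "\<exists>x. (\<forall>v\<in>I. x v > 0) \<and> (\<forall>v\<in>I. (\<Sum>u\<in>I. real (A $$ (v, u)) * x u) = class_radius A I * x v)"
proof -
  let ?n = "card I" and ?a = "\<lambda>v u. real (A $$ (v, u))"
  have fin: "finite I" using A(2) finite_subset by blast
  note bij = bij_betw_pick[OF fin]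
  have pick: "i < ?n \<Longrightarrow> pick I i \<in> I" for i using bij by (auto simp: bij_betw_def)
  obtain k where k: "k \<ge> 1" "\<And>v u. v \<in> I \<Longrightarrow> u \<in> I \<Longrightarrow> mpow ?a I k v u > 0"
    using prim unfolding primitive_on_def by metis
  let ?b = "\<lambda>i j. ?a (pick I i) (pick I j)"
  have "mpow ?b {..<?n} k i j > 0" if "i < ?n" "j < ?n" for i j
    using mpow_reindex[OF bij fin, of i j ?a k] k(2) pick that by simp
  moreover have "?n > 0" using prim by (auto simp: primitive_on_def card_gt_0_iff)
  ultimately have "primitive_on {..<?n} ?b"
    using k(1) unfolding primitive_on_def by (intro conjI exI[of _ k]) auto
  from perron_vector[OF this] obtain y where y: "\<And>i. i < ?n \<Longrightarrow> y i > 0"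
    "\<And>i. i < ?n \<Longrightarrow> (\<Sum>j<?n. ?b i j * y j) = class_radius A I * y i"
    unfolding class_radius_def map_block[OF A] by blast
  define h where "h = the_inv_into {..<?n} (pick I)"
  have h: "h v < ?n" "pick I (h v) = v" if "v \<in> I" for v
    using that bij the_inv_into_into[of "pick I" "{..<?n}" v] f_the_inv_into_f[of "pick I" "{..<?n}" v]
    by (auto simp: h_def bij_betw_def)
  have hp: "h (pick I i) = i" if "i < ?n" for i
    using that bij unfolding h_def by (auto simp: bij_betw_def intro: the_inv_into_f_f)
  have "(\<Sum>u\<in>I. ?a v u * y (h u)) = class_radius A I * y (h v)" if "v \<in> I" for v
    using sum.reindex_bij_betw[OF bij, of "\<lambda>u. ?a v u * y (h u)"] y(2)[OF h(1)[OF that]] h(2)[OF that] hp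
    by simp
  with y(1) h(1) show ?thesis by (intro exI[of _ "\<lambda>v. y (h v)"]) auto
qed

lemma class_radius_nonneg:
  assumes "A \<in> carrier_mat N N" "I \<subseteq> {..<N}" "I \<noteq> {}"
  shows "class_radius A I \<ge> 0"
proof -
  have "card I > 0" using assms finite_subset by (auto simp: card_gt_0_iff)
  then show ?thesis
    using spectral_radius_mem_max(1)[of "map_mat of_nat (block A I)" "card I"]
    unfolding class_radius_def map_block[OF assms(1,2)] by auto
qed

lemma class_radius_zero_block:
  assumes "A \<in> carrier_mat N N" "I \<subseteq> {..<N}" "I \<noteq> {}" "\<And>v u. v \<in> I \<Longrightarrow> u \<in> I \<Longrightarrow> A $$ (v, u) = 0"
  shows "class_radius A I = 0"
proof -
  let ?n = "card I"
  have fin: "finite I" using assms(2) finite_subset by blast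
  have n: "?n > 0" using assms fin by (auto simp: card_gt_0_iff)
  have "pick I i \<in> I" if "i < ?n" for i using that bij_betw_pick[OF fin] by (auto simp: bij_betw_def)
  then have M: "map_mat of_nat (block A I) = (0\<^sub>m ?n ?n :: complex mat)"
    unfolding map_block[OF assms(1,2)] using assms(4) by (intro eq_matI) auto
  obtain e where e: "e \<in> spectrum (0\<^sub>m ?n ?n)" "class_radius A I = cmod e"
    using spectral_radius_mem_max(1)[of "0\<^sub>m ?n ?n" ?n] n unfolding class_radius_def M by auto
  obtain v where v: "v \<in> carrier_vec ?n" "v \<noteq> 0\<^sub>v ?n" "0\<^sub>m ?n ?n *\<^sub>v v = e \<cdot>\<^sub>v v"
    using e(1) by (auto simp: spectrum_def eigenvalue_def eigenvector_def)
  obtain i where i: "i < ?n" "v $ i \<noteq> 0"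
    using v(1,2) by (metis carrier_vecD eq_vecI index_zero_vec(1) index_zero_vec(2))
  have "0 = e * v $ i" using arg_cong[OF v(3), of "\<lambda>w. w $ i"] v(1) i by simp
  with i e show ?thesis by simp
qed

section \<open>Paths and cylinders of a stationary diagram\<close>

definition graft :: "(nat \<Rightarrow> 'e) \<Rightarrow> nat \<Rightarrow> (nat \<Rightarrow> 'e) \<Rightarrow> nat \<Rightarrow> 'e" where
  "graft x n y i = (if i < n then x i else y i)"

locale diagram =
  fixes B :: "('v, 'e) bratteli"
  assumes diagram: "bratteli_diagram B"
begin

abbreviation "X \<equiv> path_space B"
abbreviation "cyl \<equiv> cylinder B"

definition out :: "nat \<Rightarrow> 'v \<Rightarrow> 'e set" where
  "out n v = {e \<in> edges B n. src B e = v}"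

lemma finite_edges: "finite (edges B n)"
  and src_edges: "src B ` edges B n = verts B n" and rng_edges: "rng B ` edges B n = verts B (Suc n)"
  using diagram by (auto simp: bratteli_diagram_def)

lemma verts_disjoint: "v \<in> verts B n \<Longrightarrow> v \<in> verts B m \<Longrightarrow> n = m"
proof (rule ccontr)
  assume "v \<in> verts B n" "v \<in> verts B m" "n \<noteq> m"
  moreover have "disjoint_family (verts B)" using diagram by (simp add: bratteli_diagram_def)
  ultimately show False using disjoint_family_onD[of "verts B" UNIV n m] by auto
qed

lemma finite_out: "finite (out n v)"
  using finite_edges by (simp add: out_def)

lemma pathD: "x \<in> X \<Longrightarrow> x n \<in> edges B n" "x \<in> X \<Longrightarrow> rng B (x n) = src B (x (Suc n))"
  by (auto simp: path_space_def)

lemma src_path: "x \<in> X \<Longrightarrow> src B (x n) \<in> verts B n"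
  using pathD(1)[of x n] src_edges by blast

lemma src_path_0: "x \<in> X \<Longrightarrow> y \<in> X \<Longrightarrow> src B (x 0) = src B (y 0)"
  using src_path[of x 0] src_path[of y 0] diagram by (auto simp: bratteli_diagram_def)

lemma graft_path:
  assumes "x \<in> X" "y \<in> X" "src B (x n) = src B (y n)"
  shows "graft x n y \<in> X"
  unfolding path_space_def graft_def
proof (clarify, intro conjI)
  fix i
  show "(if i < n then x i else y i) \<in> edges B i" using assms pathD by auto
  show "rng B (if i < n then x i else y i) = src B (if Suc i < n then x (Suc i) else y (Suc i))"
    using assms pathD(2)[of x i] pathD(2)[of y i] by (cases "Suc i = n") auto
qed

lemma graft_simps [simp]: "i < n \<Longrightarrow> graft x n y i = x i" "i \<ge> n \<Longrightarrow> graft x n y i = y i"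
  by (auto simp: graft_def)

lemma graft_graft: "graft x n (graft y n z) = graft x n z" "graft x n x = x"
  by (auto simp: graft_def)

lemma cyl_subset: "cyl x n \<subseteq> X"
  by (auto simp: cylinder_def)

lemma in_cylD: "y \<in> cyl x n \<Longrightarrow> y \<in> X"
  by (simp add: cylinder_def)

lemma in_cyl_self: "x \<in> X \<Longrightarrow> x \<in> cyl x n"
  by (simp add: cylinder_def)

lemma cyl_eq: "y \<in> cyl x n \<Longrightarrow> cyl y n = cyl x n"
  by (auto simp: cylinder_def)

lemma cyl_antimono: "m \<le> n \<Longrightarrow> cyl x n \<subseteq> cyl x m"
  by (auto simp: cylinder_def)

lemma cyl_inter: "m \<le> n \<Longrightarrow> cyl x m \<inter> cyl y n = (if \<forall>i<m. x i = y i then cyl y n else {})"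
  by (auto simp: cylinder_def)

lemma cyl_0: "cyl x 0 = X"
  by (auto simp: cylinder_def)

lemma in_cyl_src:
  assumes "y \<in> cyl x n" "x \<in> X"
  shows "src B (y n) = src B (x n)"
proof (cases n)
  case 0
  then show ?thesis using assms src_path_0[of y x] cyl_subset by auto
next
  case (Suc m)
  have "y m = x m" "y \<in> X" using assms Suc by (auto simp: cylinder_def)
  then show ?thesis using pathD(2)[of y m] pathD(2)[OF assms(2), of m] Suc by simp
qed

lemma graft_in_cyl:
  assumes "x \<in> X" "y \<in> X" "src B (x n) = src B (y n)"
  shows "graft x n y \<in> cyl x n"
  using graft_path[OF assms] by (simp add: cylinder_def)

text \<open>\<open>g\<close> is constrained only from level \<open>n\<close> on, so that any
  suitable prefix can be put in front of it. Dependent choice succeeds because every vertex emits an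
  edge.\<close>

lemma tail_path_exists:
  assumes "v \<in> verts B n"
  shows "\<exists>g. src B (g n) = v \<and> (\<forall>i\<ge>n. g i \<in> edges B i \<and> rng B (g i) = src B (g (Suc i)))"
proof -
  have "\<exists>f. \<forall>k. (f k \<in> edges B (n + k) \<and> (k = 0 \<longrightarrow> src B (f k) = v)) \<and> rng B (f k) = src B (f (Suc k))"
  proof (rule dependent_nat_choice)
    have "v \<in> src B ` edges B n" using assms src_edges by simp
    then show "\<exists>e. e \<in> edges B (n + 0) \<and> (0 = 0 \<longrightarrow> src B e = v)" by auto
  next
    fix e k assume "e \<in> edges B (n + k) \<and> (k = 0 \<longrightarrow> src B e = v)"
    then have "rng B e \<in> src B ` edges B (n + Suc k)" using rng_edges[of "n + k"] src_edges[of "n + Suc k"] by auto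
    then show "\<exists>e'. (e' \<in> edges B (n + Suc k) \<and> (Suc k = 0 \<longrightarrow> src B e' = v)) \<and> rng B e = src B e'" by auto
  qed
  then obtain f where f: "\<And>k. f k \<in> edges B (n + k)" "src B (f 0) = v" "\<And>k. rng B (f k) = src B (f (Suc k))"
    by blast
  show ?thesis
    using f(1,3)[of "_ - n"] f(2) by (intro exI[of _ "\<lambda>i. f (i - n)"]) (auto simp: Suc_diff_le, metis le_add_diff_inverse)
qed

lemma path_extend:
  assumes "x \<in> X" "e \<in> out n (src B (x n))"
  shows "\<exists>y\<in>cyl x n. y n = e"
proof -
  have "rng B e \<in> verts B (Suc n)" using assms(2) rng_edges by (auto simp: out_def)
  then obtain g where g: "src B (g (Suc n)) = rng B e" "\<And>i. i \<ge> Suc n \<Longrightarrow> g i \<in> edges B i"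
    "\<And>i. i \<ge> Suc n \<Longrightarrow> rng B (g i) = src B (g (Suc i))"
    using tail_path_exists by meson
  define y where "y i = (if i < n then x i else if i = n then e else g i)" for i
  have "y i \<in> edges B i \<and> rng B (y i) = src B (y (Suc i))" for i
    using assms g(1) g(2)[of i] g(3)[of i] pathD(1)[OF assms(1), of i] pathD(2)[OF assms(1), of i]
    by (cases "Suc i = n") (auto simp: y_def out_def)
  moreover have "y n = e" "\<forall>i<n. y i = x i" by (simp_all add: y_def)
  ultimately show ?thesis by (intro bexI[of _ y]) (simp_all add: cylinder_def path_space_def)
qed

lemma path_through: "v \<in> verts B n \<Longrightarrow> \<exists>x\<in>X. src B (x n) = v"
proof (induction n arbitrary: v)
  case 0
  then show ?case using tail_path_exists[OF 0] by (auto simp: path_space_def)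
next
  case (Suc n)
  then have "v \<in> rng B ` edges B n" by (simp add: rng_edges)
  then obtain e where e: "e \<in> edges B n" "rng B e = v" by auto
  then have "src B e \<in> verts B n" using src_edges[of n] by blast
  then obtain x where x: "x \<in> X" "src B (x n) = src B e" using Suc.IH by metis
  then obtain y where "y \<in> cyl x n" "y n = e" using path_extend[of x e n] e by (auto simp: out_def)
  then show ?case using pathD(2)[of y n] in_cylD[of y x n] e by (intro bexI[of _ y]) auto
qed

lemma path_space_nonempty: "X \<noteq> {}"
proof -
  obtain v where "v \<in> verts B 0" using diagram by (auto simp: bratteli_diagram_def)
  then show ?thesis using path_through by blast
qed

text \<open>A canonical element of each cylinder of length \<open>n\<close>, so that sums over finite paths become
  sums over \<open>Rep n\<close>.\<close>

definition rep :: "nat \<Rightarrow> (nat \<Rightarrow> 'e) \<Rightarrow> nat \<Rightarrow> 'e" where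
  "rep n x = (SOME y. y \<in> cyl x n)"

definition Rep :: "nat \<Rightarrow> (nat \<Rightarrow> 'e) set" where
  "Rep n = rep n ` X"

lemma rep_in_cyl: "x \<in> X \<Longrightarrow> rep n x \<in> cyl x n"
  unfolding rep_def by (rule someI[of "\<lambda>y. y \<in> cyl x n"]) (rule in_cyl_self)

lemma rep_cong: "y \<in> cyl x n \<Longrightarrow> rep n y = rep n x"
  unfolding rep_def by (simp add: cyl_eq)

lemma Rep_subset: "Rep n \<subseteq> X"
  using subsetD[OF cyl_subset rep_in_cyl] by (auto simp: Rep_def)

lemma finite_Rep: "finite (Rep n)"
proof -
  have "Rep n \<subseteq> (\<lambda>w. SOME y. y \<in> cyl w n) ` (\<Pi>\<^sub>E i\<in>{..<n}. edges B i)"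
  proof
    fix d assume "d \<in> Rep n"
    then obtain x where x: "x \<in> X" "d = rep n x" by (auto simp: Rep_def)
    have "cyl (restrict x {..<n}) n = cyl x n" by (auto simp: cylinder_def)
    then show "d \<in> (\<lambda>w. SOME y. y \<in> cyl w n) ` (\<Pi>\<^sub>E i\<in>{..<n}. edges B i)"
      using x pathD(1) by (intro image_eqI[of _ _ "restrict x {..<n}"]) (auto simp: rep_def)
  qed
  then show ?thesis by (rule finite_subset) (auto intro!: finite_PiE finite_imageI finite_edges)
qed

lemma Rep_cyl_cover: "(\<Union>d\<in>Rep n. cyl d n) = X"
proof
  show "X \<subseteq> (\<Union>d\<in>Rep n. cyl d n)"
    using rep_in_cyl in_cyl_self cyl_eq by (fastforce simp: Rep_def)
qed (auto simp: cylinder_def)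

lemma Rep_cyl_disjoint: "disjoint_family_on (\<lambda>d. cyl d n) (Rep n)"
proof -
  have "d = d'" if "d \<in> Rep n" "d' \<in> Rep n" "y \<in> cyl d n" "y \<in> cyl d' n" for d d' y
  proof -
    obtain x x' where x: "d = rep n x" "x \<in> X" "d' = rep n x'" "x' \<in> X" using \<open>d \<in> Rep n\<close> \<open>d' \<in> Rep n\<close> by (auto simp: Rep_def)
    have "y \<in> cyl x n" "y \<in> cyl x' n"
      using that cyl_eq[OF rep_in_cyl[OF x(2)]] cyl_eq[OF rep_in_cyl[OF x(4)]] x by auto
    then show ?thesis using rep_cong[of y x n] rep_cong[of y x' n] x by simp
  qed
  then show ?thesis by (auto simp: disjoint_family_on_def)
qed

lemma cyl_Rep: "x \<in> X \<Longrightarrow> \<exists>d\<in>Rep n. cyl x n = cyl d n"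
  using rep_in_cyl[of x n] cyl_eq[of "rep n x" x n] unfolding Rep_def by (intro bexI[of _ "rep n x"]) auto

section \<open>Topology and Borel sets of the path space\<close>

definition cylinders :: "(nat \<Rightarrow> 'e) set set" where
  "cylinders = {cyl x n | x n. x \<in> X}"

lemma countable_cylinders: "countable cylinders"
proof -
  have "cylinders \<subseteq> (\<Union>n. (\<lambda>d. cyl d n) ` Rep n)" 
  proof
    fix c assume "c \<in> cylinders"
    then obtain x n where x: "x \<in> X" "c = cyl x n" by (auto simp: cylinders_def)
    from cyl_Rep[OF x(1), of n] x(2) show "c \<in> (\<Union>n. (\<lambda>d. cyl d n) ` Rep n)" by auto
  qed
  moreover have "countable (\<Union>n. (\<lambda>d. cyl d n) ` Rep n)"
    by (rule countable_UN) (auto intro: countable_finite finite_Rep)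
  ultimately show ?thesis by (rule countable_subset)
qed

text \<open>The cylinders are introduced as a subbase but form a base: those around a given point
  are nested, so the longer of two lies in their intersection.\<close>

lemma open_cylinders:
  assumes "openin (path_topology B) U"
  shows "U \<subseteq> X" "x \<in> U \<Longrightarrow> \<exists>n. cyl x n \<subseteq> U"
proof -
  have "generate_topology_on {cyl x n |x n. True} U"
    using assms by (simp add: path_topology_def openin_topology_generated_by_iff)
  then have "U \<subseteq> X \<and> (\<forall>x\<in>U. \<exists>n. cyl x n \<subseteq> U)"
  proof induction
    case (Int a b)
    have "\<exists>n. cyl x n \<subseteq> a \<inter> b" if "x \<in> a \<inter> b" for x
    proof -
      have x: "x \<in> a" "x \<in> b" using that by auto
      obtain n where "cyl x n \<subseteq> a" using Int.IH(1) x(1) by auto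
      moreover obtain m where "cyl x m \<subseteq> b" using Int.IH(2) x(2) by auto
      ultimately have "cyl x (max n m) \<subseteq> a \<inter> b"
        using cyl_antimono[of n "max n m" x] cyl_antimono[of m "max n m" x] by auto
      then show ?thesis ..
    qed
    with Int show ?case by blast
  next
    case (UN K)
    have "\<exists>n. cyl x n \<subseteq> \<Union>K" if x: "x \<in> \<Union>K" for x
    proof -
      obtain k where k: "k \<in> K" "x \<in> k" using x by auto
      then obtain n where "cyl x n \<subseteq> k" using UN.IH by blast
      with k show ?thesis by blast
    qed
    moreover have "\<Union>K \<subseteq> X" using UN.IH by (intro Union_least) simp
    ultimately show ?case by simp
  next
    case (Basis s)
    then obtain y n where "s = cyl y n" by auto
    then show ?case using cyl_eq[of _ y n] cyl_subset[of y n] by (intro conjI ballI exI[of _ n]) simp_all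
  qed auto
  then show "U \<subseteq> X" "x \<in> U \<Longrightarrow> \<exists>n. cyl x n \<subseteq> U" by auto
qed

lemma open_cyl: "openin (path_topology B) (cyl x n)"
  unfolding path_topology_def by (rule topology_generated_by_Basis) auto

lemma space_borel [simp]: "space (path_borel B) = X"
  and sets_path_borel: "sets (path_borel B) = sigma_sets X {U. openin (path_topology B) U}"
  using open_cylinders(1) by (auto simp: path_borel_def space_measure_of_conv sets_measure_of_conv)

lemma open_in_sets: "openin (path_topology B) U \<Longrightarrow> U \<in> sets (path_borel B)"
  by (auto simp: sets_path_borel)

lemma cyl_in_sets [measurable]: "cyl x n \<in> sets (path_borel B)"
  by (rule open_in_sets[OF open_cyl])

text \<open>Each open set is a union of cylinders, and there are only countably many
  cylinders.\<close>

lemma sets_borel: "sets (path_borel B) = sigma_sets X cylinders"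
proof
  show "sigma_sets X cylinders \<subseteq> sets (path_borel B)"
  proof -
    have "cylinders \<subseteq> sets (path_borel B)" using cyl_in_sets by (auto simp: cylinders_def)
    from sets.sigma_sets_subset[OF this] show ?thesis by simp
  qed
  have "U \<in> sigma_sets X cylinders" if U: "openin (path_topology B) U" for U
  proof -
    have "U = \<Union>{c \<in> cylinders. c \<subseteq> U}"
      using open_cylinders[OF U] in_cyl_self by (auto simp: cylinders_def) (metis in_cyl_self subsetD)
    moreover have "\<Union>{c \<in> cylinders. c \<subseteq> U} \<in> sigma_sets X cylinders"
      by (rule sigma_sets_UNION) (auto intro: countable_subset[OF _ countable_cylinders] sigma_sets.Basic)
    ultimately show ?thesis by simp
  qed
  then show "sets (path_borel B) \<subseteq> sigma_sets X cylinders"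
    unfolding sets_path_borel by (intro sigma_sets_mono) auto
qed

lemma measurable_prefix:
  assumes "\<And>x y. x \<in> X \<Longrightarrow> y \<in> cyl x n \<Longrightarrow> h y = h x"
  shows "h \<in> path_borel B \<rightarrow>\<^sub>M count_space UNIV"
proof (rule measurableI)
  fix S
  have "h -` S \<inter> X = (\<Union>d\<in>{d \<in> Rep n. h d \<in> S}. cyl d n)" (is "?l = ?r")
  proof
    show "?l \<subseteq> ?r"
    proof
      fix x assume x: "x \<in> ?l"
      then have "rep n x \<in> Rep n" "x \<in> cyl (rep n x) n"
        using rep_in_cyl[of x n] cyl_eq[of "rep n x" x n] in_cyl_self[of x n] by (auto simp: Rep_def)
      moreover have "h (rep n x) = h x" using assms[of x "rep n x"] x rep_in_cyl by auto
      ultimately show "x \<in> ?r" using x by auto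
    qed
    show "?r \<subseteq> ?l" using assms Rep_subset cyl_subset by fastforce
  qed
  then show "h -` S \<inter> space (path_borel B) \<in> sets (path_borel B)"
    using finite_Rep by (auto intro!: sets.finite_UN)
qed auto

lemma measurable_prefix_borel:
  fixes h :: "(nat \<Rightarrow> 'e) \<Rightarrow> 'b :: topological_space"
  assumes "\<And>x y. x \<in> X \<Longrightarrow> y \<in> cyl x n \<Longrightarrow> h y = h x"
  shows "h \<in> path_borel B \<rightarrow>\<^sub>M borel"
  using measurable_compose[OF measurable_prefix[of n h], of "\<lambda>x. x" borel] assms by simp

lemma measurable_coordinate: "(\<lambda>x. x i) \<in> path_borel B \<rightarrow>\<^sub>M count_space UNIV"
  by (rule measurable_prefix[of "Suc i"]) (auto simp: cylinder_def)

lemma measurable_into_borel: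
  assumes "f \<in> space M \<rightarrow> X" "\<And>x n. x \<in> X \<Longrightarrow> f -` cyl x n \<inter> space M \<in> sets M"
  shows "f \<in> M \<rightarrow>\<^sub>M path_borel B"
  by (rule measurable_sigma_sets[OF sets_borel]) (use assms in \<open>auto simp: cylinders_def cylinder_def\<close>)

lemma emeasure_Rep_sum:
  assumes "sets M = sets (path_borel B)" "E \<in> sets M"
  shows "emeasure M E = (\<Sum>d\<in>Rep n. emeasure M (cyl d n \<inter> E))"
proof -
  have "E \<subseteq> X" using sets.sets_into_space[OF assms(2)] sets_eq_imp_space_eq[OF assms(1)] by simp
  then have "E = (\<Union>d\<in>Rep n. cyl d n \<inter> E)" using Rep_cyl_cover[of n] by auto
  also have "emeasure M \<dots> = (\<Sum>d\<in>Rep n. emeasure M (cyl d n \<inter> E))"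
  proof (rule sum_emeasure[symmetric])
    show "disjoint_family_on (\<lambda>d. cyl d n \<inter> E) (Rep n)"
      by (rule disjoint_family_on_bisimulation[OF Rep_cyl_disjoint]) blast
  qed (use assms finite_Rep in auto)
  finally show ?thesis .
qed

text \<open>The event \<open>E\<close> is carried along for \<open>class_measure_finite\<close>,
  which counts only the paths lying in the class at a given later level; elsewhere it is the whole
  space.\<close>

lemma emeasure_out_sum:
  assumes "sets M = sets (path_borel B)" "E \<in> sets M" "x \<in> X"
  shows "emeasure M (cyl x n \<inter> E) = (\<Sum>e\<in>out n (src B (x n)). emeasure M ({y \<in> cyl x n. y n = e} \<inter> E))"
proof -
  have *: "{y \<in> cyl x n. y n = e} \<in> sets M" for e
  proof -
    have "(\<lambda>y. y n) -` {e} \<inter> space (path_borel B) \<in> sets (path_borel B)"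
      by (rule measurable_sets[OF measurable_coordinate]) auto
    then have "cyl x n \<inter> ((\<lambda>y. y n) -` {e} \<inter> X) \<in> sets (path_borel B)" by auto
    moreover have "cyl x n \<inter> ((\<lambda>y. y n) -` {e} \<inter> X) = {y \<in> cyl x n. y n = e}" using cyl_subset by auto
    ultimately show ?thesis using assms(1) by simp
  qed
  have "y n \<in> out n (src B (x n))" if "y \<in> cyl x n" for y
    using in_cyl_src[OF that assms(3)] pathD(1)[of y n] that cyl_subset by (auto simp: out_def)
  then have "cyl x n \<inter> E = (\<Union>e\<in>out n (src B (x n)). {y \<in> cyl x n. y n = e} \<inter> E)" by auto
  also have "emeasure M \<dots> = (\<Sum>e\<in>out n (src B (x n)). emeasure M ({y \<in> cyl x n. y n = e} \<inter> E))"
    using assms * finite_out by (intro sum_emeasure[symmetric]) (auto simp: disjoint_family_on_def)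
  finally show ?thesis .
qed

lemma cyl_Suc: "y \<in> cyl x n \<Longrightarrow> {z \<in> cyl x n. z n = y n} = cyl y (Suc n)"
  by (auto simp: cylinder_def less_Suc_eq)

end

section \<open>Vertex numbers and edge counts in a stationary diagram\<close>

locale stationary_diagram = diagram B for B :: "('v, 'e) bratteli" +
  fixes N :: nat and \<nu> :: "nat \<Rightarrow> nat \<Rightarrow> 'v"
  assumes stationary: "stationary B N \<nu>"
begin

text \<open>Meaningful only for \<open>n \<ge> 1\<close>, since nothing is known about
  \<open>\<nu> 0\<close>; hence the many conditions \<open>n \<ge> 1\<close> below.\<close>

definition lab :: "(nat \<Rightarrow> 'e) \<Rightarrow> nat \<Rightarrow> nat" where
  "lab x n = the_inv_into {..<N} (\<nu> n) (src B (x n))"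

text \<open>The transposed entry: the first index is the source, so that products of
  \<open>adj\<close> follow the direction of a path.\<close>

definition adj :: "nat \<Rightarrow> nat \<Rightarrow> nat" where
  "adj v u = incidence_matrix B N \<nu> 1 $$ (u, v)"

lemma numbering: "n \<ge> 1 \<Longrightarrow> bij_betw (\<nu> n) {..<N} (verts B n)"
  using stationary by (simp add: stationary_def)

lemma lab_less: "x \<in> X \<Longrightarrow> n \<ge> 1 \<Longrightarrow> lab x n < N"
  and numbering_lab: "x \<in> X \<Longrightarrow> n \<ge> 1 \<Longrightarrow> \<nu> n (lab x n) = src B (x n)"
  using numbering[of n] src_path[of x n] the_inv_into_into[of "\<nu> n" "{..<N}" "src B (x n)"]
    f_the_inv_into_f[of "\<nu> n" "{..<N}" "src B (x n)"]
  by (auto simp: lab_def bij_betw_def)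

lemma lab_eq_iff: "x \<in> X \<Longrightarrow> y \<in> X \<Longrightarrow> n \<ge> 1 \<Longrightarrow> lab x n = lab y n \<longleftrightarrow> src B (x n) = src B (y n)"
  by (metis lab_def numbering_lab)

lemma lab_src: "src B (x n) = \<nu> n v \<Longrightarrow> n \<ge> 1 \<Longrightarrow> v < N \<Longrightarrow> lab x n = v"
  using numbering[of n] by (auto simp: lab_def bij_betw_def the_inv_into_f_f)

lemma in_cyl_lab: "y \<in> cyl x n \<Longrightarrow> x \<in> X \<Longrightarrow> lab y n = lab x n"
  by (simp add: lab_def in_cyl_src)

lemma in_cyl_lab_le: "y \<in> cyl x n \<Longrightarrow> x \<in> X \<Longrightarrow> m \<le> n \<Longrightarrow> lab y m = lab x m"
  using cyl_antimono[of m n x] by (intro in_cyl_lab) auto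

lemma lab_through: "n \<ge> 1 \<Longrightarrow> v < N \<Longrightarrow> \<exists>x\<in>X. lab x n = v"
  using path_through[of "\<nu> n v" n] numbering[of n] lab_src by (fastforce simp: bij_betw_def)

lemma card_edges:
  assumes "n \<ge> 1" "v < N" "u < N"
  shows "card {e \<in> edges B n. rng B e = \<nu> (Suc n) u \<and> src B e = \<nu> n v} = adj v u"
proof -
  have "incidence_matrix B N \<nu> n = incidence_matrix B N \<nu> 1"
    using stationary assms unfolding stationary_def by blast
  then have "incidence_matrix B N \<nu> n $$ (u, v) = adj v u" by (simp add: adj_def)
  then show ?thesis using assms by (simp add: incidence_matrix_def)
qed

text \<open>Edges are grouped by their range. The summands are extended reals for masses of
  cylinders and reals for the weights of a Markov chain.\<close>

lemma sum_out:
  fixes h :: "nat \<Rightarrow> 'b :: semiring_1"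
  assumes "n \<ge> 1" "v < N" and h: "\<And>e u. e \<in> out n (\<nu> n v) \<Longrightarrow> u < N \<Longrightarrow> rng B e = \<nu> (Suc n) u \<Longrightarrow> g e = h u"
  shows "(\<Sum>e\<in>out n (\<nu> n v). g e) = (\<Sum>u<N. of_nat (adj v u) * h u)"
proof -
  let ?S = "\<lambda>u. {e \<in> edges B n. rng B e = \<nu> (Suc n) u \<and> src B e = \<nu> n v}"
  have "out n (\<nu> n v) = (\<Union>u<N. ?S u)"
    using rng_edges[of n] numbering[of "Suc n"] by (fastforce simp: out_def bij_betw_def)
  moreover have "?S u \<inter> ?S u' = {}" if "u < N" "u' < N" "u \<noteq> u'" for u u'
    using that numbering[of "Suc n"] by (auto simp: bij_betw_def inj_on_def)
  ultimately have "(\<Sum>e\<in>out n (\<nu> n v). g e) = (\<Sum>u<N. \<Sum>e\<in>?S u. g e)"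
    using finite_edges by (simp add: sum.UNION_disjoint)
  also have "\<dots> = (\<Sum>u<N. \<Sum>e\<in>?S u. h u)"
    using h by (intro sum.cong refl) (auto simp: out_def)
  also have "\<dots> = (\<Sum>u<N. of_nat (adj v u) * h u)"
    using card_edges[OF assms(1,2)] by (intro sum.cong) auto
  finally show ?thesis .
qed

lemma emeasure_step:
  assumes "sets M = sets (path_borel B)" "E \<in> sets M" "x \<in> X" "n \<ge> 1"
    and h: "\<And>y. y \<in> cyl x n \<Longrightarrow> emeasure M (cyl y (Suc n) \<inter> E) = h (lab y (Suc n))"
  shows "emeasure M (cyl x n \<inter> E) = (\<Sum>u<N. of_nat (adj (lab x n) u) * h u)"
proof -
  have "emeasure M (cyl x n \<inter> E) = (\<Sum>e\<in>out n (\<nu> n (lab x n)). emeasure M ({y \<in> cyl x n. y n = e} \<inter> E))"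
    using emeasure_out_sum[OF assms(1-3)] numbering_lab[OF assms(3,4)] by simp
  also have "\<dots> = (\<Sum>u<N. of_nat (adj (lab x n) u) * h u)"
  proof (rule sum_out[OF assms(4) lab_less[OF assms(3,4)]])
    fix e u assume e: "e \<in> out n (\<nu> n (lab x n))" "u < N" "rng B e = \<nu> (Suc n) u"
    then obtain y where y: "y \<in> cyl x n" "y n = e"
      using path_extend[OF assms(3), of e n] numbering_lab[OF assms(3,4)] by auto
    have "lab y (Suc n) = u" using pathD(2)[of y n] y e in_cylD[OF y(1)] by (intro lab_src) auto
    then show "emeasure M ({y \<in> cyl x n. y n = e} \<inter> E) = h u" using h[OF y(1)] cyl_Suc[OF y(1)] y(2) by simp
  qed
  finally show ?thesis .
qed

lemma adj_path_pos:
  assumes "x \<in> X" "n \<ge> 1"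
  shows "adj (lab x n) (lab x (Suc n)) > 0"
proof -
  let ?S = "{e \<in> edges B n. rng B e = \<nu> (Suc n) (lab x (Suc n)) \<and> src B e = \<nu> n (lab x n)}"
  have "x n \<in> ?S" using assms numbering_lab[of x n] numbering_lab[of x "Suc n"] pathD[of x n] by simp
  then have "card ?S > 0" using finite_edges[of n] by (auto simp: card_gt_0_iff)
  then show ?thesis using card_edges[of n "lab x n" "lab x (Suc n)"] lab_less assms by simp
qed

lemma adj_pos_step:
  assumes "x \<in> X" "n \<ge> 1" "u < N" "adj (lab x n) u > 0"
  shows "\<exists>y\<in>cyl x n. lab y (Suc n) = u"
proof -
  have "card {e \<in> edges B n. rng B e = \<nu> (Suc n) u \<and> src B e = \<nu> n (lab x n)} > 0"
    using card_edges[of n "lab x n" u] assms lab_less[of x n] by simp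
  then obtain e where e: "e \<in> edges B n" "rng B e = \<nu> (Suc n) u" "src B e = src B (x n)"
    using numbering_lab[OF assms(1,2)] by (auto simp: card_gt_0_iff)
  then obtain y where y: "y \<in> cyl x n" "y n = e" using path_extend[OF assms(1), of e n] by (auto simp: out_def)
  then have "lab y (Suc n) = u" using pathD(2)[of y n] y e in_cylD[OF y(1)] assms by (intro lab_src) auto
  with y show ?thesis by auto
qed

end

section \<open>Invariance under finite coordinate changes\<close>

context diagram
begin

text \<open>The transposition of two finite paths with a common end vertex. Invariance under these
  involutions is the working form of invariance throughout.\<close>

definition switch :: "(nat \<Rightarrow> 'e) \<Rightarrow> (nat \<Rightarrow> 'e) \<Rightarrow> nat \<Rightarrow> (nat \<Rightarrow> 'e) \<Rightarrow> nat \<Rightarrow> 'e" where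
  "switch x y n z = (if z \<in> cyl x n then graft y n z else if z \<in> cyl y n then graft x n z else z)"

text \<open>Phrased by preimages cut down to the path space, because \<open>switch\<close> is not
  restricted to it.\<close>

definition switch_invariant :: "(nat \<Rightarrow> 'e) measure \<Rightarrow> bool" where
  "switch_invariant M \<longleftrightarrow> (\<forall>x\<in>X. \<forall>y\<in>X. \<forall>n. src B (x n) = src B (y n) \<longrightarrow>
     (\<forall>E\<in>sets M. emeasure M (switch x y n -` E \<inter> X) = emeasure M E))"

text \<open>By the last clause the new prefix depends only on the old one, so the map amounts to a
  permutation of the finite paths of length \<open>n\<close>.\<close>

definition coordinate_change :: "nat \<Rightarrow> ((nat \<Rightarrow> 'e) \<Rightarrow> nat \<Rightarrow> 'e) \<Rightarrow> bool" where
  "coordinate_change n g \<longleftrightarrow> g \<in> Bij X \<and> (\<forall>x\<in>X. \<forall>i\<ge>n. g x i = x i) \<and>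
     (\<forall>x\<in>X. \<forall>y\<in>cyl x n. g y \<in> cyl (g x) n)"

lemma graft_switch:
  assumes "x \<in> X" "y \<in> X" "src B (x n) = src B (y n)" "z \<in> cyl x n"
  shows "graft y n z \<in> cyl y n" "graft x n (graft y n z) = z"
  using assms in_cyl_src[OF assms(4,1)] in_cylD[OF assms(4)] graft_in_cyl[of y z n]
  by (auto simp: graft_graft) (auto simp: graft_def cylinder_def)

lemma switch_involution:
  assumes "x \<in> X" "y \<in> X" "src B (x n) = src B (y n)" "z \<in> X"
  shows "switch x y n z \<in> X" "switch x y n (switch x y n z) = z"
proof -
  have s: "graft y n w \<in> cyl y n" "graft x n (graft y n w) = w" if "w \<in> cyl x n" for w
    using graft_switch[OF assms(1-3) that] by auto
  have s': "graft x n w \<in> cyl x n" "graft y n (graft x n w) = w" if "w \<in> cyl y n" for w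
    using graft_switch[OF assms(2,1) assms(3)[symmetric] that] by auto
  \<comment> \<open>These two facts treat a path in both cylinders: then the two prefixes agree and
    nothing is changed.\<close>
  have ov: "graft y n w = w" if "w \<in> cyl y n" for w
    using that by (auto simp: graft_def cylinder_def)
  have ox: "graft y n w \<in> cyl x n \<Longrightarrow> w \<in> cyl x n \<Longrightarrow> graft y n w = w" for w
    by (auto simp: graft_def cylinder_def fun_eq_iff)
  show "switch x y n z \<in> X" 
    using in_cylD[OF s(1)[of z]] in_cylD[OF s'(1)[of z]] assms(4) by (simp add: switch_def)
  show "switch x y n (switch x y n z) = z"
    using s[of z] s'[of z] ox[of z] ov[of z] by (auto simp: switch_def)
qed

lemma switch_preserves_tail: "i \<ge> n \<Longrightarrow> switch x y n z i = z i"
  by (simp add: switch_def)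

lemma in_cyl_sym: "z \<in> cyl y n \<Longrightarrow> y \<in> X \<Longrightarrow> y \<in> cyl z n"
  using cyl_eq in_cyl_self by blast

lemma switch_coordinate_change:
  assumes "x \<in> X" "y \<in> X" "src B (x n) = src B (y n)"
  shows "coordinate_change n (restrict (switch x y n) X)"
proof -
  let ?g = "switch x y n"
  note inv = switch_involution[OF assms]
  have "bij_betw ?g X X" by (rule bij_betwI[where g = ?g]) (use inv in auto)
  then have "restrict ?g X \<in> Bij X" by (auto simp: Bij_def bij_betw_def inj_on_def)
  moreover have "?g w \<in> cyl (?g z) n" if "z \<in> X" "w \<in> cyl z n" for z w
  proof -
    have "w \<in> X" using in_cylD[OF that(2)] .
    moreover have wz: "\<forall>i<n. w i = z i" using that(2) by (simp add: cylinder_def)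
    ultimately have iff: "z \<in> cyl x n \<longleftrightarrow> w \<in> cyl x n" "z \<in> cyl y n \<longleftrightarrow> w \<in> cyl y n"
      using that(1) by (simp_all add: cylinder_def)
    have "?g w i = ?g z i" if "i < n" for i
      using that wz by (simp add: switch_def iff)
    then show ?thesis using inv(1)[OF \<open>w \<in> X\<close>] by (simp add: cylinder_def)
  qed
  ultimately show ?thesis unfolding coordinate_change_def
    by (intro conjI ballI allI impI) (simp_all add: switch_preserves_tail in_cylD)
qed

section \<open>The countable group of finite coordinate changes\<close>

lemma prefix_set_measurable:
  assumes "\<And>x y. x \<in> X \<Longrightarrow> y \<in> cyl x n \<Longrightarrow> P y \<longleftrightarrow> P x"
  shows "{x \<in> X. P x} \<in> sets (path_borel B)"
proof -
  have "P \<in> path_borel B \<rightarrow>\<^sub>M count_space UNIV" by (rule measurable_prefix) (use assms in blast)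
  from measurable_sets[OF this, of "{True}"] show ?thesis by (auto simp: vimage_def Int_def conj_commute)
qed

lemma coordinate_change_measurable:
  assumes "coordinate_change n g"
  shows "g \<in> path_borel B \<rightarrow>\<^sub>M path_borel B"
proof (rule measurable_into_borel)
  have gX: "g x \<in> X" if "x \<in> X" for x
    using assms that by (auto simp: coordinate_change_def Bij_def bij_betw_def)
  then show "g \<in> space (path_borel B) \<rightarrow> X" by auto
  fix w m assume "w \<in> X"
  have "{x \<in> X. g x \<in> cyl w m} \<in> sets (path_borel B)"
  proof (rule prefix_set_measurable[of "max n m"])
    fix x y assume xy: "x \<in> X" "y \<in> cyl x (max n m)"
    have y: "y \<in> X" "y \<in> cyl x n" "\<forall>i<m. y i = x i"
      using xy(2) by (simp_all add: cylinder_def)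
    have "g y \<in> cyl (g x) n" using assms xy(1) y(2) by (auto simp: coordinate_change_def)
    then have lo: "g y i = g x i" if "i < n" for i using that by (simp add: cylinder_def)
    have hi: "g y i = y i" "g x i = x i" if "i \<ge> n" for i
      using assms xy(1) y(1) that by (simp_all add: coordinate_change_def)
    have "g y i = g x i" if "i < m" for i
      using lo[of i] hi[of i] y(3) that by (cases "i < n") simp_all
    then show "g y \<in> cyl w m \<longleftrightarrow> g x \<in> cyl w m"
      using gX xy(1) y(1) by (auto simp: cylinder_def)
  qed
  then show "g -` cyl w m \<inter> space (path_borel B) \<in> sets (path_borel B)"
    by (simp add: vimage_def Int_def conj_commute)
qed

lemma switch_measurable:
  assumes "x \<in> X" "y \<in> X" "src B (x n) = src B (y n)"
  shows "switch x y n \<in> path_borel B \<rightarrow>\<^sub>M path_borel B"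
  using coordinate_change_measurable[OF switch_coordinate_change[OF assms]]
  by (rule subst[OF measurable_cong, rotated]) simp

lemma coordinate_change_mono:
  assumes "coordinate_change n g" "n \<le> m"
  shows "coordinate_change m g"
proof -
  have "g y \<in> cyl (g x) m" if "x \<in> X" "y \<in> cyl x m" for x y
  proof -
    have y: "y \<in> X" "y \<in> cyl x n" "\<forall>i<m. y i = x i"
      using assms(2) that by (simp_all add: cylinder_def)
    have "g y \<in> cyl (g x) n" using assms that y(2) by (auto simp: coordinate_change_def)
    moreover have "g y i = g x i" if "i < m" "i \<ge> n" for i
      using assms(1) \<open>x \<in> X\<close> y that by (simp add: coordinate_change_def)
    ultimately have "g y \<in> X \<and> (\<forall>i<m. g y i = g x i)"
      by (simp add: cylinder_def) (metis not_less)
    then show ?thesis by (simp add: cylinder_def)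
  qed
  then show ?thesis using assms by (auto simp: coordinate_change_def)
qed

text \<open>The induced map on the finite set \<open>Rep n\<close> is onto because \<open>g\<close>
  is, hence injective. This makes the inverse of \<open>g\<close> a coordinate change.\<close>

lemma coordinate_change_prefix_inj:
  assumes g: "coordinate_change n g" and "x \<in> X" "y \<in> X" "g y \<in> cyl (g x) n"
  shows "y \<in> cyl x n"
proof -
  define h where "h d = rep n (g d)" for d
  have gX: "g ` X = X" using g by (auto simp: coordinate_change_def Bij_def bij_betw_def)
  have hrep: "h (rep n z) = rep n (g z)" if "z \<in> X" for z
    unfolding h_def using g that rep_in_cyl[OF that] by (intro rep_cong) (auto simp: coordinate_change_def)
  have "h ` Rep n = Rep n"
  proof
    show "h ` Rep n \<subseteq> Rep n"
    proof
      fix e assume "e \<in> h ` Rep n"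
      then obtain d where "d \<in> Rep n" "e = rep n (g d)" by (auto simp: h_def)
      moreover from this have "g d \<in> X" using gX Rep_subset by blast
      ultimately show "e \<in> Rep n" unfolding Rep_def by blast
    qed
    have "\<exists>d\<in>Rep n. h d = rep n w" if w: "w \<in> X" for w
    proof -
      obtain z where "z \<in> X" "w = g z" using gX w by blast
      then show ?thesis using hrep[of z] by (auto simp: Rep_def)
    qed
    then show "Rep n \<subseteq> h ` Rep n" by (force simp: Rep_def)
  qed
  then have inj: "inj_on h (Rep n)" using finite_Rep eq_card_imp_inj_on by metis
  have "h (rep n y) = h (rep n x)" using hrep assms rep_cong[OF assms(4)] by simp
  then have "rep n y = rep n x" using inj assms(2,3) by (auto simp: inj_on_def Rep_def)
  then have "cyl y n = cyl x n"
    using cyl_eq[OF rep_in_cyl[OF assms(2), of n]] cyl_eq[OF rep_in_cyl[OF assms(3), of n]] by simp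
  then show ?thesis using in_cyl_self[OF assms(3)] by blast
qed

text \<open>For fixed \<open>n\<close> the map is determined by its action on the finitely many
  prefixes: the tail is unchanged, and outside the path space the members of \<open>Bij X\<close>
  have a default value.\<close>

lemma countable_coordinate_changes: "countable {g. \<exists>n. coordinate_change n g}"
proof -
  have "finite {g. coordinate_change n g}" for n
  proof (rule inj_on_finite)
    let ?r = "\<lambda>g. restrict (\<lambda>d. rep n (g d)) (Rep n)"
    show "inj_on ?r {g. coordinate_change n g}"
    proof (rule inj_onI, clarify)
      fix g g' assume g: "coordinate_change n g" "coordinate_change n g'" and eq: "?r g = ?r g'"
      have "g x = g' x" for x
      proof (cases "x \<in> X")
        case x: True
        have gX: "g x \<in> X" "g' x \<in> X" "g (rep n x) \<in> X" "g' (rep n x) \<in> X"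
          using g x in_cylD[OF rep_in_cyl[OF x]] by (auto simp: coordinate_change_def Bij_def bij_betw_def)
        have e: "rep n (g (rep n x)) = rep n (g' (rep n x))"
          using fun_cong[OF eq, of "rep n x"] x by (simp add: Rep_def)
        have "g (rep n x) \<in> cyl (g x) n" "g' (rep n x) \<in> cyl (g' x) n"
          using g x rep_in_cyl[OF x] by (auto simp: coordinate_change_def)
        then have "cyl (g x) n = cyl (g' x) n"
          using e rep_in_cyl[OF gX(3), of n] rep_in_cyl[OF gX(4), of n] cyl_eq by metis
        then have "g x \<in> cyl (g' x) n" using in_cyl_self[OF gX(1)] by blast
        moreover have "g x i = g' x i" if "i \<ge> n" for i
          using g x that by (simp add: coordinate_change_def)
        ultimately show ?thesis by (auto simp: cylinder_def fun_eq_iff) (metis not_less)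
      next
        case False
        then show ?thesis using g by (auto simp: coordinate_change_def Bij_def extensional_def)
      qed
      then show "g = g'" ..
    qed
    show "?r ` {g. coordinate_change n g} \<subseteq> (\<Pi>\<^sub>E d\<in>Rep n. Rep n)"
      using Rep_subset[of n]
      by (auto simp: Rep_def coordinate_change_def Bij_def bij_betw_def) (metis imageI in_cylD rep_in_cyl)
    show "finite (\<Pi>\<^sub>E d\<in>Rep n. Rep n)" by (intro finite_PiE finite_Rep)
  qed
  then have "countable {g. coordinate_change n g}" for n by (rule countable_finite)
  then have "countable (\<Union>n. {g. coordinate_change n g})" by auto
  then show ?thesis by (rule back_subst[of countable]) auto
qed

text \<open>\<open>tail_invariant\<close> speaks about all generating groups, so a concrete one is
  required before anything can be deduced from it.\<close>

lemma coordinate_changes_generate: "generates_tail_rel B {g. \<exists>n. coordinate_change n g}"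
  unfolding generates_tail_rel_def
proof (intro conjI countable_coordinate_changes)
  let ?G = "{g. \<exists>n. coordinate_change n g}"
  show "?G \<subseteq> path_borel B \<rightarrow>\<^sub>M path_borel B" using coordinate_change_measurable by auto
  show "subgroup ?G (BijGroup X)"
  proof (rule group.subgroupI[OF group_BijGroup])
    show "?G \<subseteq> carrier (BijGroup X)" by (auto simp: coordinate_change_def BijGroup_def)
    show "?G \<noteq> {}" using path_space_nonempty switch_coordinate_change by blast
    fix g assume "g \<in> ?G"
    then obtain n where g: "coordinate_change n g" by auto
    let ?h = "restrict (inv_into X g) X"
    have gB: "g \<in> Bij X" using g by (simp add: coordinate_change_def)
    then have bij: "bij_betw g X X" by (simp add: Bij_def)
    have h: "?h x \<in> X" "g (?h x) = x" if "x \<in> X" for x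
      using that bij by (auto simp: bij_betw_def inv_into_into f_inv_into_f)
    have "coordinate_change n ?h"
      unfolding coordinate_change_def
    proof (intro conjI ballI allI impI)
      show "?h \<in> Bij X" by (rule restrict_inv_into_Bij[OF gB])
      show "?h x i = x i" if "x \<in> X" "i \<ge> n" for x i
        using g h[OF that(1)] that(2) by (metis coordinate_change_def)
      show "?h y \<in> cyl (?h x) n" if "x \<in> X" "y \<in> cyl x n" for x y
        using coordinate_change_prefix_inj[OF g h(1)[OF that(1)] h(1)[OF in_cylD[OF that(2)]]]
          h(2)[OF that(1)] h(2)[OF in_cylD[OF that(2)]] that(2) by simp
    qed
    then show "inv\<^bsub>BijGroup X\<^esub> g \<in> ?G" using inv_BijGroup[OF gB] by auto
    fix f assume "f \<in> ?G"
    then obtain m where f: "coordinate_change m f" by auto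
    have f': "coordinate_change (max n m) f" and g': "coordinate_change (max n m) g"
      using f g coordinate_change_mono by auto
    have fB: "f \<in> Bij X" using f by (simp add: coordinate_change_def)
    have fX: "f x \<in> X" if "x \<in> X" for x using fB that by (auto simp: Bij_def bij_betw_def)
    have "coordinate_change (max n m) (compose X g f)"
      unfolding coordinate_change_def
    proof (intro conjI ballI allI impI)
      show "compose X g f \<in> Bij X" by (rule compose_Bij[OF gB fB])
      show "compose X g f x i = x i" if "x \<in> X" "i \<ge> max n m" for x i
        using f' g' fX that by (simp add: coordinate_change_def compose_def)
      show "compose X g f y \<in> cyl (compose X g f x) (max n m)" if "x \<in> X" "y \<in> cyl x (max n m)" for x y
        using f' g' fX that in_cylD[OF that(2)] by (simp add: coordinate_change_def compose_def)
    qed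
    then show "g \<otimes>\<^bsub>BijGroup X\<^esub> f \<in> ?G" using gB fB by (auto simp: BijGroup_def)
  qed
  show "tail_rel B = {(x, g x) |x g. x \<in> X \<and> g \<in> ?G}"
  proof (intro equalityI subsetI)
    fix p assume "p \<in> tail_rel B"
    then obtain x y n where p: "p = (x, y)" "x \<in> X" "y \<in> X" "\<forall>i\<ge>n. x i = y i"
      by (auto simp: tail_rel_def)
    then have src: "src B (x n) = src B (y n)" by simp
    have "switch x y n x = y" using p in_cyl_self[of x n] by (auto simp: switch_def graft_def)
    with p switch_coordinate_change[OF p(2,3) src] show "p \<in> {(x, g x) |x g. x \<in> X \<and> g \<in> ?G}"
      by (auto intro!: exI[of _ "restrict (switch x y n) X"])
  next
    fix p assume "p \<in> {(x, g x) |x g. x \<in> X \<and> g \<in> ?G}"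
    then obtain x g n where p: "p = (x, g x)" "x \<in> X" "coordinate_change n g" by blast
    then have "g x \<in> X" "\<forall>i\<ge>n. x i = g x i" by (auto simp: coordinate_change_def Bij_def bij_betw_def)
    with p show "p \<in> tail_rel B" by (auto simp: tail_rel_def)
  qed
qed

lemma tail_invariant_imp_switch_invariant:
  assumes "sets M = sets (path_borel B)" "tail_invariant B M"
  shows "switch_invariant M"
  unfolding switch_invariant_def
proof (intro ballI allI impI)
  fix x y n E assume xy: "x \<in> X" "y \<in> X" "src B (x n) = src B (y n)" and E: "E \<in> sets M"
  let ?g = "restrict (switch x y n) X"
  have c: "coordinate_change n ?g" by (rule switch_coordinate_change[OF xy])
  have "distr M M ?g = M"
    using assms(2) coordinate_changes_generate c unfolding tail_invariant_def by blast
  then have "emeasure M E = emeasure (distr M M ?g) E" by simp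
  also have "\<dots> = emeasure M (?g -` E \<inter> space M)"
    using coordinate_change_measurable[OF c] E assms(1)
    by (intro emeasure_distr) (simp_all cong: measurable_cong_sets)
  also have "?g -` E \<inter> space M = switch x y n -` E \<inter> X"
    using sets_eq_imp_space_eq[OF assms(1)] by auto
  finally show "emeasure M (switch x y n -` E \<inter> X) = emeasure M E" ..
qed

text \<open>A Borel map with graph in the tail relation agrees on each piece of a countable partition
  with some switch.\<close>

lemma switch_invariant_imp_tail_invariant:
  assumes sM: "sets M = sets (path_borel B)" and inv: "switch_invariant M"
  shows "tail_invariant B M"
  unfolding tail_invariant_def
proof (intro allI impI ballI)
  fix \<Gamma> g assume \<Gamma>: "generates_tail_rel B \<Gamma>" and g: "g \<in> \<Gamma>"
  have spM: "space M = X" using sets_eq_imp_space_eq[OF sM] by simp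
  have gm: "g \<in> M \<rightarrow>\<^sub>M M" using \<Gamma> g by (auto simp: generates_tail_rel_def cong: measurable_cong_sets[OF sM sM])
  have "\<Gamma> \<subseteq> carrier (BijGroup X)"
    by (rule subgroup.subset) (use \<Gamma> in \<open>simp add: generates_tail_rel_def\<close>)
  then have "g \<in> Bij X" using g by (auto simp: BijGroup_def)
  then have bij: "bij_betw g X X" by (simp add: Bij_def)
  have tail: "\<exists>n. \<forall>i\<ge>n. x i = g x i" if "x \<in> X" for x
  proof -
    have "(x, g x) \<in> tail_rel B" using \<Gamma> g that unfolding generates_tail_rel_def by blast
    then show ?thesis by (simp add: tail_rel_def)
  qed
  \<comment> \<open>A piece is indexed by a level and two finite paths with the same end vertex: on
    it \<open>g\<close> replaces the prefix \<open>d\<close> by \<open>d'\<close> and keeps the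
    tail. Countably many pieces cover the space.\<close>
  define J where "J = {(n, d, d') | n d d'. d \<in> Rep n \<and> d' \<in> Rep n \<and> src B (d n) = src B (d' n)}"
  define A where "A = (\<lambda>(n, d, d'). {x \<in> X. x \<in> cyl d n \<and> g x \<in> cyl d' n \<and> (\<forall>i\<ge>n. x i = g x i)})"
  have J: "countable J"
  proof -
    have "J \<subseteq> (SIGMA n:UNIV. Rep n \<times> Rep n)" by (auto simp: J_def)
    then show ?thesis by (rule countable_subset)
      (rule countable_SIGMA, auto intro: countable_finite finite_Rep)
  qed
  have "J \<noteq> {}" using path_space_nonempty by (auto simp: J_def Rep_def)
  define a where "a = from_nat_into J"
  have a: "range a = J" unfolding a_def by (rule range_from_nat_into[OF \<open>J \<noteq> {}\<close> J])
  have Am: "A j \<in> sets M" for j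
  proof -
    obtain n d d' where j: "j = (n, d, d')" by (cases j)
    have m: "(\<lambda>x. x i) \<in> M \<rightarrow>\<^sub>M count_space UNIV" for i
      using measurable_coordinate[of i] by (simp cong: measurable_cong_sets[OF sM refl])
    have ed: "x i \<in> edges B i" "g x i \<in> edges B i" if "x \<in> X" for x i
      using that bij pathD(1) by (auto simp: bij_betw_def)
    have e1: "{x \<in> X. x i = g x i} \<in> sets M" for i
    proof -
      have "{x \<in> X. x i = g x i} = (\<Union>e\<in>edges B i. ((\<lambda>x. x i) -` {e} \<inter> space M) \<inter> ((\<lambda>x. g x i) -` {e} \<inter> space M))"
        using ed spM by auto
      also have "\<dots> \<in> sets M"
      proof (rule sets.finite_UN[OF finite_edges])
        fix e
        show "((\<lambda>x. x i) -` {e} \<inter> space M) \<inter> ((\<lambda>x. g x i) -` {e} \<inter> space M) \<in> sets M"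
          by (rule sets.Int[OF measurable_sets[OF m] measurable_sets[OF measurable_compose[OF gm m]]]) auto
      qed
      finally show ?thesis .
    qed
    have eq: "A j = cyl d n \<inter> (g -` cyl d' n \<inter> space M) \<inter> (\<Inter>i. {x \<in> X. i \<ge> n \<longrightarrow> x i = g x i})"
      using spM cyl_subset by (auto simp: A_def j)
    have ms: "{x \<in> X. i \<ge> n \<longrightarrow> x i = g x i} \<in> sets M" for i
      using e1[of i] sets.top[of M] spM by (cases "i \<ge> n") simp_all
    have tl: "(\<Inter>i. {x \<in> X. i \<ge> n \<longrightarrow> x i = g x i}) \<in> sets M"
      by (rule sets.countable_INT[OF image_subsetI[OF ms] UNIV_not_empty])
    have c: "cyl w n \<in> sets M" for w n by (simp add: sM cyl_in_sets)
    have "cyl d n \<inter> (g -` cyl d' n \<inter> space M) \<in> sets M"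
      by (rule sets.Int[OF c measurable_sets[OF gm c]])
    from this tl show ?thesis unfolding eq by (rule sets.Int)
  qed
  define D where "D = disjointed (\<lambda>k. A (a k))"
  have Dm: "D k \<in> sets M" for k
  proof -
    have "range (\<lambda>k. A (a k)) \<subseteq> sets M" using Am by (rule image_subsetI)
    from sets.range_disjointed_sets[OF this] show ?thesis unfolding D_def by blast
  qed
  have DA: "D k \<subseteq> A (a k)" for k unfolding D_def by (rule disjointed_subset)
  have Dd: "disjoint_family D" unfolding D_def by (rule disjoint_family_disjointed)
  have DX: "(\<Union>k. D k) = X"
  proof -
    have "x \<in> (\<Union>k. A (a k))" if x: "x \<in> X" for x
    proof -
      obtain n where n: "\<forall>i\<ge>n. x i = g x i" using tail[OF x] by blast
      have gx: "g x \<in> X" using bij x by (auto simp: bij_betw_def)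
      have r: "x \<in> cyl (rep n x) n" "g x \<in> cyl (rep n (g x)) n"
        using in_cyl_sym[OF rep_in_cyl] x gx by auto
      have "src B (rep n x n) = src B (rep n (g x) n)"
        using in_cyl_src[OF rep_in_cyl[OF x] x, of n] in_cyl_src[OF rep_in_cyl[OF gx] gx, of n] n by simp
      then have "(n, rep n x, rep n (g x)) \<in> J" using x gx by (auto simp: J_def Rep_def)
      moreover have "x \<in> A (n, rep n x, rep n (g x))" using x n r by (simp add: A_def)
      ultimately show ?thesis using a by (metis UN_I UNIV_I imageE)
    qed
    then show ?thesis unfolding D_def UN_disjointed_eq using DA by (auto simp: A_def)
  qed
  \<comment> \<open>Inside one piece \<open>g\<close> coincides with a switch. As this is an
    involution, the image under \<open>g\<close> is a preimage under the switch, so it is measurable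
    and has the same mass.\<close>
  have piece: "emeasure M (g ` E') = emeasure M E' \<and> g ` E' \<in> sets M" if E': "E' \<in> sets M" "E' \<subseteq> A j" "j \<in> J" for E' j
  proof -
    obtain n d d' where j: "j = (n, d, d')" "d \<in> Rep n" "d' \<in> Rep n" "src B (d n) = src B (d' n)"
      using E'(3) by (auto simp: J_def)
    have d: "d \<in> X" "d' \<in> X" using j Rep_subset by auto
    note si = switch_involution[OF d j(4)]
    have gs: "g z = switch d d' n z" if z: "z \<in> E'" for z
    proof -
      have "z \<in> cyl d n" "g z \<in> cyl d' n" "\<forall>i\<ge>n. z i = g z i" using z E'(2) by (auto simp: A_def j)
      then show ?thesis by (auto simp: switch_def graft_def cylinder_def fun_eq_iff)
    qed
    have EX: "E' \<subseteq> X" using E'(1) sets.sets_into_space spM by blast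
    have "g ` E' = switch d d' n -` E' \<inter> X"
    proof
      show "g ` E' \<subseteq> switch d d' n -` E' \<inter> X" using gs si EX by auto
      show "switch d d' n -` E' \<inter> X \<subseteq> g ` E'"
      proof
        fix z assume z: "z \<in> switch d d' n -` E' \<inter> X"
        then have "g (switch d d' n z) = z" using gs[of "switch d d' n z"] si(2)[of z] by simp
        then show "z \<in> g ` E'" using z by (metis IntD1 image_eqI vimageD)
      qed
    qed
    moreover have "emeasure M (switch d d' n -` E' \<inter> X) = emeasure M E'"
      using inv d j(4) E'(1) unfolding switch_invariant_def by blast
    moreover have "switch d d' n -` E' \<inter> X \<in> sets M"
      using measurable_sets[OF switch_measurable[OF d j(4)], of E'] E'(1) sM by simp
    ultimately show ?thesis by simp
  qed
  show "distr M M g = M"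
  proof (rule measure_eqI)
    fix E assume "E \<in> sets (distr M M g)"
    then have E: "E \<in> sets M" by simp
    let ?P = "\<lambda>k. (g -` E \<inter> space M) \<inter> D k"
    have P: "?P k \<in> sets M" for k using measurable_sets[OF gm E] Dm by auto
    have img: "emeasure M (g ` ?P k) = emeasure M (?P k)" "g ` ?P k \<in> sets M" for k
      using piece[OF P[of k], of "a k"] DA[of k] a by auto
    have "emeasure (distr M M g) E = emeasure M (g -` E \<inter> space M)" by (rule emeasure_distr[OF gm E])
    also have "g -` E \<inter> space M = (\<Union>k. ?P k)" using DX spM by auto
    also have "emeasure M \<dots> = (\<Sum>k. emeasure M (?P k))"
      using P Dd by (intro suminf_emeasure[symmetric]) (auto simp: disjoint_family_on_def)
    also have "\<dots> = (\<Sum>k. emeasure M (g ` ?P k))" using img by simp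
    also have "\<dots> = emeasure M (\<Union>k. g ` ?P k)"
    proof (rule suminf_emeasure)
      show "disjoint_family (\<lambda>k. g ` ?P k)"
        unfolding disjoint_family_on_def
      proof (intro ballI impI)
        fix k l :: nat assume "k \<noteq> l"
        then have "?P k \<inter> ?P l = {}" using Dd unfolding disjoint_family_on_def by blast
        moreover have "?P k \<subseteq> X" "?P l \<subseteq> X" using spM by auto
        ultimately show "g ` ?P k \<inter> g ` ?P l = {}"
          using bij by (metis bij_betw_def image_empty inj_on_image_Int)
      qed
    qed (use img in auto)
    also have "(\<Union>k. g ` ?P k) = E"
    proof -
      have "(\<Union>k. g ` ?P k) = g ` (g -` E \<inter> X)" unfolding image_UN[symmetric] using DX spM by auto
      also have "\<dots> = E \<inter> g ` X" by auto
      also have "\<dots> = E" using bij sets.sets_into_space[OF E] spM by (auto simp: bij_betw_def)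
      finally show ?thesis .
    qed
    finally show "emeasure (distr M M g) E = emeasure M E" .
  qed simp
qed

end

section \<open>Measures on the paths that end up in a class\<close>

context diagram
begin

text \<open>The empty set is added to close the cylinders under intersection.\<close>

lemma sigma_sets_cylinders_empty: "sets (path_borel B) = sigma_sets X (insert {} cylinders)"
  unfolding sets_borel
  by (intro equalityI sigma_sets_mono) (auto intro: sigma_sets.intros)

lemma Int_stable_cylinders: "Int_stable (insert {} cylinders)"
proof -
  have *: "cyl x m \<inter> cyl y n \<in> insert {} cylinders" if "y \<in> X" "m \<le> n" for x y m n
    unfolding cyl_inter[OF that(2)] using that(1) by (auto simp: cylinders_def)
  have **: "cyl x m \<inter> cyl y n \<in> insert {} cylinders" if "x \<in> X" "y \<in> X" for x y m n
    using *[OF that(1), of n m y] *[OF that(2), of m n x] nat_le_linear[of m n]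
    unfolding Int_commute[of "cyl y n"] by blast
  have "a \<inter> b \<in> insert {} cylinders" if "a \<in> cylinders" "b \<in> cylinders" for a b
  proof -
    obtain x y m n where "a = cyl x m" "b = cyl y n" "x \<in> X" "y \<in> X"
      using \<open>a \<in> cylinders\<close> \<open>b \<in> cylinders\<close> by (auto simp: cylinders_def)
    then show ?thesis using ** by simp
  qed
  then show ?thesis by (intro Int_stableI) blast
qed

text \<open>The usual argument from an intersection-stable generator, carried out inside a set
  \<open>C\<close> of finite mass: finiteness is what the complement step requires.\<close>

lemma emeasure_eq_on_cylinder:
  assumes sM: "sets M = sets (path_borel B)" and sM': "sets M' = sets (path_borel B)"
    and "C \<in> sets M" "emeasure M C < \<infinity>" "emeasure M C = emeasure M' C"
    and eq: "\<And>z m. z \<in> X \<Longrightarrow> emeasure M (C \<inter> cyl z m) = emeasure M' (C \<inter> cyl z m)"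
    and "E \<in> sets M"
  shows "emeasure M (C \<inter> E) = emeasure M' (C \<inter> E)"
proof -
  have E: "E \<in> sigma_sets X (insert {} cylinders)" using assms(7) sigma_sets_cylinders_empty sM by simp
  have sets: "A \<in> sets M" "A \<in> sets M'" if "A \<in> sigma_sets X (insert {} cylinders)" for A
    using that sM sM' sigma_sets_cylinders_empty by auto
  have CX: "C \<subseteq> X" using sets.sets_into_space[OF assms(3)] sets_eq_imp_space_eq[OF sM] by simp
  have G: "insert {} cylinders \<subseteq> Pow X" using cyl_subset by (auto simp: cylinders_def)
  show ?thesis
    using Int_stable_cylinders G E
  proof (induction rule: sigma_sets_induct_disjoint)
    case (basic A)
    then show ?case using eq by (auto simp: cylinders_def)
  next
    case empty
    show ?case by simp
  next
    case (compl A)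
    have "C \<inter> (X - A) = C - C \<inter> A" using CX by auto
    moreover have "C \<inter> A \<in> sets M" "C \<inter> A \<in> sets M'" "C \<in> sets M'"
      using sets[OF compl(1)] assms(3) sM sM' by auto
    moreover have "emeasure M (C \<inter> A) < \<infinity>"
      using emeasure_mono[of "C \<inter> A" C M] assms(3,4) by (auto intro: order.strict_trans1)
    ultimately show ?case using compl.IH assms(3,5) by (simp add: emeasure_Diff less_top)
  next
    case (union A)
    have "C \<inter> A i \<in> sets (path_borel B)" for i
      using sets(1)[of "A i"] union(2) assms(3) sM by blast
    then have r: "range (\<lambda>i. C \<inter> A i) \<subseteq> sets M" "range (\<lambda>i. C \<inter> A i) \<subseteq> sets M'"
      unfolding sM sM' by (rule image_subsetI)+
    have d: "disjoint_family (\<lambda>i. C \<inter> A i)"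
      by (rule disjoint_family_on_bisimulation[OF union(1)]) blast
    have "emeasure M (C \<inter> (\<Union>i. A i)) = (\<Sum>i. emeasure M (C \<inter> A i))"
      "emeasure M' (C \<inter> (\<Union>i. A i)) = (\<Sum>i. emeasure M' (C \<inter> A i))"
      unfolding Int_UN_distrib by (rule suminf_emeasure[OF r(1) d, symmetric] suminf_emeasure[OF r(2) d, symmetric])+
    then show ?case using union.IH by simp
  qed
qed

end

context stationary_diagram
begin

section \<open>Paths that end up in a set of vertices\<close>

definition eventually_in :: "nat set \<Rightarrow> (nat \<Rightarrow> 'e) set" where
  "eventually_in I = {x \<in> X. \<exists>n. \<forall>m\<ge>n. lab x m \<in> I}"

text \<open>The consequence of the block triangular form that the measure theory uses: the levels at
  which a path is in \<open>I\<close> form an interval. \<open>no_return_class\<close> supplies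
  it.\<close>

definition no_return :: "nat set \<Rightarrow> bool" where
  "no_return I \<longleftrightarrow> (\<forall>x\<in>X. \<forall>i j k. 1 \<le> i \<longrightarrow> i \<le> j \<longrightarrow> j \<le> k \<longrightarrow> lab x i \<in> I \<longrightarrow> lab x k \<in> I \<longrightarrow> lab x j \<in> I)"

lemma no_returnD:
  "no_return I \<Longrightarrow> x \<in> X \<Longrightarrow> 1 \<le> i \<Longrightarrow> i \<le> j \<Longrightarrow> j \<le> k \<Longrightarrow> lab x i \<in> I \<Longrightarrow> lab x k \<in> I \<Longrightarrow> lab x j \<in> I"
  unfolding no_return_def by blast

lemma no_return_eventually:
  assumes "no_return I" "x \<in> eventually_in I" "1 \<le> n" "lab x n \<in> I" "n \<le> m"
  shows "lab x m \<in> I"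
proof -
  obtain k where k: "x \<in> X" "\<forall>m\<ge>k. lab x m \<in> I" using assms(2) by (auto simp: eventually_in_def)
  then show ?thesis using no_returnD[OF assms(1) k(1) assms(3,5) _ assms(4), of "max m k"] by simp
qed

lemma lab_set_measurable: "{x \<in> X. lab x n \<in> I} \<in> sets (path_borel B)"
  by (rule prefix_set_measurable[of n]) (simp add: in_cyl_lab)

lemma eventually_in_measurable: "eventually_in I \<in> sets (path_borel B)"
proof -
  have m: "{x \<in> X. n \<le> m \<longrightarrow> lab x m \<in> I} \<in> sets (path_borel B)" for n m
    by (rule prefix_set_measurable[of m]) (simp add: in_cyl_lab)
  have "(\<Union>n. \<Inter>m. {x \<in> X. n \<le> m \<longrightarrow> lab x m \<in> I}) \<in> sets (path_borel B)"
    by (rule sets.countable_UN[OF image_subsetI[OF sets.countable_INT[OF image_subsetI[OF m] UNIV_not_empty]]])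
  moreover have "(\<Union>n. \<Inter>m. {x \<in> X. n \<le> m \<longrightarrow> lab x m \<in> I}) = eventually_in I"
    by (auto simp: eventually_in_def)
  ultimately show ?thesis by simp
qed

lemma null_outside:
  assumes "sets M = sets (path_borel B)" "emeasure M (X - eventually_in I) = 0"
    and "E \<inter> eventually_in I = {}" "E \<subseteq> X"
  shows "emeasure M E = 0"
proof -
  have "X - eventually_in I \<in> sets M"
    using eventually_in_measurable sets.top[of "path_borel B"] assms(1) by auto
  then have "X - eventually_in I \<in> null_sets M" using assms(2) by auto
  then have "emeasure M E \<le> 0" using emeasure_mono[of E "X - eventually_in I" M] assms by auto
  then show ?thesis by simp
qed

text \<open>A path in this cylinder was in \<open>I\<close> at level \<open>n\<close> and is outside
  at level \<open>m\<close>, so it cannot end up in \<open>I\<close>.\<close>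

lemma emeasure_left_class:
  assumes "sets M = sets (path_borel B)" "emeasure M (X - eventually_in I) = 0" "no_return I"
    and "z \<in> X" "1 \<le> n" "n \<le> m" "lab z n \<in> I" "lab z m \<notin> I"
  shows "emeasure M (cyl z m) = 0"
proof (rule null_outside[OF assms(1,2)])
  show "cyl z m \<inter> eventually_in I = {}"
  proof (rule ccontr)
    assume "cyl z m \<inter> eventually_in I \<noteq> {}"
    then obtain y where y: "y \<in> cyl z m" "y \<in> eventually_in I" by auto
    have "lab y n = lab z n" "lab y m = lab z m"
      using in_cyl_lab_le[OF y(1) assms(4)] assms(6) by auto
    then show False using no_return_eventually[OF assms(3) y(2) assms(5) _ assms(6)] assms(7,8) by simp
  qed
qed (rule cyl_subset)

text \<open>A path that ends up in \<open>I\<close> is there from its first visit at a positive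
  level on, so the sets increase with \<open>n\<close>. In the uniqueness argument they exhaust the
  space by sets of finite mass.\<close>

lemma emeasure_eventually_SUP:
  assumes sM: "sets M = sets (path_borel B)" and null: "emeasure M (X - eventually_in I) = 0"
    and nr: "no_return I" and "1 \<le> n0" and E: "E \<in> sets M"
  shows "emeasure M E = (SUP n. emeasure M (E \<inter> eventually_in I \<inter> {x \<in> X. lab x (n0 + n) \<in> I}))"
proof -
  let ?A = "\<lambda>n. E \<inter> eventually_in I \<inter> {x \<in> X. lab x (n0 + n) \<in> I}"
  have EX: "E \<subseteq> X" using sets.sets_into_space[OF E] sets_eq_imp_space_eq[OF sM] by simp
  have ev: "eventually_in I \<in> sets M" using eventually_in_measurable sM by simp
  have "emeasure M E = emeasure M (E \<inter> eventually_in I) + emeasure M (E - eventually_in I)"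
    using E ev by (subst plus_emeasure) (auto intro!: arg_cong[where f = "emeasure M"])
  also have "emeasure M (E - eventually_in I) = 0" using EX by (intro null_outside[OF sM null]) auto
  also have "E \<inter> eventually_in I = (\<Union>n. ?A n)"
  proof -
    have "\<exists>n. lab x (n0 + n) \<in> I" if "x \<in> eventually_in I" for x
    proof -
      obtain k where "\<forall>m\<ge>k. lab x m \<in> I" using \<open>x \<in> eventually_in I\<close> by (auto simp: eventually_in_def)
      then have "lab x (n0 + k) \<in> I" by simp
      then show ?thesis ..
    qed
    then show ?thesis using EX by auto
  qed
  also have "emeasure M (\<Union>n. ?A n) = (SUP n. emeasure M (?A n))"
  proof (rule SUP_emeasure_incseq[symmetric])
    show "range ?A \<subseteq> sets M" using E ev lab_set_measurable sM by auto
    show "incseq ?A"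
    proof (rule incseq_SucI)
      fix n
      have "lab x (n0 + Suc n) \<in> I" if "x \<in> eventually_in I" "lab x (n0 + n) \<in> I" for x
        by (rule no_return_eventually[OF nr that(1) _ that(2)]) (use \<open>1 \<le> n0\<close> in auto)
      then show "?A n \<subseteq> ?A (Suc n)" by blast
    qed
  qed
  finally show ?thesis by simp
qed

text \<open>Each exhausting set is covered by finitely many cylinders ending in \<open>I\<close>,
  and \<open>emeasure_eq_on_cylinder\<close> applies inside each. Masses are compared only from
  \<open>n0\<close> on, since the proofs of uniqueness and of invariance supply no more.\<close>

lemma measure_eqI_eventually_in:
  assumes sM: "sets M = sets (path_borel B)" and sM': "sets M' = sets (path_borel B)"
    and nr: "no_return I"
    and null: "emeasure M (X - eventually_in I) = 0" "emeasure M' (X - eventually_in I) = 0"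
    and n0: "1 \<le> n0"
    and eq: "\<And>x n. x \<in> X \<Longrightarrow> n \<ge> n0 \<Longrightarrow> lab x n \<in> I \<Longrightarrow> emeasure M (cyl x n) = emeasure M' (cyl x n)"
    and fin: "\<And>x n. x \<in> X \<Longrightarrow> n \<ge> n0 \<Longrightarrow> lab x n \<in> I \<Longrightarrow> emeasure M (cyl x n) < \<infinity>"
  shows "M = M'"
proof (rule measure_eqI)
  show "sets M = sets M'" using sM sM' by simp
  fix E assume E: "E \<in> sets M"
  have cylM: "cyl x n \<in> sets M" "cyl x n \<in> sets M'" for x n using sM sM' cyl_in_sets by auto
  have ev: "eventually_in I \<in> sets M" using eventually_in_measurable sM by simp
  have on_cyl: "emeasure M (cyl x n \<inter> A) = emeasure M' (cyl x n \<inter> A)"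
    if x: "x \<in> X" "n \<ge> n0" "lab x n \<in> I" and A: "A \<in> sets M" for x n A
  proof (rule emeasure_eq_on_cylinder[OF sM sM' cylM(1) fin[OF x] eq[OF x] _ A])
    fix z m assume z: "z \<in> X"
    show "emeasure M (cyl x n \<inter> cyl z m) = emeasure M' (cyl x n \<inter> cyl z m)"
    proof (cases "m \<le> n")
      case True
      then have "cyl x n \<inter> cyl z m = (if \<forall>i<m. z i = x i then cyl x n else {})"
        using cyl_inter[OF True, of z x] by (simp add: Int_commute)
      then show ?thesis using eq[OF x] by simp
    next
      case False
      then have nm: "n \<le> m" by simp
      show ?thesis
      proof (cases "\<forall>i<n. x i = z i")
        case True
        then have c: "cyl x n \<inter> cyl z m = cyl z m" using cyl_inter[OF nm, of x z] by simp
        have "z \<in> cyl x n" using True z by (simp add: cylinder_def)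
        then have zn: "lab z n \<in> I" using in_cyl_lab[of z x n] x by simp
        show ?thesis
        \<comment> \<open>A longer subcylinder either still ends in \<open>I\<close>, where the
          masses agree by assumption, or has left \<open>I\<close> and is null for both
          measures.\<close>
        proof (cases "lab z m \<in> I")
          case True
          then show ?thesis unfolding c using z x nm by (intro eq) auto
        next
          case False
          then show ?thesis unfolding c using z x nm zn n0
            by (simp add: emeasure_left_class[OF sM null(1) nr z, of n m] emeasure_left_class[OF sM' null(2) nr z, of n m])
        qed
      next
        case False
        then have "cyl x n \<inter> cyl z m = {}" by (rule trans[OF cyl_inter[OF nm] if_not_P])
        then show ?thesis by simp
      qed
    qed
  qed
  let ?A = "\<lambda>n. E \<inter> eventually_in I \<inter> {x \<in> X. lab x (n0 + n) \<in> I}"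
  have "emeasure M (?A n) = emeasure M' (?A n)" for n
  proof -
    let ?m = "n0 + n"
    have A: "?A n \<in> sets M" "?A n \<in> sets M'" using E ev lab_set_measurable sM sM' by auto
    have "emeasure M (cyl d ?m \<inter> ?A n) = emeasure M' (cyl d ?m \<inter> ?A n)" if d: "d \<in> Rep ?m" for d
    proof (cases "lab d ?m \<in> I")
      case True
      then show ?thesis using d Rep_subset A by (intro on_cyl) auto
    next
      case False
      then have "lab y ?m \<notin> I" if "y \<in> cyl d ?m" for y using in_cyl_lab[OF that] subsetD[OF Rep_subset d] by simp
      then have "cyl d ?m \<inter> ?A n = {}" by blast
      then show ?thesis by simp
    qed
    then show ?thesis
      using emeasure_Rep_sum[OF sM A(1), of ?m] emeasure_Rep_sum[OF sM' A(2), of ?m] by simp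
  qed
  then show "emeasure M E = emeasure M' E"
    using emeasure_eventually_SUP[OF sM null(1) nr n0 E] emeasure_eventually_SUP[OF sM' null(2) nr n0, of E] E sM sM'
    by simp
qed

section \<open>Cylinder masses of an invariant measure\<close>

lemma switch_vimage_cyl:
  assumes xy: "x \<in> X" "y \<in> X" "src B (x n) = src B (y n)"
  shows "switch x y n -` cyl x n \<inter> X = cyl y n"
proof
  show "cyl y n \<subseteq> switch x y n -` cyl x n \<inter> X"
  proof
    fix z assume z: "z \<in> cyl y n"
    have "switch x y n z \<in> cyl x n"
    proof (cases "z \<in> cyl x n")
      case True
      then have "cyl x n = cyl y n" using cyl_eq[OF z] cyl_eq[OF True] by simp
      then show ?thesis using graft_switch(1)[OF xy True] True by (simp add: switch_def)
    next
      case False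
      then show ?thesis using graft_switch(1)[OF xy(2,1) xy(3)[symmetric] z] z by (simp add: switch_def)
    qed
    then show "z \<in> switch x y n -` cyl x n \<inter> X" using in_cylD[OF z] by simp
  qed
  show "switch x y n -` cyl x n \<inter> X \<subseteq> cyl y n"
  proof
    fix z assume z: "z \<in> switch x y n -` cyl x n \<inter> X"
    then have w: "switch x y n (switch x y n z) = z" "switch x y n z \<in> cyl x n"
      using switch_involution[OF xy, of z] by auto
    have "switch x y n w \<in> cyl y n" if "w \<in> cyl x n" for w
      using graft_switch(1)[OF xy that] that by (simp add: switch_def)
    from this[OF w(2)] show "z \<in> cyl y n" unfolding w(1) .
  qed
qed

lemma switch_invariant_cyl:
  assumes sM: "sets M = sets (path_borel B)" and inv: "switch_invariant M"
    and "x \<in> X" "y \<in> X" "src B (x n) = src B (y n)"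
  shows "emeasure M (cyl x n) = emeasure M (cyl y n)"
proof -
  have "emeasure M (switch x y n -` cyl x n \<inter> X) = emeasure M (cyl x n)"
    using inv assms(3-5) cyl_in_sets[of x n] unfolding switch_invariant_def sM by blast
  then show ?thesis unfolding switch_vimage_cyl[OF assms(3-5)] by simp
qed

lemma mpow_reach:
  assumes "x \<in> X" "n \<ge> 1" "mpow (\<lambda>v u. real (adj v u)) I j (lab x n) u > 0" "I \<subseteq> {..<N}"
  shows "\<exists>y\<in>cyl x n. lab y (n + j) = u"
  using assms(1-3)
proof (induction j arbitrary: x n)
  case 0
  then show ?case using in_cyl_self[of x n] by (auto split: if_splits)
next
  case (Suc j)
  have "\<exists>w\<in>I. real (adj (lab x n) w) * mpow (\<lambda>v u. real (adj v u)) I j w u > 0"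
  proof (rule ccontr)
    assume "\<not> ?thesis"
    then have "(\<Sum>w\<in>I. real (adj (lab x n) w) * mpow (\<lambda>v u. real (adj v u)) I j w u) \<le> 0"
      by (intro sum_nonpos) (simp add: not_less)
    with Suc.prems(3) show False by simp
  qed
  then obtain w where w: "w \<in> I" "adj (lab x n) w > 0" "mpow (\<lambda>v u. real (adj v u)) I j w u > 0"
    by (auto simp: zero_less_mult_iff)
  obtain y where y: "y \<in> cyl x n" "lab y (Suc n) = w"
    using adj_pos_step[OF Suc.prems(1,2) _ w(2)] w(1) assms(4) by auto
  then obtain z where z: "z \<in> cyl y (Suc n)" "lab z (Suc n + j) = u"
    using Suc.IH[of y "Suc n"] in_cylD[OF y(1)] w by auto
  then have "z \<in> cyl x n" using cyl_antimono[of n "Suc n" y] cyl_eq[OF y(1)] by auto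
  with z show ?case by auto
qed

text \<open>The choice of the path does not matter once cylinders with the same end vertex have
  equal mass. The value may be infinite.\<close>

definition cyl_mass :: "(nat \<Rightarrow> 'e) measure \<Rightarrow> nat \<Rightarrow> nat \<Rightarrow> ennreal" where
  "cyl_mass M n v = emeasure M (cyl (SOME x. x \<in> X \<and> lab x n = v) n)"

lemma emeasure_cyl_mass:
  assumes "\<And>x y n. x \<in> X \<Longrightarrow> y \<in> X \<Longrightarrow> src B (x n) = src B (y n) \<Longrightarrow> emeasure M (cyl x n) = emeasure M (cyl y n)"
    and "x \<in> X" "n \<ge> 1"
  shows "emeasure M (cyl x n) = cyl_mass M n (lab x n)"
proof -
  let ?y = "SOME y. y \<in> X \<and> lab y n = lab x n"
  have "?y \<in> X \<and> lab ?y n = lab x n" by (rule someI[of _ x]) (use assms(2) in simp)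
  then show ?thesis unfolding cyl_mass_def using assms(2,3) lab_eq_iff[of x ?y n] by (intro assms(1)) auto
qed

text \<open>One finite cylinder suffices: primitivity spreads finiteness to all cylinders ending in
  \<open>I\<close> from some level \<open>n0\<close> on, where
  \<open>primitive_backward_unique\<close> applies. Vertices outside \<open>I\<close> drop out of
  the recursion because those cylinders are null.\<close>

lemma invariant_measure_cyl:
  assumes sM: "sets M = sets (path_borel B)"
    and inv: "\<And>x y n. x \<in> X \<Longrightarrow> y \<in> X \<Longrightarrow> src B (x n) = src B (y n) \<Longrightarrow> emeasure M (cyl x n) = emeasure M (cyl y n)"
    and null: "emeasure M (X - eventually_in I) = 0" and nr: "no_return I" and I: "I \<subseteq> {..<N}"
    and prim: "primitive_on I (\<lambda>v u. real (adj v u))"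
    and \<xi>: "\<And>v. v \<in> I \<Longrightarrow> \<xi> v > 0" "\<And>v. v \<in> I \<Longrightarrow> (\<Sum>u\<in>I. real (adj v u) * \<xi> u) = r * \<xi> v"
    and z: "z \<in> X" "k \<ge> 1" "lab z k \<in> I" "emeasure M (cyl z k) < \<infinity>"
  shows "\<exists>c\<ge>0. \<exists>n0\<ge>1. \<forall>x\<in>X. \<forall>n\<ge>n0. lab x n \<in> I \<longrightarrow> emeasure M (cyl x n) = ennreal (c * \<xi> (lab x n) / r ^ n)"
proof -
  let ?a = "\<lambda>v u. real (adj v u)"
  have fin: "finite I" using I finite_subset by blast
  have cylM: "cyl x n \<in> sets M" for x n using sM cyl_in_sets by auto
  define p where "p = cyl_mass M"
  have p: "emeasure M (cyl x n) = p n (lab x n)" if "x \<in> X" "n \<ge> 1" for x n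
    unfolding p_def using inv that by (rule emeasure_cyl_mass)
  have rec: "p n v = (\<Sum>u\<in>I. of_nat (adj v u) * p (Suc n) u)" if n: "n \<ge> 1" and v: "v \<in> I" for n v
  proof -
    obtain x where x: "x \<in> X" "lab x n = v" using lab_through[OF n, of v] v I by auto
    let ?h = "\<lambda>u. if u \<in> I then p (Suc n) u else 0"
    have "emeasure M (cyl x n \<inter> X) = (\<Sum>u<N. of_nat (adj (lab x n) u) * ?h u)"
    proof (rule emeasure_step[OF sM _ x(1) n])
      show "X \<in> sets M" using sets.top[of "path_borel B"] sM by simp
      fix y assume y: "y \<in> cyl x n"
      have "cyl y (Suc n) \<inter> X = cyl y (Suc n)" using cyl_subset by auto
      moreover have "emeasure M (cyl y (Suc n)) = 0" if "lab y (Suc n) \<notin> I"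
        using emeasure_left_class[OF sM null nr in_cylD[OF y] n, of "Suc n"] that in_cyl_lab[OF y x(1)] x(2) v by simp
      ultimately show "emeasure M (cyl y (Suc n) \<inter> X) = ?h (lab y (Suc n))"
        using p[OF in_cylD[OF y], of "Suc n"] by simp
    qed
    also have "cyl x n \<inter> X = cyl x n" using cyl_subset by auto
    also have "emeasure M (cyl x n) = p n v" using p[OF x(1) n] x(2) by simp
    also have "(\<Sum>u<N. of_nat (adj (lab x n) u) * ?h u) = (\<Sum>u\<in>{..<N} \<inter> I. of_nat (adj v u) * p (Suc n) u)"
      unfolding x(2) by (simp add: sum.inter_restrict if_distrib cong: if_cong)
    also have "{..<N} \<inter> I = I" using I by auto
    finally show ?thesis .
  qed
  obtain j where j: "j \<ge> 1" "\<And>v u. v \<in> I \<Longrightarrow> u \<in> I \<Longrightarrow> mpow ?a I j v u > 0"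
    using prim unfolding primitive_on_def by metis
  \<comment> \<open>A zero column would remain zero in every positive power. Hence each
    \<open>u\<close> has a predecessor in \<open>I\<close>, through which finiteness passes to the
    next level.\<close>
  have col: "\<exists>w\<in>I. adj w u > 0" if u: "u \<in> I" for u
  proof (rule ccontr)
    assume *: "\<not> ?thesis"
    obtain i where "j = Suc i" using j(1) by (cases j) auto
    then have "mpow ?a I j u u = (\<Sum>w\<in>I. mpow ?a I i u w * ?a w u)" using mpow_Suc_right[OF fin u u] by simp
    also have "\<dots> = 0" using * by (intro sum.neutral) auto
    finally show False using j(2)[OF u u] by simp
  qed
  \<comment> \<open>The finite cylinder at level \<open>k\<close> contains, by positivity of the
    \<open>j\<close>-th power, a cylinder of length \<open>k + j\<close> ending at each vertex of
    \<open>I\<close>.\<close>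
  define n0 where "n0 = k + j"
  have finite: "p n u < \<infinity>" if "n \<ge> n0" "u \<in> I" for n u
    using that
  proof (induction n arbitrary: u rule: dec_induct)
    case base
    obtain y where y: "y \<in> cyl z k" "lab y (k + j) = u"
      using mpow_reach[OF z(1,2) j(2)[OF z(3) base] I] by blast
    have "cyl y (k + j) \<subseteq> cyl z k" using cyl_antimono[of k "k + j" y] cyl_eq[OF y(1)] by auto
    then have "emeasure M (cyl y (k + j)) \<le> emeasure M (cyl z k)" using cylM by (intro emeasure_mono) auto
    then show ?case using p[OF in_cylD[OF y(1)], of "k + j"] y(2) z(2,4) by (auto simp: n0_def)
  next
    case (step n)
    obtain w where w: "w \<in> I" "adj w u > 0" using col step.prems by auto
    have "p (Suc n) u \<le> of_nat (adj w u) * p (Suc n) u"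
      using w(2) mult_right_mono[of 1 "of_nat (adj w u) :: ennreal" "p (Suc n) u"] by (simp add: Suc_le_eq)
    also have "\<dots> \<le> (\<Sum>u\<in>I. of_nat (adj w u) * p (Suc n) u)"
      using fin step.prems by (intro member_le_sum) auto
    also have "\<dots> = p n w" using rec[of n w] w(1) step.hyps z(2) by (simp add: n0_def)
    also have "\<dots> < \<infinity>" using step.IH w(1) by simp
    finally show ?case .
  qed
  define q where "q n v = enn2real (p n v)" for n v
  have pq: "p n v = ennreal (q n v)" if "n \<ge> n0" "v \<in> I" for n v
    using finite[OF that] by (simp add: q_def)
  have "\<exists>c\<ge>0. \<forall>n\<ge>n0. \<forall>v\<in>I. q n v = c * \<xi> v / r ^ n"
  proof (rule primitive_backward_unique[OF prim \<xi>])
    show "q n v \<ge> 0" for n v by (simp add: q_def)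
    fix n v assume nv: "n \<ge> n0" "v \<in> I"
    have "ennreal (q n v) = (\<Sum>u\<in>I. of_nat (adj v u) * ennreal (q (Suc n) u))"
      using rec[of n v] nv z(2) pq by (simp add: n0_def)
    also have "\<dots> = (\<Sum>u\<in>I. ennreal (?a v u * q (Suc n) u))"
      by (simp add: ennreal_mult q_def ennreal_of_nat_eq_real_of_nat)
    also have "\<dots> = ennreal (\<Sum>u\<in>I. ?a v u * q (Suc n) u)"
      by (intro sum_ennreal) (simp add: q_def)
    finally show "q n v = (\<Sum>u\<in>I. ?a v u * q (Suc n) u)"
      by (subst (asm) ennreal_inj) (auto simp: q_def intro!: sum_nonneg)
  qed auto
  then obtain c where c: "c \<ge> 0" "\<And>n v. n \<ge> n0 \<Longrightarrow> v \<in> I \<Longrightarrow> q n v = c * \<xi> v / r ^ n" by auto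
  show ?thesis
  proof (intro exI[of _ c] conjI exI[of _ n0] ballI allI impI)
    show "n0 \<ge> 1" using z(2) by (simp add: n0_def)
    then show "emeasure M (cyl x n) = ennreal (c * \<xi> (lab x n) / r ^ n)" if "x \<in> X" "n0 \<le> n" "lab x n \<in> I" for x n
      using p[of x n] pq[of n "lab x n"] c(2)[of n "lab x n"] that by simp
  qed (rule c(1))
qed
end

section \<open>Construction of the measure of a class\<close>

lemma pmf_of_weights_exists:
  assumes "finite S" "\<And>e. e \<in> S \<Longrightarrow> f e \<ge> 0" "sum f S = (1 :: real)"
  shows "\<exists>p. \<forall>e. pmf p e = (if e \<in> S then f e else 0)"
proof -
  let ?f = "\<lambda>e. if e \<in> S then f e else 0"
  have "(\<integral>\<^sup>+ e. ennreal (?f e) \<partial>count_space UNIV) = (\<Sum>e\<in>S. ennreal (?f e))"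
    by (rule nn_integral_count_space'[OF assms(1)]) auto
  also have "\<dots> = ennreal (\<Sum>e\<in>S. f e)"
    using assms(2) by (subst sum_ennreal[symmetric]) auto
  finally have "(\<integral>\<^sup>+ e. ennreal (?f e) \<partial>count_space UNIV) = 1" using assms(3) by simp
  then have "pmf (embed_pmf ?f) e = ?f e" for e
    by (intro pmf_embed_pmf) (use assms(2) in auto)
  then show ?thesis by blast
qed

context diagram
begin

text \<open>The random path chooses independently at every vertex the edge by which it would leave
  that vertex. A cylinder is then an event of product form, as the levels are disjoint.\<close>

lemma random_path_measure:
  fixes q :: "'v \<Rightarrow> 'e pmf"
  assumes q: "\<And>n v. v \<in> verts B n \<Longrightarrow> set_pmf (q v) \<subseteq> out n v"
  shows "\<exists>P. sets P = sets (path_borel B) \<and>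
    (\<forall>x\<in>X. \<forall>n. emeasure P (cyl x n) = ennreal (\<Prod>i<n. pmf (q (src B (x i))) (x i)))"
proof -
  \<comment> \<open>Replaces a value that is not an edge leaving \<open>v\<close> by one that is, so
    that the walk is a path for every sample and not only almost surely.\<close>
  define c where "c n v e = (if e \<in> out n v then e else SOME e. e \<in> out n v)" for n v e
  have c_out: "c n v e \<in> out n v" if "v \<in> verts B n" for n v e
  proof -
    have "v \<in> src B ` edges B n" using that src_edges by simp
    then have "\<exists>e. e \<in> out n v" by (auto simp: out_def)
    then have "(SOME e. e \<in> out n v) \<in> out n v" by (rule someI_ex)
    then show ?thesis by (simp add: c_def)
  qed
  obtain v0 where v0: "verts B 0 = {v0}" using diagram by (auto simp: bratteli_diagram_def)
  define walk where "walk \<omega> = rec_nat (c 0 v0 (\<omega> v0)) (\<lambda>n e. c (Suc n) (rng B e) (\<omega> (rng B e)))" for \<omega>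
  have walk_0: "walk \<omega> 0 = c 0 v0 (\<omega> v0)"
    and walk_Suc: "walk \<omega> (Suc n) = c (Suc n) (rng B (walk \<omega> n)) (\<omega> (rng B (walk \<omega> n)))" for \<omega> n
    by (simp_all add: walk_def)
  have walk_edges: "walk \<omega> n \<in> edges B n" for \<omega> n
  proof (induction n)
    case 0
    show ?case using c_out[of v0 0 "\<omega> v0"] v0 by (simp add: walk_0 out_def)
  next
    case (Suc n)
    then have "rng B (walk \<omega> n) \<in> verts B (Suc n)" using rng_edges[of n] by blast
    from c_out[OF this] show ?case by (simp add: walk_Suc out_def)
  qed
  have walk_src: "rng B (walk \<omega> n) = src B (walk \<omega> (Suc n))" for \<omega> n
  proof -
    have "rng B (walk \<omega> n) \<in> verts B (Suc n)" using walk_edges[of \<omega> n] rng_edges[of n] by blast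
    from c_out[OF this] show ?thesis by (simp add: walk_Suc out_def)
  qed
  have walk_X: "walk \<omega> \<in> X" for \<omega> using walk_edges walk_src by (simp add: path_space_def)
  have walk_c: "walk \<omega> n = c n (src B (walk \<omega> n)) (\<omega> (src B (walk \<omega> n)))" for \<omega> n
  proof (cases n)
    case 0
    have "src B (walk \<omega> 0) = v0" using src_path[OF walk_X, of \<omega> 0] v0 by simp
    then show ?thesis using 0 walk_0 by simp
  next
    case (Suc m)
    then show ?thesis using walk_Suc[of \<omega> m] walk_src[of \<omega> m] by simp
  qed
  have cyl_iff: "walk \<omega> \<in> cyl x n \<longleftrightarrow> (\<forall>i<n. c i (src B (x i)) (\<omega> (src B (x i))) = x i)" if x: "x \<in> X" for \<omega> x n
  proof
    assume "walk \<omega> \<in> cyl x n"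
    then have "\<forall>i<n. walk \<omega> i = x i" by (simp add: cylinder_def)
    then show "\<forall>i<n. c i (src B (x i)) (\<omega> (src B (x i))) = x i" using walk_c by metis
  next
    assume *: "\<forall>i<n. c i (src B (x i)) (\<omega> (src B (x i))) = x i"
    have "walk \<omega> i = x i" if "i < n" for i
      using that
    proof (induction i)
      case 0
      have "src B (walk \<omega> 0) = src B (x 0)" by (rule src_path_0[OF walk_X x])
      then show ?case using * 0 walk_c[of \<omega> 0] by simp
    next
      case (Suc i)
      have "src B (walk \<omega> (Suc i)) = src B (x (Suc i))"
        using walk_src[of \<omega> i] pathD(2)[OF x, of i] Suc by simp
      then show ?case using * Suc.prems walk_c[of \<omega> "Suc i"] by simp
    qed
    then show "walk \<omega> \<in> cyl x n" using walk_X by (simp add: cylinder_def)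
  qed
  interpret product_prob_space "\<lambda>v. measure_pmf (q v)" UNIV
    by (simp add: product_prob_space_def product_prob_space_axioms_def product_sigma_finite_def
        measure_pmf.prob_space_axioms measure_pmf.sigma_finite_measure_axioms)
  let ?\<Omega> = "\<Pi>\<^sub>M v\<in>UNIV. measure_pmf (q v)"
  have ev: "walk -` cyl x n \<inter> space ?\<Omega> =
      {\<omega> \<in> space ?\<Omega>. \<forall>v\<in>(\<lambda>i. src B (x i)) ` {..<n}. \<omega> v \<in> {e. \<forall>i<n. src B (x i) = v \<longrightarrow> c i v e = x i}}"
    if x: "x \<in> X" for x n
    using cyl_iff[OF x] by (auto, metis)
  \<comment> \<open>A path visits each vertex at most once, so its steps read different coordinates
    of the product and the probabilities multiply.\<close>
  have inj: "inj_on (\<lambda>i. src B (x i)) A" if x: "x \<in> X" for x A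
    by (rule inj_onI) (metis src_path[OF x] verts_disjoint)
  have prob: "emeasure ?\<Omega> (walk -` cyl x n \<inter> space ?\<Omega>) = ennreal (\<Prod>i<n. pmf (q (src B (x i))) (x i))"
    if x: "x \<in> X" for x n
  proof -
    have "emeasure ?\<Omega> (walk -` cyl x n \<inter> space ?\<Omega>) =
      (\<Prod>v\<in>(\<lambda>i. src B (x i)) ` {..<n}. emeasure (measure_pmf (q v)) {e. \<forall>i<n. src B (x i) = v \<longrightarrow> c i v e = x i})"
      unfolding ev[OF x] by (intro emeasure_PiM_Collect) auto
    also have "\<dots> = (\<Prod>i<n. emeasure (measure_pmf (q (src B (x i)))) {e. \<forall>j<n. src B (x j) = src B (x i) \<longrightarrow> c j (src B (x i)) e = x j})"
      by (subst prod.reindex[OF inj[OF x]]) simp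
    also have "\<dots> = (\<Prod>i<n. ennreal (pmf (q (src B (x i))) (x i)))"
    proof (rule prod.cong)
      fix i assume i: "i \<in> {..<n}"
      let ?v = "src B (x i)"
      have "{e. \<forall>j<n. src B (x j) = ?v \<longrightarrow> c j ?v e = x j} = {e. c i ?v e = x i}"
        using i inj[OF x, of UNIV] by (auto simp: inj_on_def)
      \<comment> \<open>The correction made by \<open>c\<close> takes place on a null set of
        \<open>q\<close>, because \<open>q\<close> is supported on the edges leaving the
        vertex.\<close>
      moreover have "emeasure (measure_pmf (q ?v)) {e. c i ?v e = x i} = emeasure (measure_pmf (q ?v)) {x i}"
      proof (rule emeasure_eq_AE)
        show "AE e in measure_pmf (q ?v). (e \<in> {e. c i ?v e = x i}) = (e \<in> {x i})"
          using q[OF src_path[OF x, of i]] by (auto simp: AE_measure_pmf_iff c_def)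
      qed auto
      ultimately show "emeasure (measure_pmf (q ?v)) {e. \<forall>j<n. src B (x j) = ?v \<longrightarrow> c j ?v e = x j} = ennreal (pmf (q ?v) (x i))"
        by (simp add: emeasure_pmf_single)
    qed simp
    also have "\<dots> = ennreal (\<Prod>i<n. pmf (q (src B (x i))) (x i))" by (rule prod_ennreal) simp
    finally show ?thesis .
  qed
  have meas: "walk \<in> ?\<Omega> \<rightarrow>\<^sub>M path_borel B"
  proof (rule measurable_into_borel)
    show "walk \<in> space ?\<Omega> \<rightarrow> X" using walk_X by auto
    fix x n assume x: "x \<in> X"
    have "{\<omega> \<in> space ?\<Omega>. \<forall>v\<in>(\<lambda>i. src B (x i)) ` {..<n}. \<omega> v \<in> {e. \<forall>i<n. src B (x i) = v \<longrightarrow> c i v e = x i}} \<in> sets ?\<Omega>"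
    proof (rule sets.sets_Collect_finite_All)
      fix v
      show "{\<omega> \<in> space ?\<Omega>. \<omega> v \<in> {e. \<forall>i<n. src B (x i) = v \<longrightarrow> c i v e = x i}} \<in> sets ?\<Omega>"
      proof -
        let ?Z = "{e. \<forall>i<n. src B (x i) = v \<longrightarrow> c i v e = x i}"
        have eq: "{\<omega> \<in> space ?\<Omega>. \<omega> v \<in> ?Z} = (\<lambda>\<omega>. \<omega> v) -` ?Z \<inter> space ?\<Omega>" by blast
        have m: "(\<lambda>\<omega>. \<omega> v) \<in> ?\<Omega> \<rightarrow>\<^sub>M measure_pmf (q v)"
          by (rule measurable_component_singleton) (rule UNIV_I)
        have "?Z \<in> sets (measure_pmf (q v))" unfolding sets_measure_pmf by (rule UNIV_I)
        then show ?thesis unfolding eq by (rule measurable_sets[OF m])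
      qed
    qed simp
    then show "walk -` cyl x n \<inter> space ?\<Omega> \<in> sets ?\<Omega>" unfolding ev[OF x] .
  qed
  show ?thesis
    by (intro exI[of _ "distr ?\<Omega> (path_borel B) walk"] conjI ballI allI)
      (simp_all add: emeasure_distr[OF meas] prob)
qed

end

section \<open>The measure with prescribed cylinder masses\<close>

context stationary_diagram
begin

text \<open>The scale of \<xi> fixes the constant multiple. No mass is prescribed for cylinders that
  end outside \<open>I\<close>; it may be infinite, and deciding when the total is finite is the
  later task.\<close>

definition class_measure :: "nat set \<Rightarrow> (nat \<Rightarrow> real) \<Rightarrow> real \<Rightarrow> (nat \<Rightarrow> 'e) measure \<Rightarrow> bool" where
  "class_measure I \<xi> r M \<longleftrightarrow> sets M = sets (path_borel B) \<and> sigma_finite_measure M \<and>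
     emeasure M (X - eventually_in I) = 0 \<and>
     (\<forall>x\<in>X. \<forall>n\<ge>1. lab x n \<in> I \<longrightarrow> emeasure M (cyl x n) = ennreal (\<xi> (lab x n) / r ^ n))"

text \<open>The measure has a density with respect to a Markov chain that is spread over all edges
  outside \<open>I\<close> and follows the stochastic matrix normalised by \<open>\<xi>\<close> inside \<open>I\<close>; the density
  only depends on the path up to its entrance into \<open>I\<close>.\<close>

lemma class_measure_exists:
  assumes I: "I \<subseteq> {..<N}" and nr: "no_return I" and r: "r > 0"
    and \<xi>: "\<And>v. v \<in> I \<Longrightarrow> \<xi> v > 0" "\<And>v. v \<in> I \<Longrightarrow> (\<Sum>u\<in>I. real (adj v u) * \<xi> u) = r * \<xi> v"
  shows "\<exists>M. class_measure I \<xi> r M"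
proof -
  define ix where "ix n v = the_inv_into {..<N} (\<nu> n) v" for n v
  have lab_ix: "lab x n = ix n (src B (x n))" for x n by (simp add: lab_def ix_def)
  have ix: "ix n (\<nu> n u) = u" if "n \<ge> 1" "u < N" for n u
    using numbering[OF that(1)] that(2) by (auto simp: ix_def bij_betw_def the_inv_into_f_f)
  \<comment> \<open>A Doob transform: by the eigenvector equation these weights sum to 1 over the
    edges leaving a vertex of \<open>I\<close>, although edges out of \<open>I\<close> get weight
    0.\<close>
  define w where "w n v e = (if ix (Suc n) (rng B e) \<in> I then \<xi> (ix (Suc n) (rng B e)) / (r * \<xi> (ix n v)) else 0)" for n v e
  define inside where "inside n v \<longleftrightarrow> n \<ge> 1 \<and> ix n v \<in> I" for n v
  \<comment> \<open>Outside \<open>I\<close> any positive weights will do, since the density divides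
    them out again.\<close>
  define good where "good p n v \<longleftrightarrow> set_pmf p \<subseteq> out n v \<and>
      (if inside n v then \<forall>e\<in>out n v. pmf p e = w n v e else \<forall>e\<in>out n v. pmf p e > 0)" for p n v
  have ex1: "\<exists>p. good p n v" if v: "v \<in> verts B n" for n v
  proof (cases "inside n v")
    case True
    then have n: "n \<ge> 1" and iI: "ix n v \<in> I" by (auto simp: inside_def)
    then have iN: "ix n v < N" using I by auto
    have \<nu>: "\<nu> n (ix n v) = v"
      using numbering[OF n] v unfolding ix_def by (metis bij_betw_def f_the_inv_into_f)
    have "sum (w n v) (out n v) = (\<Sum>u<N. of_nat (adj (ix n v) u) * (if u \<in> I then \<xi> u / (r * \<xi> (ix n v)) else 0))"
      using sum_out[OF n iN, of "w n v" "\<lambda>u. if u \<in> I then \<xi> u / (r * \<xi> (ix n v)) else 0"] ix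
      unfolding \<nu> by (auto simp: w_def)
    also have "\<dots> = (\<Sum>u\<in>{..<N} \<inter> I. of_nat (adj (ix n v) u) * (\<xi> u / (r * \<xi> (ix n v))))"
      by (simp add: sum.inter_restrict if_distrib cong: if_cong)
    also have "{..<N} \<inter> I = I" using I by auto
    also have "(\<Sum>u\<in>I. of_nat (adj (ix n v) u) * (\<xi> u / (r * \<xi> (ix n v)))) = 1"
      using \<xi>(2)[OF iI] \<xi>(1)[OF iI] r by (simp add: sum_divide_distrib[symmetric])
    finally have 1: "sum (w n v) (out n v) = 1" .
    have "w n v e \<ge> 0" for e using \<xi>(1) iI r by (auto simp: w_def less_imp_le)
    then obtain p where "\<forall>e. pmf p e = (if e \<in> out n v then w n v e else 0)"
      using pmf_of_weights_exists[OF finite_out _ 1] by blast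
    then show ?thesis using True by (auto simp: good_def set_pmf_iff intro!: exI[of _ p] split: if_splits)
  next
    case False
    have "v \<in> src B ` edges B n" using v src_edges by simp
    then have ne: "out n v \<noteq> {}" by (auto simp: out_def)
    then show ?thesis using False finite_out[of n v]
      by (intro exI[of _ "pmf_of_set (out n v)"]) (auto simp: good_def card_gt_0_iff)
  qed
  have "\<exists>p. \<forall>n. v \<in> verts B n \<longrightarrow> good p n v" for v
  proof (cases "\<exists>n. v \<in> verts B n")
    case True
    then obtain n where n: "v \<in> verts B n" by auto
    obtain p where "good p n v" using ex1[OF n] by auto
    then show ?thesis using verts_disjoint[OF n] by blast
  qed auto
  then obtain q where q: "\<And>v n. v \<in> verts B n \<Longrightarrow> good (q v) n v" by metis
  define Q :: "(nat \<Rightarrow> 'e) \<Rightarrow> nat \<Rightarrow> real" where "Q x n = (\<Prod>i<n. pmf (q (src B (x i))) (x i))" for x n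
  obtain P where P: "sets P = sets (path_borel B)" "\<And>x n. x \<in> X \<Longrightarrow> emeasure P (cyl x n) = ennreal (Q x n)"
    using random_path_measure[of q] q unfolding good_def Q_def by metis
  have x_out: "x i \<in> out i (src B (x i))" if "x \<in> X" for x i using pathD(1)[OF that] by (simp add: out_def)
  have in_I: "pmf (q (src B (x i))) (x i) = (if lab x (Suc i) \<in> I then \<xi> (lab x (Suc i)) / (r * \<xi> (lab x i)) else 0)"
    if "x \<in> X" "i \<ge> 1" "lab x i \<in> I" for x i
    using q[OF src_path[OF that(1)], of i] x_out[OF that(1)] that pathD(2)[OF that(1), of i]
    by (simp add: good_def inside_def w_def lab_ix)
  have out_I: "pmf (q (src B (x i))) (x i) > 0" if "x \<in> X" "\<not> (i \<ge> 1 \<and> lab x i \<in> I)" for x i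
    using q[OF src_path[OF that(1)], of i] x_out[OF that(1)] that by (simp add: good_def inside_def lab_ix)
  have Q_Suc: "Q x (Suc n) = Q x n * pmf (q (src B (x n))) (x n)" for x n by (simp add: Q_def)
  have Q_pos: "Q x n > 0" if x: "x \<in> X" "n \<ge> 1" "lab x n \<in> I" for x n
    unfolding Q_def
  proof (rule prod_pos)
    fix i assume i: "i \<in> {..<n}"
    show "pmf (q (src B (x i))) (x i) > 0"
    proof (cases "i \<ge> 1 \<and> lab x i \<in> I")
      case True
      then have "lab x (Suc i) \<in> I" using no_returnD[OF nr x(1), of i "Suc i" n] x i by simp
      then show ?thesis using in_I[OF x(1), of i] True \<xi>(1) r by simp
    next
      case False
      then show ?thesis using out_I x by blast
    qed
  qed
  \<comment> \<open>The required mass of a cylinder divided by its probability. A step inside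
    \<open>I\<close> multiplies both by the same factor, so the quotient stays constant while the
    path is in \<open>I\<close>.\<close>
  define g where "g n x = \<xi> (lab x n) / r ^ n / Q x n" for n x
  have g_pos: "g n x > 0" if "x \<in> X" "n \<ge> 1" "lab x n \<in> I" for x n
    using Q_pos[OF that] \<xi>(1) that r by (simp add: g_def)
  have g_Suc: "g (Suc n) x = g n x" if x: "x \<in> X" "n \<ge> 1" "lab x n \<in> I" "lab x (Suc n) \<in> I" for x n
  proof -
    have pos: "\<xi> (lab x n) > 0" "\<xi> (lab x (Suc n)) > 0" using \<xi>(1) x by auto
    have p: "pmf (q (src B (x n))) (x n) = \<xi> (lab x (Suc n)) / (r * \<xi> (lab x n))"
      using in_I[OF x(1-3)] x(4) by simp
    show ?thesis
      unfolding g_def Q_Suc p using pos Q_pos[OF x(1-3)] r by (simp add: field_simps)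
  qed
  have g_le: "g m x = g n x" if x: "x \<in> X" "n \<ge> 1" "lab x n \<in> I" "lab x m \<in> I" "n \<le> m" for x n m
    using x(5,4)
  proof (induction m rule: dec_induct)
    case (step m)
    have "lab x m \<in> I" by (rule no_returnD[OF nr x(1,2) step.hyps(1) _ x(3) step.prems]) simp
    then show ?case using g_Suc[OF x(1), of m] step x(2) by simp
  qed simp
  \<comment> \<open>All nonzero values \<open>h n x\<close> of one path agree. The supremum picks
    out this common value, or 0 for a path that is never in \<open>I\<close>, and is measurable as a
    countable supremum.\<close>
  define h where "h n x = (if n \<ge> 1 \<and> lab x n \<in> I then ennreal (g n x) else 0)" for n x
  define f where "f x = (SUP n. h n x)" for x
  have prefix: "lab y n = lab x n" "Q y n = Q x n" if "y \<in> cyl x n" "x \<in> X" for x y n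
  proof -
    show "lab y n = lab x n" by (rule in_cyl_lab[OF that])
    have "y i = x i" if "i < n" for i using \<open>y \<in> cyl x n\<close> that by (simp add: cylinder_def)
    then show "Q y n = Q x n" by (simp add: Q_def)
  qed
  have h_meas: "h n \<in> borel_measurable (path_borel B)" for n
    by (rule measurable_prefix_borel[of n]) (simp add: h_def g_def prefix)
  have f_meas: "f \<in> borel_measurable P"
    unfolding f_def using h_meas P(1) by (intro borel_measurable_SUP) (simp_all cong: measurable_cong_sets)
  have f_eq: "f x = ennreal (g n x)" if x: "x \<in> X" "n \<ge> 1" "lab x n \<in> I" for x n
  proof (rule antisym)
    show "f x \<le> ennreal (g n x)"
      unfolding f_def
    proof (rule SUP_least)
      fix m
      show "h m x \<le> ennreal (g n x)"
        using g_le[of x n m] g_le[of x m n] x nat_le_linear[of m n] by (auto simp: h_def)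
    qed
    show "ennreal (g n x) \<le> f x"
      unfolding f_def using x by (intro SUP_upper2[of n]) (auto simp: h_def)
  qed
  have f_0: "f x = 0" if "\<forall>n\<ge>1. lab x n \<notin> I" for x
  proof -
    have "h n x = 0" for n using that by (auto simp: h_def)
    then show ?thesis by (simp add: f_def)
  qed
  define M where "M = density P f"
  have sM: "sets M = sets (path_borel B)" by (simp add: M_def P(1))
  have spP: "space P = X" using sets_eq_imp_space_eq[OF P(1)] by simp
  obtain x0 where x0: "x0 \<in> X" using path_space_nonempty by auto
  interpret P: prob_space P
    using P(2)[OF x0, of 0] by (intro prob_spaceI) (simp add: spP cyl_0 Q_def)
  \<comment> \<open>The chain almost surely never leaves \<open>I\<close>, and the density vanishes
    on paths that never enter it. Together this gives concentration on
    \<open>eventually_in I\<close>.\<close>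
  have leave: "emeasure P {x \<in> X. lab x k \<in> I \<and> lab x (Suc k) \<notin> I} = 0" if k: "k \<ge> 1" for k
  proof -
    let ?E = "{x \<in> X. lab x k \<in> I \<and> lab x (Suc k) \<notin> I}"
    have E: "?E \<in> sets P" unfolding P(1)
      by (rule prefix_set_measurable[of "Suc k"]) (simp add: in_cyl_lab_le)
    have "emeasure P (cyl d (Suc k) \<inter> ?E) = 0" if d: "d \<in> Rep (Suc k)" for d
    proof (cases "lab d k \<in> I \<and> lab d (Suc k) \<notin> I")
      case True
      have dX: "d \<in> X" using d Rep_subset by auto
      have "Q d (Suc k) = 0" using in_I[OF dX k] True by (simp add: Q_Suc)
      then have "emeasure P (cyl d (Suc k)) = 0" using P(2)[OF dX] by simp
      then show ?thesis using emeasure_mono[of "cyl d (Suc k) \<inter> ?E" "cyl d (Suc k)" P] P(1) cyl_in_sets by simp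
    next
      case False
      have dX: "d \<in> X" using d Rep_subset by auto
      have "lab y k = lab d k" "lab y (Suc k) = lab d (Suc k)" if "y \<in> cyl d (Suc k)" for y
        using in_cyl_lab_le[OF that dX] by auto
      then have "cyl d (Suc k) \<inter> ?E = {}" using False by auto
      then show ?thesis by simp
    qed
    then show ?thesis using emeasure_Rep_sum[OF P(1) E, of "Suc k"] by simp
  qed
  have null: "emeasure M (X - eventually_in I) = 0"
  proof -
    let ?Z = "\<Union>k\<in>{1..}. {x \<in> X. lab x k \<in> I \<and> lab x (Suc k) \<notin> I}"
    have Em: "{x \<in> X. lab x k \<in> I \<and> lab x (Suc k) \<notin> I} \<in> sets P" for k
      unfolding P(1) by (rule prefix_set_measurable[of "Suc k"]) (simp add: in_cyl_lab_le)
    have "?Z \<in> null_sets P"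
      using leave Em by (intro null_sets_UN') auto
    moreover have "f x * indicator (X - eventually_in I) x = 0" if x: "x \<in> space P" "x \<notin> ?Z" for x
    proof (cases "\<exists>n\<ge>1. lab x n \<in> I")
      case True
      then obtain n where n: "n \<ge> 1" "lab x n \<in> I" by auto
      have "lab x m \<in> I" if "n \<le> m" for m
        using that
      proof (induction m rule: dec_induct)
        case (step m)
        then show ?case using x n(1) spP by auto
      qed (rule n(2))
      then have "x \<in> eventually_in I" using x spP by (auto simp: eventually_in_def)
      then show ?thesis by simp
    next
      case False
      then show ?thesis using f_0 by simp
    qed
    ultimately have "AE x in P. f x * indicator (X - eventually_in I) x = 0"
      by (intro AE_I'[of ?Z]) auto
    moreover have Xe: "X - eventually_in I \<in> sets P"
      using eventually_in_measurable sets.top[of "path_borel B"] P(1) by auto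
    ultimately show ?thesis
      unfolding M_def using f_meas
      by (subst emeasure_density) (auto simp: nn_integral_0_iff_AE)
  qed
  have cylM: "emeasure M (cyl x n) = ennreal (\<xi> (lab x n) / r ^ n)" if x: "x \<in> X" "n \<ge> 1" "lab x n \<in> I" for x n
  proof -
    have "emeasure M (cyl x n) = (\<integral>\<^sup>+ y. f y * indicator (cyl x n) y \<partial>P)"
      unfolding M_def using f_meas P(1) cyl_in_sets by (intro emeasure_density) auto
    also have "\<dots> = (\<integral>\<^sup>+ y. ennreal (g n x) * indicator (cyl x n) y \<partial>P)"
    proof (rule nn_integral_cong)
      fix y
      have "f y = ennreal (g n x)" if y: "y \<in> cyl x n"
      proof -
        have "f y = ennreal (g n y)" using prefix(1)[OF y x(1)] x by (intro f_eq[OF in_cylD[OF y]]) auto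
        then show ?thesis using prefix[OF y x(1)] by (simp add: g_def)
      qed
      then show "f y * indicator (cyl x n) y = ennreal (g n x) * indicator (cyl x n) y"
        by (auto simp: indicator_def)
    qed
    also have "\<dots> = ennreal (g n x) * ennreal (Q x n)"
      using P(1) cyl_in_sets P(2)[OF x(1)] by (subst nn_integral_cmult_indicator) auto
    also have "\<dots> = ennreal (\<xi> (lab x n) / r ^ n)"
      using g_pos[OF x] Q_pos[OF x] by (subst ennreal_mult[symmetric]) (auto simp: g_def)
    finally show ?thesis .
  qed
  \<comment> \<open>A density with finite values over a probability measure is enough, whatever the
    total mass.\<close>
  have "sigma_finite_measure M"
    unfolding M_def
  proof (subst P.sigma_finite_iff_density_finite[OF f_meas], rule AE_I2)
    fix x assume "x \<in> space P"
    then show "f x \<noteq> \<infinity>" using f_eq[of x] f_0[of x] spP by (cases "\<exists>n\<ge>1. lab x n \<in> I") auto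
  qed
  then show ?thesis using sM null cylM unfolding class_measure_def by blast
qed

end

section \<open>Invariance, uniqueness, ergodicity and atoms of class measures\<close>

context diagram
begin

lemma switch_switch_vimage:
  assumes "x \<in> X" "y \<in> X" "src B (x n) = src B (y n)" "n \<le> m" "w \<in> X"
  shows "switch x y n -` cyl w m \<inter> X = cyl (switch x y n w) m"
proof -
  let ?g = "switch x y n"
  note inv = switch_involution[OF assms(1-3)]
  have pre: "?g v \<in> cyl (?g u) m" if "u \<in> X" "v \<in> cyl u m" for u v
  proof -
    have "restrict ?g X v \<in> cyl (restrict ?g X u) m"
      using coordinate_change_mono[OF switch_coordinate_change[OF assms(1-3)] assms(4)] that
      unfolding coordinate_change_def by blast
    then show ?thesis using that(1) in_cylD[OF that(2)] by simp
  qed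
  show ?thesis
  proof
    show "?g -` cyl w m \<inter> X \<subseteq> cyl (?g w) m"
    proof
      fix z assume z: "z \<in> ?g -` cyl w m \<inter> X"
      then show "z \<in> cyl (?g w) m" using pre[OF assms(5), of "?g z"] inv(2)[of z] by simp
    qed
    show "cyl (?g w) m \<subseteq> ?g -` cyl w m \<inter> X"
    proof
      fix z assume z: "z \<in> cyl (?g w) m"
      show "z \<in> ?g -` cyl w m \<inter> X"
        using pre[OF inv(1)[OF assms(5)] z] inv(2)[OF assms(5)] in_cylD[OF z] by simp
    qed
  qed
qed

end

context stationary_diagram
begin

lemma class_measureD:
  assumes "class_measure I \<xi> r M"
  shows "sets M = sets (path_borel B)" "space M = X" "sigma_finite_measure M"
    "emeasure M (X - eventually_in I) = 0"
    "x \<in> X \<Longrightarrow> n \<ge> 1 \<Longrightarrow> lab x n \<in> I \<Longrightarrow> emeasure M (cyl x n) = ennreal (\<xi> (lab x n) / r ^ n)"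
  using assms sets_eq_imp_space_eq[of M "path_borel B"] unfolding class_measure_def by auto

lemma lab_tail: "x n = y n \<Longrightarrow> lab x n = lab y n"
  by (simp add: lab_def)

lemma eventually_in_tail:
  assumes "x \<in> X" "y \<in> X" "\<forall>i\<ge>n. x i = y i"
  shows "x \<in> eventually_in I \<longleftrightarrow> y \<in> eventually_in I"
proof -
  have *: "y \<in> eventually_in I" if "x \<in> eventually_in I" "x \<in> X" "y \<in> X" "\<forall>i\<ge>n. x i = y i" for x y
  proof -
    obtain k where k: "\<And>m. m \<ge> k \<Longrightarrow> lab x m \<in> I" using \<open>x \<in> eventually_in I\<close> by (auto simp: eventually_in_def)
    have "lab y m \<in> I" if "m \<ge> max k n" for m
      using k[of m] \<open>\<forall>i\<ge>n. x i = y i\<close> lab_tail[of x m y] that by simp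
    then show ?thesis using \<open>y \<in> X\<close> unfolding eventually_in_def by blast
  qed
  show ?thesis using *[of x y] *[of y x] assms by auto
qed

text \<open>The image of \<open>M\<close> under a switch has the same null set and, from level
  \<open>max 1 n\<close> on, the same cylinder masses: a switch changes neither the length nor the
  end vertex of such a cylinder. So the two measures coincide.\<close>

lemma class_measure_switch_invariant:
  assumes nr: "no_return I" and M: "class_measure I \<xi> r M"
  shows "switch_invariant M"
  unfolding switch_invariant_def
proof (intro ballI allI impI)
  fix x y n E assume xy: "x \<in> X" "y \<in> X" "src B (x n) = src B (y n)" and E: "E \<in> sets M"
  let ?g = "switch x y n"
  note D = class_measureD[OF M]
  note inv = switch_involution[OF xy]
  have gm: "?g \<in> M \<rightarrow>\<^sub>M path_borel B"
    using switch_measurable[OF xy] by (simp cong: measurable_cong_sets[OF D(1) refl])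
  let ?M' = "distr M (path_borel B) ?g"
  have M': "emeasure ?M' F = emeasure M (?g -` F \<inter> X)" if "F \<in> sets (path_borel B)" for F
    using emeasure_distr[OF gm that] D(2) by simp
  have ev: "?g -` (X - eventually_in I) \<inter> X = X - eventually_in I"
  proof -
    have "?g z \<in> eventually_in I \<longleftrightarrow> z \<in> eventually_in I" if "z \<in> X" for z
      using inv(1)[OF that] that switch_preserves_tail by (intro eventually_in_tail[of _ _ n]) auto
    then show ?thesis using inv(1) by auto
  qed
  have "?M' = M"
  proof (rule measure_eqI_eventually_in[OF _ D(1) nr _ D(4), where ?n0.0 = "max 1 n"])
    have "X - eventually_in I \<in> sets (path_borel B)"
      using eventually_in_measurable sets.top[of "path_borel B"] by auto
    then show "emeasure ?M' (X - eventually_in I) = 0" using M' ev D(4) by simp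
    fix w m assume w: "w \<in> X" "max 1 n \<le> m" "lab w m \<in> I"
    have "?g -` cyl w m \<inter> X = cyl (?g w) m" using switch_switch_vimage[OF xy _ w(1), of m] w(2) by simp
    moreover have l: "lab (?g w) m = lab w m" using switch_preserves_tail[of n m] w(2) by (intro lab_tail) simp
    ultimately show "emeasure ?M' (cyl w m) = emeasure M (cyl w m)"
      using M'[OF cyl_in_sets, of w m] D(5)[OF w(1)] D(5)[OF inv(1)[OF w(1)], of m] w(2,3) by simp
    then show "emeasure ?M' (cyl w m) < \<infinity>" using D(5)[OF w(1)] w(2,3) by simp
  qed auto
  then show "emeasure M (?g -` E \<inter> X) = emeasure M E" using M'[of E] E D(1) by simp
qed

text \<open>Of \<open>M'\<close> only equal masses of cylinders are required, and
  \<open>c = 0\<close> is allowed: the proof of ergodicity applies this to the restriction of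
  \<open>M\<close> to a saturated set, which may be zero.\<close>

lemma measure_eq_scaled_class_measure:
  assumes nr: "no_return I" and I: "I \<subseteq> {..<N}"
    and prim: "primitive_on I (\<lambda>v u. real (adj v u))"
    and \<xi>: "\<And>v. v \<in> I \<Longrightarrow> \<xi> v > 0" "\<And>v. v \<in> I \<Longrightarrow> (\<Sum>u\<in>I. real (adj v u) * \<xi> u) = r * \<xi> v"
    and M: "class_measure I \<xi> r M"
    and sM': "sets M' = sets (path_borel B)" and null: "emeasure M' (X - eventually_in I) = 0"
    and inv: "\<And>x y n. x \<in> X \<Longrightarrow> y \<in> X \<Longrightarrow> src B (x n) = src B (y n) \<Longrightarrow> emeasure M' (cyl x n) = emeasure M' (cyl y n)"
    and z: "z \<in> X" "k \<ge> 1" "lab z k \<in> I" "emeasure M' (cyl z k) < \<infinity>"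
  shows "\<exists>c\<ge>0. M' = scale_measure (ennreal c) M"
proof -
  have r: "r > 0" by (rule primitive_eigenvalue_pos[OF prim \<xi>])
  note D = class_measureD[OF M]
  obtain c n0 where c: "c \<ge> 0" "n0 \<ge> 1"
    "\<And>x n. x \<in> X \<Longrightarrow> n \<ge> n0 \<Longrightarrow> lab x n \<in> I \<Longrightarrow> emeasure M' (cyl x n) = ennreal (c * \<xi> (lab x n) / r ^ n)"
    using invariant_measure_cyl[OF sM' inv null nr I prim \<xi> z] by blast
  have "M' = scale_measure (ennreal c) M"
  proof (rule measure_eqI_eventually_in[OF sM' _ nr null _ c(2)])
    show "sets (scale_measure (ennreal c) M) = sets (path_borel B)" using D(1) by simp
    show "emeasure (scale_measure (ennreal c) M) (X - eventually_in I) = 0" using D(4) by simp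
    fix x n assume x: "x \<in> X" "n \<ge> n0" "lab x n \<in> I"
    show "emeasure M' (cyl x n) = emeasure (scale_measure (ennreal c) M) (cyl x n)"
      using c(3)[OF x] D(5)[OF x(1) _ x(3)] x(2) c(1,2) \<xi>(1)[OF x(3)] r
      by (simp add: ennreal_mult[symmetric])
    show "emeasure M' (cyl x n) < \<infinity>" using c(3)[OF x] by simp
  qed
  with c(1) show ?thesis by blast
qed

lemma class_measure_ergodic:
  assumes nr: "no_return I" and I: "I \<subseteq> {..<N}"
    and prim: "primitive_on I (\<lambda>v u. real (adj v u))"
    and \<xi>: "\<And>v. v \<in> I \<Longrightarrow> \<xi> v > 0" "\<And>v. v \<in> I \<Longrightarrow> (\<Sum>u\<in>I. real (adj v u) * \<xi> u) = r * \<xi> v"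
    and M: "class_measure I \<xi> r M"
  shows "tail_ergodic B M"
  unfolding tail_ergodic_def
proof (intro ballI impI)
  fix S assume S: "S \<in> sets M" and sat: "tail_rel B `` S = S"
  note D = class_measureD[OF M]
  have sinv: "switch_invariant M" by (rule class_measure_switch_invariant[OF nr M])
  let ?M' = "density M (indicator S)"
  have M': "emeasure ?M' E = emeasure M (S \<inter> E)" if "E \<in> sets M" for E
    using emeasure_restricted[OF S that] .
  have SX: "S \<subseteq> X" using sets.sets_into_space[OF S] D(2) by simp
  have XeM: "X - eventually_in I \<in> sets M"
    using eventually_in_measurable sets.top[of "path_borel B"] D(1) by auto
  obtain v where v: "v \<in> I" using prim by (auto simp: primitive_on_def)
  obtain z where z: "z \<in> X" "lab z 1 = v" using lab_through[of 1 v] v I by auto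
  have "\<exists>c\<ge>0. ?M' = scale_measure (ennreal c) M"
  proof (rule measure_eq_scaled_class_measure[OF nr I prim \<xi> M _ _ _ z(1)])
    show "sets ?M' = sets (path_borel B)" using D(1) by simp
    have "emeasure M (S \<inter> (X - eventually_in I)) \<le> emeasure M (X - eventually_in I)"
      using XeM by (intro emeasure_mono) auto
    then show "emeasure ?M' (X - eventually_in I) = 0" using M'[OF XeM] D(4) by simp
    show "emeasure ?M' (cyl x n) = emeasure ?M' (cyl y n)"
      if xy: "x \<in> X" "y \<in> X" "src B (x n) = src B (y n)" for x y n
    proof -
      note inv = switch_involution[OF xy]
      have sw: "switch x y n z \<in> S" if z: "z \<in> S" for z
      proof -
        have "z \<in> X" using SX z by auto
        moreover have "\<forall>i\<ge>n. z i = switch x y n z i" by (simp add: switch_preserves_tail)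
        ultimately have "(z, switch x y n z) \<in> tail_rel B"
          using inv(1)[of z] by (auto simp: tail_rel_def)
        then show ?thesis using sat z by blast
      qed
      have "switch x y n -` (S \<inter> cyl x n) \<inter> X = (switch x y n -` S \<inter> X) \<inter> (switch x y n -` cyl x n \<inter> X)"
        by auto
      also have "switch x y n -` S \<inter> X = S"
      proof
        show "S \<subseteq> switch x y n -` S \<inter> X" using sw SX by auto
        show "switch x y n -` S \<inter> X \<subseteq> S"
        proof
          fix w assume "w \<in> switch x y n -` S \<inter> X"
          then show "w \<in> S" using sw[of "switch x y n w"] inv(2)[of w] by simp
        qed
      qed
      also have "switch x y n -` cyl x n \<inter> X = cyl y n" by (rule switch_vimage_cyl[OF xy])
      finally have "switch x y n -` (S \<inter> cyl x n) \<inter> X = S \<inter> cyl y n" .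
      moreover have "emeasure M (switch x y n -` (S \<inter> cyl x n) \<inter> X) = emeasure M (S \<inter> cyl x n)"
        using sinv xy S cyl_in_sets[of x n] D(1) unfolding switch_invariant_def by blast
      ultimately show ?thesis using M' cyl_in_sets D(1) by simp
    qed
    have "emeasure M (S \<inter> cyl z 1) \<le> emeasure M (cyl z 1)"
      using cyl_in_sets D(1) by (intro emeasure_mono) auto
    also have "\<dots> < \<infinity>" using D(5)[OF z(1), of 1] z(2) v by simp
    finally show "emeasure ?M' (cyl z 1) < \<infinity>" using M'[of "cyl z 1"] cyl_in_sets D(1) by simp
  qed (use z v in auto)
  then obtain c where c: "c \<ge> 0" "?M' = scale_measure (ennreal c) M" by auto
  have top: "space M \<in> sets M" by simp
  show "S \<in> null_sets M \<or> space M - S \<in> null_sets M"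
  proof (cases "c = 0")
    case True
    have "emeasure M S = emeasure ?M' (space M)"
      using M'[OF top] SX D(2) by (simp add: Int_absorb2)
    then have "emeasure M S = 0" unfolding c(2) using True by simp
    then show ?thesis using S by auto
  next
    case False
    \<comment> \<open>\<open>?M'\<close> gives no mass to the complement of \<open>S\<close>, so a
      nonzero factor \<open>c\<close> forces \<open>M\<close> to give it none either.\<close>
    have "emeasure ?M' (space M - S) = 0" using M'[of "space M - S"] S by (simp add: Diff_disjoint)
    then have "ennreal c * emeasure M (space M - S) = 0" unfolding c(2) by simp
    then have "emeasure M (space M - S) = 0" using False c(1) by simp
    then show ?thesis using S by auto
  qed
qed

text \<open>Cylinders of length \<open>m\<close> ending in \<open>I\<close> have mass at most
  \<open>K / r ^ m\<close>, which tends to 0. Cutting a part of \<open>S\<close> of finite positive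
  mass by long cylinders therefore yields strictly smaller pieces.\<close>

lemma class_measure_nonatomic:
  assumes nr: "no_return I" and I: "I \<subseteq> {..<N}" and r: "r > 1" and M: "class_measure I \<xi> r M"
  shows "nonatomic M"
  unfolding nonatomic_def
proof (intro ballI impI)
  fix S assume S: "S \<in> sets M" and pos: "emeasure M S > 0"
  note D = class_measureD[OF M]
  have cylM: "cyl x n \<in> sets M" for x n using D(1) cyl_in_sets by auto
  have evM: "eventually_in I \<in> sets M" using D(1) eventually_in_measurable by auto
  let ?A = "\<lambda>n. S \<inter> eventually_in I \<inter> {x \<in> X. lab x (1 + n) \<in> I}"
  have AM: "?A n \<in> sets M" for n using S evM lab_set_measurable D(1) by auto
  \<comment> \<open>\<open>S\<close> may have infinite mass, so the argument moves to its part in a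
    cylinder ending in \<open>I\<close>, which is finite.\<close>
  have "\<exists>n d. d \<in> Rep (1 + n) \<and> lab d (1 + n) \<in> I \<and> emeasure M (cyl d (1 + n) \<inter> S) > 0"
  proof (rule ccontr)
    assume neg: "\<not> ?thesis"
    have "emeasure M (?A n) = 0" for n
    proof -
      have "emeasure M (cyl d (1 + n) \<inter> ?A n) = 0" if d: "d \<in> Rep (1 + n)" for d
      proof (cases "lab d (1 + n) \<in> I")
        case True
        then have "emeasure M (cyl d (1 + n) \<inter> S) = 0" using neg d by (auto simp: not_less)
        moreover have "emeasure M (cyl d (1 + n) \<inter> ?A n) \<le> emeasure M (cyl d (1 + n) \<inter> S)"
          using cylM S by (intro emeasure_mono) auto
        ultimately show ?thesis by simp
      next
        case False
        then have "lab y (1 + n) \<notin> I" if "y \<in> cyl d (1 + n)" for y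
          using in_cyl_lab[OF that] subsetD[OF Rep_subset d] by simp
        then have "cyl d (1 + n) \<inter> ?A n = {}" by blast
        then show ?thesis by simp
      qed
      then show ?thesis using emeasure_Rep_sum[OF D(1) AM, of n "1 + n"] by simp
    qed
    then have "emeasure M S = 0"
      using emeasure_eventually_SUP[OF D(1,4) nr order.refl S] by simp
    with pos show False by simp
  qed
  then obtain n d where d: "n \<ge> 1" "d \<in> X" "lab d n \<in> I" "emeasure M (cyl d n \<inter> S) > 0"
    using Rep_subset by (metis le_add1 subsetD)
  let ?S = "cyl d n \<inter> S"
  have fin: "emeasure M ?S < \<infinity>"
  proof -
    have "emeasure M ?S \<le> emeasure M (cyl d n)" using cylM S by (intro emeasure_mono) auto
    also have "\<dots> < \<infinity>" using D(5)[OF d(2,1,3)] by simp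
    finally show ?thesis .
  qed
  then obtain a where a: "emeasure M ?S = ennreal a" "a > 0"
    using d(4) by (metis ennreal_cases ennreal_less_zero_iff infinity_ennreal_def less_irrefl)
  define K where "K = Max (insert 1 (\<xi> ` I))"
  have finI: "finite I" using I finite_subset by blast
  have K: "\<xi> v \<le> K" if "v \<in> I" for v unfolding K_def using finI that by (intro Max_ge) auto
  \<comment> \<open>\<open>l\<close> brings \<open>K / r ^ l\<close> below the mass
    \<open>a\<close>; taking \<open>m \<ge> n\<close> as well lets the label at level
    \<open>n\<close> be read off from \<open>d'\<close>.\<close>
  obtain l where l: "K / a < r ^ l" using real_arch_pow[OF r] by auto
  define m where "m = max n l"
  have rm: "K < a * r ^ m"
  proof -
    have "r ^ l \<le> r ^ m" using r by (intro power_increasing) (auto simp: m_def)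
    then have "K / a < r ^ m" using l by simp
    then show ?thesis using a(2) by (simp add: field_simps)
  qed
  have SM: "?S \<in> sets M" using S cylM by auto
  have "\<exists>d'\<in>Rep m. emeasure M (cyl d' m \<inter> ?S) > 0"
  proof (rule ccontr)
    assume "\<not> ?thesis"
    then have "emeasure M ?S = 0" using emeasure_Rep_sum[OF D(1) SM, of m] by (simp add: not_less)
    with d(4) show False by simp
  qed
  then obtain d' where d': "d' \<in> X" "emeasure M (cyl d' m \<inter> ?S) > 0" using Rep_subset by blast
  let ?T = "cyl d' m \<inter> ?S"
  have le: "emeasure M ?T \<le> emeasure M (cyl d' m)" using cylM by (intro emeasure_mono) auto
  have "?T \<noteq> {}" using d'(2) by auto
  then obtain y where y: "y \<in> cyl d' m" "y \<in> cyl d n" by auto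
  have "lab d' n = lab y n" using in_cyl_lab_le[OF y(1) d'(1), of n] by (simp add: m_def)
  also have "\<dots> = lab d n" by (rule in_cyl_lab[OF y(2) d(2)])
  finally have dn: "lab d' n \<in> I" using d(3) by simp
  have dm: "lab d' m \<in> I"
  proof (rule ccontr)
    assume "lab d' m \<notin> I"
    then have "emeasure M (cyl d' m) = 0"
      using emeasure_left_class[OF D(1,4) nr d'(1) d(1) _ dn, of m] by (simp add: m_def)
    then show False using le d'(2) by simp
  qed
  have "emeasure M ?T \<le> ennreal (\<xi> (lab d' m) / r ^ m)"
    using le D(5)[OF d'(1) _ dm] d(1) by (simp add: m_def)
  also have "\<dots> < ennreal a"
    using rm K[OF dm] r a(2) by (intro ennreal_lessI) (auto simp: pos_divide_less_eq)
  finally have "emeasure M ?T < emeasure M ?S" using a(1) by simp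
  also have "\<dots> \<le> emeasure M S" using S by (intro emeasure_mono) auto
  finally have "emeasure M ?T < emeasure M S" .
  then show "\<exists>T\<in>sets M. T \<subseteq> S \<and> 0 < emeasure M T \<and> emeasure M T < emeasure M S"
    using d'(2) SM cylM by (intro bexI[of _ ?T]) auto
qed

lemma class_measure_in_infinite_ergodic_measures:
  assumes nr: "no_return I" and I: "I \<subseteq> {..<N}" and r: "r > 1"
    and prim: "primitive_on I (\<lambda>v u. real (adj v u))"
    and \<xi>: "\<And>v. v \<in> I \<Longrightarrow> \<xi> v > 0" "\<And>v. v \<in> I \<Longrightarrow> (\<Sum>u\<in>I. real (adj v u) * \<xi> u) = r * \<xi> v"
    and M: "class_measure I \<xi> r M" and inf: "emeasure M X = \<infinity>"
  shows "M \<in> infinite_ergodic_measures B"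
proof -
  note D = class_measureD[OF M]
  obtain v where v: "v \<in> I" using prim by (auto simp: primitive_on_def)
  obtain z where z: "z \<in> X" "lab z 1 = v" using lab_through[of 1 v] v I by auto
  have "emeasure M (cyl z 1) = ennreal (\<xi> v / r)" using D(5)[OF z(1), of 1] z(2) v by simp
  moreover have "\<xi> v / r > 0" using \<xi>(1)[OF v] r by simp
  ultimately have "openin (path_topology B) (cyl z 1) \<and> 0 < emeasure M (cyl z 1) \<and> emeasure M (cyl z 1) < \<infinity>"
    using open_cyl by simp
  then show ?thesis
    using D inf switch_invariant_imp_tail_invariant[OF D(1) class_measure_switch_invariant[OF nr M]]
      class_measure_ergodic[OF nr I prim \<xi> M] class_measure_nonatomic[OF nr I r M]
    unfolding infinite_ergodic_measures_def infinite_measure_def by auto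
qed

text \<open>A set of positive mass contains a path that ends up in \<open>I\<close>. Its prefix is
  taken long enough for the cylinder to fit into \<open>U\<close> and to end in
  \<open>I\<close>.\<close>

lemma finite_cylinder_in_class:
  assumes sM: "sets M = sets (path_borel B)" and null: "emeasure M (X - eventually_in I) = 0"
    and U: "openin (path_topology B) U" "0 < emeasure M U" "emeasure M U < \<infinity>"
  shows "\<exists>z k. z \<in> X \<and> k \<ge> 1 \<and> lab z k \<in> I \<and> emeasure M (cyl z k) < \<infinity>"
proof -
  have "U \<inter> eventually_in I \<noteq> {}"
    using null_outside[OF sM null _ open_cylinders(1)[OF U(1)]] U(2) by auto
  then obtain x where x: "x \<in> U" "x \<in> eventually_in I" by auto
  obtain n where n: "cyl x n \<subseteq> U" using open_cylinders(2)[OF U(1) x(1)] by auto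
  obtain k where k: "x \<in> X" "\<forall>m\<ge>k. lab x m \<in> I" using x(2) by (auto simp: eventually_in_def)
  let ?m = "max 1 (max n k)"
  have "n \<le> ?m" by simp
  then have "cyl x ?m \<subseteq> U" using cyl_antimono n by blast
  then have "emeasure M (cyl x ?m) \<le> emeasure M U"
    using open_in_sets[OF U(1)] sM by (intro emeasure_mono) auto
  then have "emeasure M (cyl x ?m) < \<infinity>" using U(3) by (rule order.strict_trans1)
  then show ?thesis using k by (intro exI[of _ x] exI[of _ ?m]) auto
qed

text \<open>If \<open>r \<le> 1\<close>, the cylinders around a path that stays in \<open>I\<close>
  have masses bounded below. They shrink to one point, which by continuity from above is an
  atom.\<close>

lemma class_measure_nonatomic_imp:
  assumes I: "I \<subseteq> {..<N}" and r: "r > 0" and M: "class_measure I \<xi> r M" and M': "M' = scale_measure (ennreal c) M"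
    and c: "c > 0" and \<xi>: "\<And>v. v \<in> I \<Longrightarrow> \<xi> v > 0"
    and na: "nonatomic M'" and ne: "eventually_in I \<noteq> {}"
  shows "r > 1"
proof (rule ccontr)
  assume "\<not> r > 1"
  then have r1: "r \<le> 1" by simp
  note D = class_measureD[OF M]
  obtain x where x: "x \<in> eventually_in I" using ne by auto
  obtain k where k: "x \<in> X" "\<And>m. m \<ge> k \<Longrightarrow> lab x m \<in> I" using x by (auto simp: eventually_in_def)
  have finI: "finite I" using I finite_subset by blast
  define \<delta> where "\<delta> = Min (\<xi> ` I)"
  have Ine: "I \<noteq> {}" using k(2)[of k] by auto
  have \<delta>: "\<delta> > 0" "\<And>v. v \<in> I \<Longrightarrow> \<delta> \<le> \<xi> v"
    unfolding \<delta>_def using finI Ine \<xi> by (auto intro: Min_le)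
  let ?A = "\<lambda>n. cyl x (n + k + 1)"
  have sM': "sets M' = sets (path_borel B)" using D(1) M' by simp
  have A: "emeasure M (?A n) = ennreal (\<xi> (lab x (n + k + 1)) / r ^ (n + k + 1))" for n
    using D(5)[OF k(1), of "n + k + 1"] k(2)[of "n + k + 1"] by simp
  have low: "ennreal (c * \<delta>) \<le> emeasure M' (?A n)" for n
  proof -
    have "\<xi> (lab x (n + k + 1)) * 1 \<le> \<xi> (lab x (n + k + 1)) / r ^ (n + k + 1)"
      using \<xi>[OF k(2)[of "n + k + 1"]] r power_le_one[of r "n + k + 1"] r1 by (simp add: field_simps)
    then have "c * \<delta> \<le> c * (\<xi> (lab x (n + k + 1)) / r ^ (n + k + 1))"
      using \<delta>(2)[OF k(2)[of "n + k + 1"]] c by (intro mult_left_mono) auto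
    then show ?thesis unfolding M' emeasure_scale_measure A using c
      by (subst ennreal_mult'[symmetric]) (auto intro: ennreal_leI)
  qed
  have int: "(\<Inter>n. ?A n) = {x}"
  proof
    show "(\<Inter>n. ?A n) \<subseteq> {x}"
    proof
      fix y assume y: "y \<in> (\<Inter>n. ?A n)"
      have "y i = x i" for i
      proof -
        have "y \<in> ?A i" using y by blast
        then show ?thesis by (simp add: cylinder_def)
      qed
      then show "y \<in> {x}" by auto
    qed
  qed (use in_cyl_self[OF k(1)] in auto)
  have AM: "range ?A \<subseteq> sets M'" unfolding sM' by (rule image_subsetI) (rule cyl_in_sets)
  then have xM: "{x} \<in> sets M'" unfolding int[symmetric] by (intro sets.countable_INT UNIV_not_empty)
  have "(INF n. emeasure M' (?A n)) = emeasure M' (\<Inter>n. ?A n)"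
  proof (rule INF_emeasure_decseq[OF AM])
    show "decseq ?A" by (intro decseq_SucI cyl_antimono) simp
    show "emeasure M' (?A n) \<noteq> \<infinity>" for n
      unfolding M' emeasure_scale_measure A by (simp add: ennreal_mult_eq_top_iff)
  qed
  moreover have "ennreal (c * \<delta>) \<le> (INF n. emeasure M' (?A n))" by (intro INF_greatest low)
  ultimately have "ennreal (c * \<delta>) \<le> emeasure M' {x}" using int by simp
  moreover have "0 < ennreal (c * \<delta>)" using c \<delta> by simp
  ultimately have "emeasure M' {x} > 0" by (rule order.strict_trans2[rotated])
  then obtain T where T: "T \<subseteq> {x}" "0 < emeasure M' T" "emeasure M' T < emeasure M' {x}"
    using na xM unfolding nonatomic_def by blast
  then have "T = {} \<or> T = {x}" by auto
  then show False using T by auto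
qed

end

section \<open>The classes of the incidence matrix\<close>

locale diagram_classes = stationary_diagram B N \<nu>
  for B :: "('v, 'e) bratteli" and N :: nat and \<nu> :: "nat \<Rightarrow> nat \<Rightarrow> 'v" +
  fixes s m :: nat and C :: "nat \<Rightarrow> nat set"
  assumes incidence_P: "condition_P (incidence_matrix B N \<nu> 1) s m C"
begin

definition F :: "nat mat" where
  "F = incidence_matrix B N \<nu> 1"

abbreviation "A \<equiv> transpose_mat F"
abbreviation "\<rho> \<alpha> \<equiv> class_radius A (C \<alpha>)"

lemma F_carrier: "F \<in> carrier_mat N N" and A_carrier: "A \<in> carrier_mat N N"
  by (simp_all add: F_def incidence_matrix_def)

lemma condition_P: "condition_P F s m C"
  using incidence_P by (simp add: F_def)

lemma dim_F [simp]: "dim_row F = N" "dim_col F = N"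
  using F_carrier by auto

lemma F_adj: "F $$ (u, v) = adj v u"
  by (simp add: adj_def F_def)

lemma A_adj: "v < N \<Longrightarrow> u < N \<Longrightarrow> A $$ (v, u) = adj v u"
  by (simp add: F_adj)

lemma matrix_graph_A: "(v, u) \<in> matrix_graph A \<longleftrightarrow> v < N \<and> u < N \<and> adj v u > 0"
  by (auto simp: matrix_graph_def F_adj)

lemma equiv_class_rel: "equiv {..<N} (class_rel F)"
proof (rule equivI)
  show "class_rel F \<subseteq> {..<N} \<times> {..<N}" by (auto simp: class_rel_def)
  show "refl_on {..<N} (class_rel F)" by (auto simp: refl_on_def class_rel_def)
  show "sym (class_rel F)" by (auto simp: sym_def class_rel_def)
  show "trans (class_rel F)" unfolding trans_def class_rel_def by (auto intro: trancl_trans)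
qed

lemma C_quotient: "C ` {..<m} = {..<N} // class_rel F" and C_inj: "inj_on C {..<m}"
proof -
  have "bij_betw C {..<m} ({..<dim_row F} // class_rel F)"
    using condition_P unfolding condition_P_def by (rule conjunct1)
  then show "C ` {..<m} = {..<N} // class_rel F" "inj_on C {..<m}" by (simp_all add: bij_betw_def)
qed

lemma C_subset: "\<alpha> < m \<Longrightarrow> C \<alpha> \<subseteq> {..<N}"
  using Union_quotient[OF equiv_class_rel] C_quotient by blast

lemma C_nonempty: "\<alpha> < m \<Longrightarrow> C \<alpha> \<noteq> {}"
  using in_quotient_imp_non_empty[OF equiv_class_rel, of "C \<alpha>"] C_quotient by blast

lemma C_disjoint: "\<alpha> < m \<Longrightarrow> \<beta> < m \<Longrightarrow> v \<in> C \<alpha> \<Longrightarrow> v \<in> C \<beta> \<Longrightarrow> \<alpha> = \<beta>"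
proof -
  assume *: "\<alpha> < m" "\<beta> < m" "v \<in> C \<alpha>" "v \<in> C \<beta>"
  then have "C \<alpha> \<in> {..<N} // class_rel F" "C \<beta> \<in> {..<N} // class_rel F" using C_quotient by blast+
  from quotient_disj[OF equiv_class_rel this] have "C \<alpha> = C \<beta>" using * by blast
  then show ?thesis using C_inj * by (auto simp: inj_on_def)
qed

lemma C_cover: "v < N \<Longrightarrow> \<exists>\<alpha><m. v \<in> C \<alpha>"
proof -
  assume "v < N"
  then have "v \<in> \<Union>({..<N} // class_rel F)" using Union_quotient[OF equiv_class_rel] by simp
  then show ?thesis unfolding C_quotient[symmetric] by auto
qed

section \<open>The class of a vertex and its monotonicity along paths\<close>

definition cl :: "nat \<Rightarrow> nat" where
  "cl v = (THE \<alpha>. \<alpha> < m \<and> v \<in> C \<alpha>)"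

lemma cl: assumes "v < N" shows "cl v < m" "v \<in> C (cl v)"
proof -
  have "\<exists>!\<alpha>. \<alpha> < m \<and> v \<in> C \<alpha>" using C_cover[OF assms] C_disjoint by blast
  from theI'[OF this] show "cl v < m" "v \<in> C (cl v)" by (auto simp: cl_def)
qed

lemma cl_eq: "\<alpha> < m \<Longrightarrow> v \<in> C \<alpha> \<Longrightarrow> cl v = \<alpha>"
  using cl[of v] C_subset[of \<alpha>] C_disjoint by blast

text \<open>\<open>adj v u\<close> is the entry \<open>(u, v)\<close> of \<open>F\<close>, which
  vanishes in the block triangular form when the class of \<open>u\<close> precedes that of
  \<open>v\<close>.\<close>

lemma adj_cl_mono: "v < N \<Longrightarrow> u < N \<Longrightarrow> adj v u > 0 \<Longrightarrow> cl v \<le> cl u"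
proof (rule ccontr)
  assume *: "v < N" "u < N" "adj v u > 0" "\<not> cl v \<le> cl u"
  have "F $$ (u, v) = 0"
    using condition_P cl[OF *(1)] cl[OF *(2)] *(4) unfolding condition_P_def by (meson not_le)
  with *(3) show False by (simp add: F_adj)
qed

lemma path_cl_mono:
  assumes "x \<in> X" "1 \<le> i" "i \<le> j"
  shows "cl (lab x i) \<le> cl (lab x j)"
  using assms(3)
proof (induction j rule: dec_induct)
  case (step j)
  have "cl (lab x j) \<le> cl (lab x (Suc j))"
    using assms step.hyps by (intro adj_cl_mono lab_less adj_path_pos) auto
  with step.IH show ?case by simp
qed simp

lemma no_return_class: "\<alpha> < m \<Longrightarrow> no_return (C \<alpha>)"
  unfolding no_return_def
proof (intro ballI allI impI)
  fix x i j k assume *: "\<alpha> < m" "x \<in> X" "1 \<le> i" "i \<le> j" "j \<le> k" "lab x i \<in> C \<alpha>" "lab x k \<in> C \<alpha>"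
  have "cl (lab x i) \<le> cl (lab x j)" "cl (lab x j) \<le> cl (lab x k)"
    using * by (auto intro!: path_cl_mono)
  then have "cl (lab x j) = \<alpha>" using cl_eq[OF *(1)] *(6,7) by simp
  then show "lab x j \<in> C \<alpha>" using cl(2)[OF lab_less[OF *(2), of j]] * by simp
qed

lemma eventually_in_some_class: "X = (\<Union>\<alpha><m. eventually_in (C \<alpha>))"
proof (intro equalityI subsetI)
  fix x assume x: "x \<in> X"
  let ?K = "(\<lambda>i. cl (lab x i)) ` {1..}"
  have "?K \<subseteq> {..<m}" using cl(1)[OF lab_less[OF x]] by (intro image_subsetI) simp
  then have fin: "finite ?K" by (rule finite_subset) simp
  then have "Max ?K \<in> ?K" by (intro Max_in) auto
  then obtain n where n: "n \<ge> 1" "Max ?K = cl (lab x n)" by auto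
  have const: "cl (lab x k) = cl (lab x n)" if "k \<ge> n" for k
  proof (rule antisym)
    show "cl (lab x n) \<le> cl (lab x k)" by (rule path_cl_mono[OF x n(1) that])
    show "cl (lab x k) \<le> cl (lab x n)"
      unfolding n(2)[symmetric] using fin that n(1) by (intro Max_ge) auto
  qed
  have "lab x k \<in> C (cl (lab x n))" if "k \<ge> n" for k
    using cl(2)[OF lab_less[OF x, of k]] that n(1) unfolding const[OF that] by simp
  then have "\<forall>k\<ge>n. lab x k \<in> C (cl (lab x n))" by blast
  with x have "x \<in> eventually_in (C (cl (lab x n)))" unfolding eventually_in_def by blast
  then show "x \<in> (\<Union>\<alpha><m. eventually_in (C \<alpha>))" using cl(1)[OF lab_less[OF x n(1)]] by blast
qed (auto simp: eventually_in_def)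

lemma eventually_in_disjoint:
  assumes "\<alpha> < m" "\<beta> < m" "\<alpha> \<noteq> \<beta>"
  shows "eventually_in (C \<alpha>) \<inter> eventually_in (C \<beta>) = {}"
proof (rule ccontr)
  assume "\<not> ?thesis"
  then obtain x where x: "x \<in> eventually_in (C \<alpha>)" "x \<in> eventually_in (C \<beta>)" by blast
  obtain k where "\<forall>i\<ge>k. lab x i \<in> C \<alpha>" using x(1) unfolding eventually_in_def by blast
  moreover obtain l where "\<forall>i\<ge>l. lab x i \<in> C \<beta>" using x(2) unfolding eventually_in_def by blast
  ultimately have "lab x (max k l) \<in> C \<alpha>" "lab x (max k l) \<in> C \<beta>" by auto
  then show False using C_disjoint assms by blast
qed

text \<open>An arrow inside the class makes its block nonzero, so condition (P) applies; since that
  condition concerns \<open>F\<close>, the result is transposed.\<close>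

lemma primitive_on_adj:
  assumes "\<alpha> < m" "v \<in> C \<alpha>" "u \<in> C \<alpha>" "adj v u > 0"
  shows "primitive_on (C \<alpha>) (\<lambda>v u. real (adj v u))"
proof -
  have I: "C \<alpha> \<subseteq> {..<N}" "C \<alpha> \<noteq> {}" using C_subset C_nonempty assms(1) by auto
  then have fin: "finite (C \<alpha>)" using finite_subset by blast
  obtain i j where ij: "i < card (C \<alpha>)" "pick (C \<alpha>) i = u" "j < card (C \<alpha>)" "pick (C \<alpha>) j = v"
    using bij_betw_pick[OF fin] assms(2,3) unfolding bij_betw_def by (metis imageE lessThan_iff)
  have "block F (C \<alpha>) $$ (i, j) = adj v u"
    unfolding block_eq_mat[OF F_carrier I(1)] using ij by (simp add: F_adj)
  then have "block F (C \<alpha>) \<noteq> 0\<^sub>m (card (C \<alpha>)) (card (C \<alpha>))" using assms(4) ij by auto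
  then have "primitive (block F (C \<alpha>))" using condition_P assms(1) by (simp add: condition_P_def)
  from primitive_on_transpose[OF primitive_block[OF F_carrier I this]]
  show ?thesis by (simp add: F_adj)
qed

lemma perron_vector_class:
  assumes "\<alpha> < m" and prim: "primitive_on (C \<alpha>) (\<lambda>v u. real (adj v u))"
  shows "\<exists>\<xi>. (\<forall>v\<in>C \<alpha>. \<xi> v > 0) \<and> (\<forall>v\<in>C \<alpha>. (\<Sum>u\<in>C \<alpha>. real (adj v u) * \<xi> u) = \<rho> \<alpha> * \<xi> v)"
proof -
  have I: "C \<alpha> \<subseteq> {..<N}" using C_subset assms(1) by auto
  have eq: "real (adj v u) = real (A $$ (v, u))" if "v \<in> C \<alpha>" "u \<in> C \<alpha>" for v u
  proof -
    have "v < N" "u < N" using that I by auto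
    then show ?thesis by (simp add: F_adj)
  qed
  have "primitive_on (C \<alpha>) (\<lambda>v u. real (A $$ (v, u)))" by (rule primitive_on_cong[OF eq prim])
  from class_perron_vector[OF A_carrier I this] show ?thesis using eq by simp
qed

text \<open>The transposed block has a Perron vector, a priori for the eigenvalue
  \<open>class_radius F (C \<alpha>)\<close>. Pairing it with the right vector evaluates one
  bilinear form in two ways, and the pairing is positive, so the eigenvalues agree.\<close>

lemma left_perron_vector_class:
  assumes "\<alpha> < m" and prim: "primitive_on (C \<alpha>) (\<lambda>v u. real (adj v u))"
  shows "\<exists>y. (\<forall>v\<in>C \<alpha>. y v > 0) \<and> (\<forall>u\<in>C \<alpha>. (\<Sum>v\<in>C \<alpha>. y v * real (adj v u)) = \<rho> \<alpha> * y u)"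
proof -
  have I: "C \<alpha> \<subseteq> {..<N}" using C_subset assms(1) by auto
  have "primitive_on (C \<alpha>) (\<lambda>u v. real (F $$ (u, v)))"
    using primitive_on_transpose[OF prim] by (simp add: F_adj)
  from class_perron_vector[OF F_carrier I this]
  obtain y where y: "\<And>v. v \<in> C \<alpha> \<Longrightarrow> y v > 0"
    "\<And>u. u \<in> C \<alpha> \<Longrightarrow> (\<Sum>v\<in>C \<alpha>. y v * real (adj v u)) = class_radius F (C \<alpha>) * y u"
    by (auto simp: F_adj mult.commute)
  obtain \<xi> where \<xi>: "\<And>v. v \<in> C \<alpha> \<Longrightarrow> \<xi> v > 0"
    "\<And>v. v \<in> C \<alpha> \<Longrightarrow> (\<Sum>u\<in>C \<alpha>. real (adj v u) * \<xi> u) = \<rho> \<alpha> * \<xi> v"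
    using perron_vector_class[OF assms] by blast
  let ?S = "\<Sum>v\<in>C \<alpha>. y v * \<xi> v"
  have "class_radius F (C \<alpha>) * ?S = (\<Sum>u\<in>C \<alpha>. (\<Sum>v\<in>C \<alpha>. y v * real (adj v u)) * \<xi> u)"
    by (simp add: y(2) sum_distrib_left mult.assoc)
  also have "\<dots> = (\<Sum>v\<in>C \<alpha>. y v * (\<Sum>u\<in>C \<alpha>. real (adj v u) * \<xi> u))"
    by (simp add: sum_distrib_left sum_distrib_right mult.assoc) (rule sum.swap)
  also have "\<dots> = (\<Sum>v\<in>C \<alpha>. y v * (\<rho> \<alpha> * \<xi> v))" using \<xi>(2) by (intro sum.cong) auto
  also have "\<dots> = \<rho> \<alpha> * ?S" by (simp add: sum_distrib_left mult_ac)
  finally have "class_radius F (C \<alpha>) * ?S = \<rho> \<alpha> * ?S" .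
  moreover have "?S > 0"
    using y(1) \<xi>(1) C_nonempty[OF assms(1)] finite_subset[OF I] by (intro sum_pos) auto
  ultimately have "class_radius F (C \<alpha>) = \<rho> \<alpha>" by simp
  with y show ?thesis by (intro exI[of _ y]) simp
qed

lemma primitive_on_if_radius_pos:
  assumes "\<alpha> < m" "\<rho> \<alpha> > 0"
  shows "primitive_on (C \<alpha>) (\<lambda>v u. real (adj v u))"
proof (cases "\<exists>v\<in>C \<alpha>. \<exists>u\<in>C \<alpha>. adj v u > 0")
  case True
  then show ?thesis using primitive_on_adj[OF assms(1)] by blast
next
  case False
  have "A $$ (v, u) = 0" if "v \<in> C \<alpha>" "u \<in> C \<alpha>" for v u
  proof -
    have "v < N" "u < N" using that C_subset[OF assms(1)] by auto
    then show ?thesis using A_adj[of v u] False that by simp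
  qed
  then have "\<rho> \<alpha> = 0"
    using class_radius_zero_block[OF A_carrier C_subset[OF assms(1)] C_nonempty[OF assms(1)]] by blast
  with assms(2) show ?thesis by simp
qed

text \<open>Includes zero blocks, which are not primitive: there the sums vanish and any positive
  vector will do. The inequality is all that a supersolution needs.\<close>

lemma sub_perron_vector_class:
  assumes "\<alpha> < m"
  shows "\<exists>\<xi>. (\<forall>v\<in>C \<alpha>. \<xi> v > 0) \<and> (\<forall>v\<in>C \<alpha>. (\<Sum>u\<in>C \<alpha>. real (adj v u) * \<xi> u) \<le> \<rho> \<alpha> * \<xi> v)"
proof (cases "\<exists>v\<in>C \<alpha>. \<exists>u\<in>C \<alpha>. adj v u > 0")
  case True
  then have "primitive_on (C \<alpha>) (\<lambda>v u. real (adj v u))" using primitive_on_adj[OF assms] by blast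
  from perron_vector_class[OF assms this] show ?thesis by (metis order.refl)
next
  case False
  have "\<rho> \<alpha> \<ge> 0" by (rule class_radius_nonneg[OF A_carrier C_subset[OF assms] C_nonempty[OF assms]])
  then show ?thesis using False by (intro exI[of _ "\<lambda>_. 1"]) auto
qed

lemma primitive_on_if_path:
  assumes "\<alpha> < m" "x \<in> eventually_in (C \<alpha>)"
  shows "primitive_on (C \<alpha>) (\<lambda>v u. real (adj v u))"
proof -
  obtain k where k: "x \<in> X" "\<And>i. i \<ge> k \<Longrightarrow> lab x i \<in> C \<alpha>" using assms(2) by (auto simp: eventually_in_def)
  show ?thesis
    using primitive_on_adj[OF assms(1) k(2)[of "k + 1"] k(2)[of "Suc (k + 1)"]] adj_path_pos[OF k(1), of "k + 1"]
    by simp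
qed

end

section \<open>Finite and infinite class measures\<close>

context stationary_diagram
begin

lemma emeasure_step_le:
  assumes "sets M = sets (path_borel B)" "E \<in> sets M" "x \<in> X" "n \<ge> 1"
    and h: "\<And>y. y \<in> cyl x n \<Longrightarrow> emeasure M (cyl y (Suc n) \<inter> E) \<le> h (lab y (Suc n))"
  shows "emeasure M (cyl x n \<inter> E) \<le> (\<Sum>u<N. of_nat (adj (lab x n) u) * h u)"
proof -
  let ?h = "\<lambda>e. h (the_inv_into {..<N} (\<nu> (Suc n)) (rng B e))"
  have "emeasure M (cyl x n \<inter> E) = (\<Sum>e\<in>out n (\<nu> n (lab x n)). emeasure M ({y \<in> cyl x n. y n = e} \<inter> E))"
    using emeasure_out_sum[OF assms(1-3)] numbering_lab[OF assms(3,4)] by simp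
  also have "\<dots> \<le> (\<Sum>e\<in>out n (\<nu> n (lab x n)). ?h e)"
  proof (rule sum_mono)
    fix e assume e: "e \<in> out n (\<nu> n (lab x n))"
    then obtain y where y: "y \<in> cyl x n" "y n = e"
      using path_extend[OF assms(3), of e n] numbering_lab[OF assms(3,4)] by auto
    have "lab y (Suc n) = the_inv_into {..<N} (\<nu> (Suc n)) (rng B e)"
      using pathD(2)[OF in_cylD[OF y(1)], of n] y(2) by (simp add: lab_def)
    then show "emeasure M ({y \<in> cyl x n. y n = e} \<inter> E) \<le> ?h e"
      using h[OF y(1)] cyl_Suc[OF y(1)] y(2) by simp
  qed
  also have "\<dots> = (\<Sum>u<N. of_nat (adj (lab x n) u) * h u)"
  proof (rule sum_out[OF assms(4) lab_less[OF assms(3,4)]])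
    fix e u assume "u < N" "rng B e = \<nu> (Suc n) u"
    then show "?h e = h u" using numbering[of "Suc n"] by (simp add: bij_betw_def the_inv_into_f_f)
  qed
  finally show ?thesis .
qed

text \<open>By induction on \<open>k\<close>, the supersolution \<open>\<Lambda> v / r ^ n\<close>
  bounds the mass of the paths of a cylinder that are in \<open>I\<close> at level
  \<open>n + k\<close>. The bound is uniform in \<open>k\<close>, and the supremum over
  \<open>k\<close> recovers the whole cylinder.\<close>

lemma class_measure_finite:
  assumes I: "I \<subseteq> {..<N}" and nr: "no_return I" and r: "r > 0" and M: "class_measure I \<xi> r M"
    and \<Lambda>: "\<And>v. v < N \<Longrightarrow> \<Lambda> v \<ge> 0" "\<And>v. v \<in> I \<Longrightarrow> \<xi> v \<le> \<Lambda> v"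
      "\<And>v. v < N \<Longrightarrow> (\<Sum>u<N. real (adj v u) * \<Lambda> u) \<le> r * \<Lambda> v"
  shows "emeasure M X < \<infinity>"
proof -
  note D = class_measureD[OF M]
  have cylM: "cyl x n \<in> sets M" for x n using D(1) cyl_in_sets by auto
  have YM: "{y \<in> X. lab y k \<in> I} \<in> sets M" for k using lab_set_measurable D(1) by auto
  have le: "emeasure M (cyl x n \<inter> {y \<in> X. lab y (n + k) \<in> I}) \<le> ennreal (\<Lambda> (lab x n) / r ^ n)"
    if "x \<in> X" "n \<ge> 1" for x n k
    using that
  proof (induction k arbitrary: x n)
    case 0
    show ?case
    proof (cases "lab x n \<in> I")
      case True
      have "emeasure M (cyl x n \<inter> {y \<in> X. lab y (n + 0) \<in> I}) \<le> emeasure M (cyl x n)"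
        using cylM by (intro emeasure_mono) auto
      also have "\<dots> = ennreal (\<xi> (lab x n) / r ^ n)" by (rule D(5)[OF 0 True])
      also have "\<dots> \<le> ennreal (\<Lambda> (lab x n) / r ^ n)"
        using \<Lambda>(2)[OF True] r by (intro ennreal_leI divide_right_mono) auto
      finally show ?thesis .
    next
      case False
      then have "lab y n \<notin> I" if "y \<in> cyl x n" for y using in_cyl_lab[OF that 0(1)] by simp
      then have "cyl x n \<inter> {y \<in> X. lab y (n + 0) \<in> I} = {}" by auto
      then show ?thesis by (simp only: emeasure_empty zero_le)
    qed
  next
    case (Suc k)
    let ?E = "{y \<in> X. lab y (n + Suc k) \<in> I}"
    have "emeasure M (cyl x n \<inter> ?E) \<le> (\<Sum>u<N. of_nat (adj (lab x n) u) * ennreal (\<Lambda> u / r ^ Suc n))"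
    proof (rule emeasure_step_le[OF D(1) YM Suc.prems])
      fix y assume "y \<in> cyl x n"
      then show "emeasure M (cyl y (Suc n) \<inter> ?E) \<le> ennreal (\<Lambda> (lab y (Suc n)) / r ^ Suc n)"
        using Suc.IH[of y "Suc n"] in_cylD by simp
    qed
    also have "\<dots> = (\<Sum>u<N. ennreal (real (adj (lab x n) u) * (\<Lambda> u / r ^ Suc n)))"
      using \<Lambda>(1) r by (intro sum.cong refl) (simp add: ennreal_mult[symmetric] ennreal_of_nat_eq_real_of_nat)
    also have "\<dots> = ennreal (\<Sum>u<N. real (adj (lab x n) u) * (\<Lambda> u / r ^ Suc n))"
      using \<Lambda>(1) r by (intro sum_ennreal) simp
    also have "(\<Sum>u<N. real (adj (lab x n) u) * (\<Lambda> u / r ^ Suc n)) = (\<Sum>u<N. real (adj (lab x n) u) * \<Lambda> u) / r ^ Suc n"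
      by (simp add: sum_divide_distrib)
    also have "\<dots> \<le> r * \<Lambda> (lab x n) / r ^ Suc n"
      using \<Lambda>(3)[OF lab_less[OF Suc.prems]] r by (intro divide_right_mono) auto
    also have "r * \<Lambda> (lab x n) / r ^ Suc n = \<Lambda> (lab x n) / r ^ n" using r by simp
    finally show ?case by (simp add: ennreal_leI)
  qed
  have fin: "emeasure M (cyl d 1) < \<infinity>" if d: "d \<in> X" for d
  proof -
    have "emeasure M (cyl d 1) = (SUP k. emeasure M (cyl d 1 \<inter> eventually_in I \<inter> {x \<in> X. lab x (1 + k) \<in> I}))"
      by (rule emeasure_eventually_SUP[OF D(1,4) nr order.refl cylM])
    also have "\<dots> \<le> ennreal (\<Lambda> (lab d 1) / r ^ 1)"
    proof (rule SUP_least)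
      fix k
      have "emeasure M (cyl d 1 \<inter> eventually_in I \<inter> {x \<in> X. lab x (1 + k) \<in> I}) \<le> emeasure M (cyl d 1 \<inter> {x \<in> X. lab x (1 + k) \<in> I})"
        using cylM[of d 1] YM[of "1 + k"] by (intro emeasure_mono) auto
      then show "emeasure M (cyl d 1 \<inter> eventually_in I \<inter> {x \<in> X. lab x (1 + k) \<in> I}) \<le> ennreal (\<Lambda> (lab d 1) / r ^ 1)"
        using le[OF d order.refl, of k] by (rule order.trans)
    qed
    finally show ?thesis by (rule order.strict_trans1) simp
  qed
  have "emeasure M X = (\<Sum>d\<in>Rep 1. emeasure M (cyl d 1 \<inter> X))"
    using sets.top[of M] D(2) by (intro emeasure_Rep_sum[OF D(1)]) simp
  also have "\<dots> = (\<Sum>d\<in>Rep 1. emeasure M (cyl d 1))"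
    using cyl_subset by (intro sum.cong refl) (simp add: Int_absorb2)
  also have "\<dots> < \<infinity>" using fin Rep_subset[of 1] finite_Rep[of 1] by (auto simp: less_top[symmetric])
  finally show ?thesis .
qed

text \<open>If all masses were finite then the weighted mass \<open>\<rho> ^ n * (\<Sum>v\<in>J. y v * p n v)\<close> of the class
  \<open>J\<close> at level \<open>n\<close> would be finite and drop at each level by at least a fixed amount, the flow
  along the edge from \<open>J\<close> towards \<open>I\<close>.\<close>

lemma class_measure_infinite:
  assumes I: "I \<subseteq> {..<N}" and nr: "no_return I" and r: "r > 0" and M: "class_measure I \<xi> r M"
    and \<xi>: "\<And>v. v \<in> I \<Longrightarrow> \<xi> v > 0"
    and J: "J \<subseteq> {..<N}" and y: "\<And>v. v \<in> J \<Longrightarrow> y v > 0"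
      "\<And>u. u \<in> J \<Longrightarrow> (\<Sum>v\<in>J. y v * real (adj v u)) = \<rho> * y u" and \<rho>: "\<rho> \<ge> r"
    and leave: "v0 \<in> J" "u0 < N" "u0 \<notin> J" "adj v0 u0 > 0"
    and reach: "(u0, j) \<in> {(v, u). v < N \<and> u < N \<and> adj v u > 0}\<^sup>*" "j \<in> I"
  shows "emeasure M X = \<infinity>"
proof (rule ccontr)
  assume fin: "emeasure M X \<noteq> \<infinity>"
  note D = class_measureD[OF M]
  have inv: "emeasure M (cyl x n) = emeasure M (cyl y n)" if "x \<in> X" "y \<in> X" "src B (x n) = src B (y n)" for x y n
    by (rule switch_invariant_cyl[OF D(1) class_measure_switch_invariant[OF nr M] that])
  have top: "X \<in> sets M" using sets.top[of M] D(2) by simp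
  define p where "p n v = enn2real (cyl_mass M n v)" for n v
  have mass: "emeasure M (cyl x n) = ennreal (p n (lab x n))" if x: "x \<in> X" "n \<ge> 1" for x n
  proof -
    have "emeasure M (cyl x n) \<le> emeasure M X" by (rule emeasure_mono[OF cyl_subset top])
    also have "\<dots> < \<infinity>" using fin by (simp add: less_top[symmetric])
    finally have "emeasure M (cyl x n) < \<infinity>" .
    moreover have "emeasure M (cyl x n) = cyl_mass M n (lab x n)" by (rule emeasure_cyl_mass[OF inv x])
    ultimately show ?thesis unfolding p_def by (simp add: ennreal_enn2real)
  qed
  have p0: "p n v \<ge> 0" for n v by (simp add: p_def)
  have step: "p n v = (\<Sum>u<N. real (adj v u) * p (Suc n) u)" if n: "n \<ge> 1" and v: "v < N" for n v
  proof -
    obtain x where x: "x \<in> X" "lab x n = v" using lab_through[OF n v] by auto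
    have "emeasure M (cyl x n \<inter> X) = (\<Sum>u<N. of_nat (adj (lab x n) u) * ennreal (p (Suc n) u))"
    proof (rule emeasure_step[OF D(1) top x(1) n])
      fix z assume z: "z \<in> cyl x n"
      have "cyl z (Suc n) \<inter> X = cyl z (Suc n)" using cyl_subset by auto
      then show "emeasure M (cyl z (Suc n) \<inter> X) = ennreal (p (Suc n) (lab z (Suc n)))"
        using mass[OF in_cylD[OF z], of "Suc n"] by simp
    qed
    also have "\<dots> = (\<Sum>u<N. ennreal (real (adj v u) * p (Suc n) u))"
      using p0 x(2) by (intro sum.cong refl) (simp add: ennreal_mult ennreal_of_nat_eq_real_of_nat)
    also have "\<dots> = ennreal (\<Sum>u<N. real (adj v u) * p (Suc n) u)"
      using p0 by (intro sum_ennreal) simp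
    also have "cyl x n \<inter> X = cyl x n" using cyl_subset by auto
    finally have "ennreal (p n v) = ennreal (\<Sum>u<N. real (adj v u) * p (Suc n) u)" using mass[OF x(1) n] x(2) by simp
    then show ?thesis by (subst (asm) ennreal_inj) (auto simp: p0 intro!: sum_nonneg)
  qed
  have mono: "p (Suc n) u \<le> p n v" if "n \<ge> 1" "v < N" "u < N" "adj v u > 0" for n v u
  proof -
    have "p (Suc n) u \<le> real (adj v u) * p (Suc n) u" using that p0[of "Suc n" u] mult_right_mono[of 1 "real (adj v u)" "p (Suc n) u"] by simp
    also have "\<dots> \<le> (\<Sum>u<N. real (adj v u) * p (Suc n) u)" using that p0 by (intro member_le_sum) auto
    finally show ?thesis using step[OF that(1,2)] by simp
  qed
  have jN: "j < N" using reach(2) I by auto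
  \<comment> \<open>\<open>k\<close> is the length of a path from \<open>u0\<close> to
    \<open>j\<close>: the mass at a vertex is at least that at each successor one level
    later.\<close>
  have "\<exists>k. \<forall>n\<ge>1. p (n + k) j \<le> p n u0"
    using reach(1)
  proof (induction rule: converse_rtrancl_induct)
    case base
    show ?case by (rule exI[of _ 0]) simp
  next
    case (step v u)
    then obtain k where k: "\<And>n. n \<ge> 1 \<Longrightarrow> p (n + k) j \<le> p n u" by auto
    have "p (n + Suc k) j \<le> p n v" if "n \<ge> 1" for n
      using k[of "Suc n"] mono[OF that, of v u] step.hyps(1) by simp
    then show ?case by blast
  qed
  then obtain k where k: "\<And>n. n \<ge> 1 \<Longrightarrow> p (n + k) j \<le> p n u0" by auto
  have pj: "p n j = \<xi> j / r ^ n" if n: "n \<ge> 1" for n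
  proof -
    obtain x where x: "x \<in> X" "lab x n = j" using lab_through[OF n jN] by auto
    have "ennreal (p n j) = ennreal (\<xi> j / r ^ n)" using mass[OF x(1) n] D(5)[OF x(1) n] x(2) reach(2) by simp
    then show ?thesis using \<xi>[OF reach(2)] r p0 by (subst (asm) ennreal_inj) auto
  qed
  \<comment> \<open>The flow at level \<open>n\<close> is at least
    \<open>y v0 * \<xi> j / r ^ (Suc n + k)\<close>, and its weight \<open>\<rho> ^ n\<close> is at
    least \<open>r ^ n\<close>; the dependence on \<open>n\<close> cancels.\<close>
  define \<epsilon> where "\<epsilon> = y v0 * \<xi> j / r ^ Suc k"
  have \<epsilon>: "\<epsilon> > 0" using y(1)[OF leave(1)] \<xi>[OF reach(2)] r by (simp add: \<epsilon>_def)
  define S where "S n = \<rho> ^ n * (\<Sum>v\<in>J. y v * p n v)" for n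
  have finJ: "finite J" using J finite_subset by blast
  have \<rho>0: "\<rho> > 0" using \<rho> r by simp
  have drop: "S (Suc n) + \<epsilon> \<le> S n" if n: "n \<ge> 1" for n
  proof -
    have "y v * (\<Sum>u\<in>J. real (adj v u) * p (Suc n) u) + (if v = v0 then y v0 * p (Suc n) u0 else 0) \<le> y v * p n v"
      if v: "v \<in> J" for v
    proof -
      have vN: "v < N" using v J by auto
      have "(\<Sum>u\<in>J. real (adj v u) * p (Suc n) u) + (if v = v0 then p (Suc n) u0 else 0)
        \<le> (\<Sum>u\<in>J. real (adj v u) * p (Suc n) u) + real (adj v u0) * p (Suc n) u0"
        using leave(4) p0[of "Suc n" u0] mult_right_mono[of 1 "real (adj v0 u0)" "p (Suc n) u0"] by simp
      also have "\<dots> = (\<Sum>u\<in>insert u0 J. real (adj v u) * p (Suc n) u)"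
        using finJ leave(3) by simp
      also have "\<dots> \<le> (\<Sum>u<N. real (adj v u) * p (Suc n) u)"
        using J leave(2) p0 by (intro sum_mono2) auto
      also have "\<dots> = p n v" using step[OF n vN] by simp
      finally have "y v * ((\<Sum>u\<in>J. real (adj v u) * p (Suc n) u) + (if v = v0 then p (Suc n) u0 else 0)) \<le> y v * p n v"
        using y(1)[OF v] by (intro mult_left_mono) auto
      then show ?thesis by (auto simp: distrib_left)
    qed
    then have "(\<Sum>v\<in>J. y v * (\<Sum>u\<in>J. real (adj v u) * p (Suc n) u) + (if v = v0 then y v0 * p (Suc n) u0 else 0)) \<le> (\<Sum>v\<in>J. y v * p n v)"
      by (intro sum_mono)
    moreover have "(\<Sum>v\<in>J. y v * (\<Sum>u\<in>J. real (adj v u) * p (Suc n) u)) = \<rho> * (\<Sum>u\<in>J. y u * p (Suc n) u)"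
    proof -
      have "(\<Sum>v\<in>J. y v * (\<Sum>u\<in>J. real (adj v u) * p (Suc n) u)) = (\<Sum>u\<in>J. (\<Sum>v\<in>J. y v * real (adj v u)) * p (Suc n) u)"
        by (simp add: sum_distrib_left sum_distrib_right mult.assoc) (rule sum.swap)
      also have "\<dots> = (\<Sum>u\<in>J. (\<rho> * y u) * p (Suc n) u)" using y(2) by (intro sum.cong) auto
      finally show ?thesis by (simp add: sum_distrib_left mult.assoc)
    qed
    moreover have "(\<Sum>v\<in>J. if v = v0 then y v0 * p (Suc n) u0 else 0) = y v0 * p (Suc n) u0"
      using finJ leave(1) by simp
    ultimately have "\<rho> * (\<Sum>u\<in>J. y u * p (Suc n) u) + y v0 * p (Suc n) u0 \<le> (\<Sum>v\<in>J. y v * p n v)"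
      by (simp add: sum.distrib)
    then have "\<rho> ^ n * (\<rho> * (\<Sum>u\<in>J. y u * p (Suc n) u) + y v0 * p (Suc n) u0) \<le> S n"
      unfolding S_def using \<rho>0 by (intro mult_left_mono) auto
    then have 1: "S (Suc n) + \<rho> ^ n * (y v0 * p (Suc n) u0) \<le> S n"
      by (simp add: S_def distrib_left mult_ac)
    have "\<xi> j / r ^ (Suc n + k) \<le> p (Suc n) u0" using k[of "Suc n"] pj[of "Suc n + k"] by simp
    then have "r ^ n * (y v0 * (\<xi> j / r ^ (Suc n + k))) \<le> r ^ n * (y v0 * p (Suc n) u0)"
      using y(1)[OF leave(1)] r by (intro mult_left_mono) auto
    also have "\<dots> \<le> \<rho> ^ n * (y v0 * p (Suc n) u0)"
      using \<rho> r y(1)[OF leave(1)] p0 by (intro mult_right_mono power_mono) auto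
    also have "r ^ n * (y v0 * (\<xi> j / r ^ (Suc n + k))) = \<epsilon>"
      using r by (simp add: \<epsilon>_def power_add field_simps)
    finally show ?thesis using 1 by simp
  qed
  have S0: "S n \<ge> 0" for n unfolding S_def using \<rho>0 y(1) p0 by (intro mult_nonneg_nonneg sum_nonneg) (auto simp: less_imp_le)
  have bound: "S (1 + n) + real n * \<epsilon> \<le> S 1" for n
  proof (induction n)
    case (Suc n)
    then show ?case using drop[of "1 + n"] by (simp add: algebra_simps)
  qed simp
  obtain n where "S 1 < real n * \<epsilon>" using reals_Archimedean3[OF \<epsilon>] by blast
  then show False using S0[of "1 + n"] bound[of n] by linarith
qed

end

section \<open>The correspondence\<close>

lemma rtrancl_leaves:
  assumes "(i, j) \<in> R\<^sup>*" "i \<in> J" "j \<notin> J"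
  shows "\<exists>v\<in>J. \<exists>u. u \<notin> J \<and> (v, u) \<in> R \<and> (u, j) \<in> R\<^sup>*"
  using assms
proof (induction rule: converse_rtrancl_induct)
  case (step v u)
  then show ?case by (cases "u \<in> J") auto
qed simp

context diagram_classes
begin

text \<open>With \<open>K\<close> large, the vectors \<open>x \<beta>\<close> weighted by \<open>K ^ (\<alpha> - \<beta>)\<close> form a supersolution for
  \<open>\<rho> \<alpha>\<close>: the flow into later classes is dominated by the gap between \<open>\<rho> \<beta>\<close> and \<open>\<rho> \<alpha>\<close>.\<close>

lemma distinguished_class_measure_finite:
  assumes \<alpha>: "\<alpha> < m" and dist: "distinguished A m C \<alpha>" and pos: "\<rho> \<alpha> > 0"
    and \<xi>: "\<And>v. v \<in> C \<alpha> \<Longrightarrow> \<xi> v > 0" "\<And>v. v \<in> C \<alpha> \<Longrightarrow> (\<Sum>u\<in>C \<alpha>. real (adj v u) * \<xi> u) = \<rho> \<alpha> * \<xi> v"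
    and M: "class_measure (C \<alpha>) \<xi> (\<rho> \<alpha>) M"
  shows "emeasure M X < \<infinity>"
proof -
  let ?G = "matrix_graph A"
  obtain z where z: "\<And>\<beta> v. \<beta> < m \<Longrightarrow> v \<in> C \<beta> \<Longrightarrow> z \<beta> v > 0"
    "\<And>\<beta> v. \<beta> < m \<Longrightarrow> v \<in> C \<beta> \<Longrightarrow> (\<Sum>u\<in>C \<beta>. real (adj v u) * z \<beta> u) \<le> \<rho> \<beta> * z \<beta> v"
    using sub_perron_vector_class by metis
  \<comment> \<open>On \<open>C \<alpha>\<close> the given \<xi> is used, because \<Lambda> has to
    dominate it there and \<open>z \<alpha>\<close> may have a different scale.\<close>
  define x where "x v = (if cl v = \<alpha> then \<xi> v else z (cl v) v)" for v
  have x0: "x v > 0" if "v < N" for v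
    using cl[OF that] \<xi>(1) z(1) by (auto simp: x_def)
  have x_sub: "(\<Sum>u\<in>C \<beta>. real (adj v u) * x u) \<le> \<rho> \<beta> * x v" if "\<beta> < m" "v \<in> C \<beta>" for \<beta> v
  proof -
    have "x u = (if \<beta> = \<alpha> then \<xi> u else z \<beta> u)" if "u \<in> C \<beta>" for u
      using cl_eq[OF \<open>\<beta> < m\<close> that] by (simp add: x_def)
    then show ?thesis using \<xi>(2) z(2) that by (cases "\<beta> = \<alpha>") auto
  qed
  define reach where "reach v \<longleftrightarrow> (\<exists>j\<in>C \<alpha>. (v, j) \<in> ?G\<^sup>*)" for v
  have reach_edge: "reach v" if "reach u" "v < N" "u < N" "adj v u > 0" for v u
  proof -
    have "(v, u) \<in> ?G" using that by (simp add: matrix_graph_A)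
    with \<open>reach u\<close> show ?thesis unfolding reach_def by (meson converse_rtrancl_into_rtrancl)
  qed
  have reach_le: "cl v \<le> \<alpha>" if "reach v" for v
  proof -
    obtain j where j: "j \<in> C \<alpha>" "(v, j) \<in> ?G\<^sup>*" using \<open>reach v\<close> by (auto simp: reach_def)
    from j(2) have "cl v \<le> cl j"
    proof (induction rule: converse_rtrancl_induct)
      case (step a b)
      then show ?case using adj_cl_mono[of a b] by (auto simp: matrix_graph_A)
    qed simp
    then show ?thesis using cl_eq[OF \<alpha> j(1)] by simp
  qed
  have gap: "\<rho> (cl v) < \<rho> \<alpha>" if v: "v < N" "reach v" "cl v \<noteq> \<alpha>" for v
  proof -
    obtain j where j: "j \<in> C \<alpha>" "(v, j) \<in> ?G\<^sup>*" using v(2) by (auto simp: reach_def)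
    have "v \<noteq> j" using cl_eq[OF \<alpha> j(1)] v(3) by auto
    then have "(v, j) \<in> ?G\<^sup>+" using j(2) by (simp add: rtrancl_eq_or_trancl)
    then have "has_access A C (cl v) \<alpha>" using cl(2)[OF v(1)] j(1) by (auto simp: has_access_def)
    then show ?thesis using dist cl(1)[OF v(1)] v(3) by (simp add: distinguished_def)
  qed
  define D where "D v = (\<Sum>u<N. real (adj v u) * x u)" for v
  have D0: "D v \<ge> 0" for v unfolding D_def using x0 by (intro sum_nonneg) (simp add: less_imp_le)
  \<comment> \<open>A crude common bound for finitely many quotients. Absolute values make the
    vertices without a gap harmless, and the summand 1 makes the powers of \<open>K\<close>
    increase.\<close>
  define K where "K = 1 + (\<Sum>v<N. \<bar>D v / ((\<rho> \<alpha> - \<rho> (cl v)) * x v)\<bar>)"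
  have K1: "K \<ge> 1" unfolding K_def by (simp add: sum_nonneg)
  have KD: "D v \<le> K * ((\<rho> \<alpha> - \<rho> (cl v)) * x v)" if v: "v < N" "reach v" "cl v \<noteq> \<alpha>" for v
  proof -
    have gp: "(\<rho> \<alpha> - \<rho> (cl v)) * x v > 0" using gap[OF v] x0[OF v(1)] by simp
    have "D v / ((\<rho> \<alpha> - \<rho> (cl v)) * x v) \<le> \<bar>D v / ((\<rho> \<alpha> - \<rho> (cl v)) * x v)\<bar>" by (rule abs_ge_self)
    also have "\<dots> \<le> (\<Sum>v<N. \<bar>D v / ((\<rho> \<alpha> - \<rho> (cl v)) * x v)\<bar>)"
      using v(1) by (intro member_le_sum) auto
    also have "\<dots> \<le> K" by (simp add: K_def)
    finally show ?thesis using gp by (simp add: pos_divide_le_eq)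
  qed
  \<comment> \<open>Vertices without access to the class get 0: their radius need not lie below
    \<open>\<rho> \<alpha>\<close>, and no edge leads from them to a vertex with access.\<close>
  define \<Lambda> where "\<Lambda> v = (if reach v then K ^ (\<alpha> - cl v) * x v else 0)" for v
  have \<Lambda>0: "\<Lambda> v \<ge> 0" if "v < N" for v using K1 x0[OF that] by (simp add: \<Lambda>_def)
  show ?thesis
  proof (rule class_measure_finite[OF C_subset[OF \<alpha>] no_return_class[OF \<alpha>] pos M \<Lambda>0])
    fix v assume v: "v \<in> C \<alpha>"
    then have "reach v" by (auto simp: reach_def)
    then show "\<xi> v \<le> \<Lambda> v" using cl_eq[OF \<alpha> v] by (simp add: \<Lambda>_def x_def)
  next
    fix v assume v: "v < N"
    let ?\<beta> = "cl v"
    have CN: "C ?\<beta> \<subseteq> {..<N}" by (rule C_subset[OF cl(1)[OF v]])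
    show "(\<Sum>u<N. real (adj v u) * \<Lambda> u) \<le> \<rho> \<alpha> * \<Lambda> v"
    proof (cases "reach v")
      case False
      have "real (adj v u) * \<Lambda> u = 0" if "u < N" for u
        using reach_edge[of u v] False v that by (auto simp: \<Lambda>_def)
      then have "(\<Sum>u<N. real (adj v u) * \<Lambda> u) = 0" by (intro sum.neutral) blast
      moreover have "\<Lambda> v = 0" using False by (simp add: \<Lambda>_def)
      ultimately show ?thesis by simp
    next
      case True
      have inside: "(\<Sum>u\<in>C ?\<beta>. real (adj v u) * \<Lambda> u) \<le> K ^ (\<alpha> - ?\<beta>) * (\<rho> ?\<beta> * x v)"
      proof -
        have "(\<Sum>u\<in>C ?\<beta>. real (adj v u) * \<Lambda> u) \<le> (\<Sum>u\<in>C ?\<beta>. K ^ (\<alpha> - ?\<beta>) * (real (adj v u) * x u))"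
        proof (rule sum_mono)
          fix u assume u: "u \<in> C ?\<beta>"
          then have "cl u = ?\<beta>" "x u > 0" using cl_eq[OF cl(1)[OF v]] x0 CN by auto
          then have "\<Lambda> u \<le> K ^ (\<alpha> - ?\<beta>) * x u" using K1 by (simp add: \<Lambda>_def)
          then have "real (adj v u) * \<Lambda> u \<le> real (adj v u) * (K ^ (\<alpha> - ?\<beta>) * x u)"
            by (intro mult_left_mono) auto
          then show "real (adj v u) * \<Lambda> u \<le> K ^ (\<alpha> - ?\<beta>) * (real (adj v u) * x u)" by (simp add: mult_ac)
        qed
        also have "\<dots> = K ^ (\<alpha> - ?\<beta>) * (\<Sum>u\<in>C ?\<beta>. real (adj v u) * x u)" by (simp add: sum_distrib_left)
        also have "\<dots> \<le> K ^ (\<alpha> - ?\<beta>) * (\<rho> ?\<beta> * x v)"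
          using K1 x_sub[OF cl[OF v]] by (intro mult_left_mono) auto
        finally show ?thesis .
      qed
      have split: "(\<Sum>u<N. real (adj v u) * \<Lambda> u) =
          (\<Sum>u\<in>C ?\<beta>. real (adj v u) * \<Lambda> u) + (\<Sum>u\<in>{..<N} - C ?\<beta>. real (adj v u) * \<Lambda> u)"
        using CN by (subst sum.subset_diff[OF CN]) auto
      have next_class: "cl u > ?\<beta> \<and> cl u \<le> \<alpha>" if u: "u \<in> {..<N} - C ?\<beta>" "adj v u > 0" "reach u" for u
        using adj_cl_mono[OF v, of u] u reach_le[OF u(3)] cl(2)[of u] by (cases "cl u = ?\<beta>") auto
      show ?thesis
      proof (cases "?\<beta> = \<alpha>")
        case True
        have "(\<Sum>u\<in>{..<N} - C ?\<beta>. real (adj v u) * \<Lambda> u) = 0"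
        proof (rule sum.neutral, rule ballI)
          fix u assume u: "u \<in> {..<N} - C ?\<beta>"
          show "real (adj v u) * \<Lambda> u = 0"
          proof (cases "adj v u > 0 \<and> reach u")
            case a: True
            show ?thesis using next_class[OF u] a True by simp
          next
            case False
            then show ?thesis by (auto simp: \<Lambda>_def)
          qed
        qed
        then show ?thesis using split inside True \<open>reach v\<close> by (simp add: \<Lambda>_def)
      next
        case False
        then have lt: "?\<beta> < \<alpha>" using reach_le[OF True] by simp
        \<comment> \<open>Later classes carry at least one factor \<open>K\<close> less than the
          class of \<open>v\<close>; the spare factor pays for the whole flow
          \<open>D v\<close>.\<close>
        let ?k = "\<alpha> - Suc ?\<beta>"
        have k: "\<alpha> - ?\<beta> = Suc ?k" using lt by simp
        have "(\<Sum>u\<in>{..<N} - C ?\<beta>. real (adj v u) * \<Lambda> u) \<le> (\<Sum>u\<in>{..<N} - C ?\<beta>. K ^ ?k * (real (adj v u) * x u))"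
        proof (rule sum_mono)
          fix u assume u: "u \<in> {..<N} - C ?\<beta>"
          have xu: "x u > 0" using x0 u by simp
          show "real (adj v u) * \<Lambda> u \<le> K ^ ?k * (real (adj v u) * x u)"
          proof (cases "adj v u > 0 \<and> reach u")
            case a: True
            have "cl u > ?\<beta>" using next_class[OF u] a by simp
            then have "K ^ (\<alpha> - cl u) \<le> K ^ ?k" using K1 by (intro power_increasing) auto
            then have "K ^ (\<alpha> - cl u) * (real (adj v u) * x u) \<le> K ^ ?k * (real (adj v u) * x u)"
              using xu by (intro mult_right_mono) auto
            then show ?thesis using a by (simp add: \<Lambda>_def mult_ac)
          next
            case False
            then have "real (adj v u) * \<Lambda> u = 0" by (auto simp: \<Lambda>_def)
            moreover have "0 \<le> K ^ ?k * (real (adj v u) * x u)" using K1 xu by simp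
            ultimately show ?thesis by linarith
          qed
        qed
        also have "\<dots> = K ^ ?k * (\<Sum>u\<in>{..<N} - C ?\<beta>. real (adj v u) * x u)" by (simp add: sum_distrib_left)
        also have "\<dots> \<le> K ^ ?k * D v"
          unfolding D_def using K1 x0 by (intro mult_left_mono sum_mono2) (auto simp: less_imp_le)
        also have "\<dots> \<le> K ^ ?k * (K * ((\<rho> \<alpha> - \<rho> ?\<beta>) * x v))"
          using K1 KD[OF v True False] by (intro mult_left_mono) auto
        also have "\<dots> = K ^ (\<alpha> - ?\<beta>) * ((\<rho> \<alpha> - \<rho> ?\<beta>) * x v)" unfolding k by simp
        finally have "(\<Sum>u<N. real (adj v u) * \<Lambda> u) \<le> K ^ (\<alpha> - ?\<beta>) * (\<rho> ?\<beta> * x v) + K ^ (\<alpha> - ?\<beta>) * ((\<rho> \<alpha> - \<rho> ?\<beta>) * x v)"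
          using split inside by simp
        also have "\<dots> = \<rho> \<alpha> * \<Lambda> v" using True by (simp add: \<Lambda>_def algebra_simps)
        finally show ?thesis .
      qed
    qed
  qed
qed

lemma nondistinguished_class_measure_infinite:
  assumes \<alpha>: "\<alpha> < m" and nd: "\<not> distinguished A m C \<alpha>" and pos: "\<rho> \<alpha> > 0"
    and \<xi>: "\<And>v. v \<in> C \<alpha> \<Longrightarrow> \<xi> v > 0" and M: "class_measure (C \<alpha>) \<xi> (\<rho> \<alpha>) M"
  shows "emeasure M X = \<infinity>"
proof -
  have G: "matrix_graph A = {(v, u). v < N \<and> u < N \<and> adj v u > 0}"
    using matrix_graph_A by auto
  obtain \<beta> where \<beta>: "\<beta> < m" "\<beta> \<noteq> \<alpha>" "has_access A C \<beta> \<alpha>" "\<rho> \<beta> \<ge> \<rho> \<alpha>"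
    using nd by (auto simp: distinguished_def not_less)
  then obtain i j where ij: "i \<in> C \<beta>" "j \<in> C \<alpha>" "(i, j) \<in> (matrix_graph A)\<^sup>+"
    by (auto simp: has_access_def)
  have "j \<notin> C \<beta>" using C_disjoint[OF \<alpha> \<beta>(1) ij(2)] \<beta>(2) by auto
  then obtain v0 u0 where vu: "v0 \<in> C \<beta>" "u0 \<notin> C \<beta>" "(v0, u0) \<in> matrix_graph A" "(u0, j) \<in> (matrix_graph A)\<^sup>*"
    using rtrancl_leaves[OF trancl_into_rtrancl[OF ij(3)] ij(1)] by blast
  have prim: "primitive_on (C \<beta>) (\<lambda>v u. real (adj v u))"
    using primitive_on_if_radius_pos[OF \<beta>(1)] \<beta>(4) pos by simp
  obtain y where y: "\<And>v. v \<in> C \<beta> \<Longrightarrow> y v > 0"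
    "\<And>u. u \<in> C \<beta> \<Longrightarrow> (\<Sum>v\<in>C \<beta>. y v * real (adj v u)) = \<rho> \<beta> * y u"
    using left_perron_vector_class[OF \<beta>(1) prim] by blast
  show ?thesis
    by (rule class_measure_infinite[OF C_subset[OF \<alpha>] no_return_class[OF \<alpha>] pos M \<xi> C_subset[OF \<beta>(1)] y \<beta>(4) vu(1) _ vu(2)])
      (use vu ij(2) G in auto)
qed

text \<open>The map sends a vertex to the class of multiples of its measure. Radius above 1 provides
  both primitivity of the block and absence of atoms.\<close>

lemma infinite_ergodic_measures_correspondence:
  "\<exists>\<psi>. bij_betw \<psi> (nondistinguished_vertices A m C \<inter> nondegenerate_vertices A m C)
     (infinite_ergodic_measures B // proportional)"
proof -
  let ?good = "nondistinguished_vertices A m C \<inter> nondegenerate_vertices A m C"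
  have good: "\<alpha> \<in> ?good \<longleftrightarrow> \<alpha> < m \<and> \<not> distinguished A m C \<alpha> \<and> \<rho> \<alpha> > 1" for \<alpha>
    by (auto simp: nondistinguished_vertices_def nondegenerate_vertices_def)
  define prim where "prim \<alpha> \<longleftrightarrow> primitive_on (C \<alpha>) (\<lambda>v u. real (adj v u))" for \<alpha>
  define perron where "perron \<alpha> \<xi> M \<longleftrightarrow> (\<forall>v\<in>C \<alpha>. \<xi> v > 0) \<and>
      (\<forall>v\<in>C \<alpha>. (\<Sum>u\<in>C \<alpha>. real (adj v u) * \<xi> u) = \<rho> \<alpha> * \<xi> v) \<and> class_measure (C \<alpha>) \<xi> (\<rho> \<alpha>) M" for \<alpha> \<xi> M
  have "\<exists>\<xi> M. perron \<alpha> \<xi> M" if \<alpha>: "\<alpha> < m" "prim \<alpha>" for \<alpha>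
  proof -
    have pr: "primitive_on (C \<alpha>) (\<lambda>v u. real (adj v u))" using \<alpha>(2) by (simp add: prim_def)
    obtain \<xi> where \<xi>: "\<And>v. v \<in> C \<alpha> \<Longrightarrow> \<xi> v > 0"
      "\<And>v. v \<in> C \<alpha> \<Longrightarrow> (\<Sum>u\<in>C \<alpha>. real (adj v u) * \<xi> u) = \<rho> \<alpha> * \<xi> v"
      using perron_vector_class[OF \<alpha>(1) pr] by blast
    obtain M where "class_measure (C \<alpha>) \<xi> (\<rho> \<alpha>) M"
      using class_measure_exists[OF C_subset[OF \<alpha>(1)] no_return_class[OF \<alpha>(1)] primitive_eigenvalue_pos[OF pr \<xi>] \<xi>] by blast
    with \<xi> show ?thesis unfolding perron_def by blast
  qed
  then obtain \<xi> M where pm: "\<And>\<alpha>. \<alpha> < m \<Longrightarrow> prim \<alpha> \<Longrightarrow> perron \<alpha> (\<xi> \<alpha>) (M \<alpha>)" by metis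
  have \<xi>: "\<xi> \<alpha> v > 0" "(\<Sum>u\<in>C \<alpha>. real (adj v u) * \<xi> \<alpha> u) = \<rho> \<alpha> * \<xi> \<alpha> v"
    if "\<alpha> < m" "primitive_on (C \<alpha>) (\<lambda>v u. real (adj v u))" "v \<in> C \<alpha>" for \<alpha> v
    using pm[of \<alpha>] that by (auto simp: prim_def perron_def)
  have M: "class_measure (C \<alpha>) (\<xi> \<alpha>) (\<rho> \<alpha>) (M \<alpha>)"
    if "\<alpha> < m" "primitive_on (C \<alpha>) (\<lambda>v u. real (adj v u))" for \<alpha>
    using pm[of \<alpha>] that by (auto simp: prim_def perron_def)
  have good_prim: "primitive_on (C \<alpha>) (\<lambda>v u. real (adj v u))" if "\<alpha> \<in> ?good" for \<alpha>
    using that good by (intro primitive_on_if_radius_pos) auto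
  have M_IEM: "M \<alpha> \<in> infinite_ergodic_measures B" if \<alpha>: "\<alpha> \<in> ?good" for \<alpha>
  proof -
    have am: "\<alpha> < m" "\<rho> \<alpha> > 1" "\<not> distinguished A m C \<alpha>" using \<alpha> good by auto
    note p = am(1) good_prim[OF \<alpha>]
    have inf: "emeasure (M \<alpha>) X = \<infinity>"
      using nondistinguished_class_measure_infinite[OF am(1,3) _ \<xi>(1)[OF p] M[OF p]] am(2) by simp
    show ?thesis
      by (rule class_measure_in_infinite_ergodic_measures[OF no_return_class[OF am(1)] C_subset[OF am(1)] am(2) p(2) \<xi>[OF p] M[OF p] inf])
  qed
  have self: "(M', M') \<in> proportional" for M' :: "(nat \<Rightarrow> 'e) measure"
    by (auto simp: proportional_def intro!: exI[of _ 1])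
  have class_eq: "proportional `` {scale_measure (ennreal c) M'} = proportional `` {M'}"
    if c: "c > 0" for c and M' :: "(nat \<Rightarrow> 'e) measure"
  proof (intro equalityI subsetI)
    fix L assume "L \<in> proportional `` {scale_measure (ennreal c) M'}"
    then obtain d where d: "d > 0" "L = scale_measure (ennreal d) (scale_measure (ennreal c) M')"
      by (auto simp: proportional_def)
    then have "L = scale_measure (ennreal (d * c)) M'" using c by (simp add: ennreal_mult)
    then show "L \<in> proportional `` {M'}"
      using d c by (auto simp: proportional_def intro!: exI[of _ "d * c"])
  next
    fix L assume "L \<in> proportional `` {M'}"
    then obtain d where d: "d > 0" "L = scale_measure (ennreal d) M'" by (auto simp: proportional_def)
    then have "L = scale_measure (ennreal (d / c)) (scale_measure (ennreal c) M')"
      using c by (simp add: ennreal_mult[symmetric])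
    then show "L \<in> proportional `` {scale_measure (ennreal c) M'}"
      using d c by (auto simp: proportional_def intro!: exI[of _ "d / c"])
  qed
  \<comment> \<open>Proportional measures would be concentrated on two disjoint sets at once and
    hence vanish, whereas these measures are infinite.\<close>
  have inj: "inj_on (\<lambda>\<alpha>. proportional `` {M \<alpha>}) ?good"
  proof (rule inj_onI, rule ccontr)
    fix \<alpha> \<beta> assume *: "\<alpha> \<in> ?good" "\<beta> \<in> ?good" "proportional `` {M \<alpha>} = proportional `` {M \<beta>}" "\<alpha> \<noteq> \<beta>"
    have ab: "\<alpha> < m" "\<beta> < m" using * good by auto
    note Da = class_measureD[OF M[OF ab(1) good_prim[OF *(1)]]] and Db = class_measureD[OF M[OF ab(2) good_prim[OF *(2)]]]
    have "M \<alpha> \<in> proportional `` {M \<beta>}" using *(3) self by blast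
    then obtain c where c: "M \<alpha> = scale_measure (ennreal c) (M \<beta>)" by (auto simp: proportional_def)
    have ev: "eventually_in (C \<gamma>) \<in> sets (M \<alpha>)" "X - eventually_in (C \<gamma>) \<in> sets (M \<alpha>)" for \<gamma>
      using eventually_in_measurable[of "C \<gamma>"] sets.top[of "path_borel B"] Da(1) by auto
    have "emeasure (M \<alpha>) (X - eventually_in (C \<beta>)) = 0" using Db(4) unfolding c by simp
    then have "X - eventually_in (C \<beta>) \<in> null_sets (M \<alpha>)" using ev by auto
    moreover have "X - eventually_in (C \<alpha>) \<in> null_sets (M \<alpha>)" using Da(4) ev by auto
    moreover have "X = (X - eventually_in (C \<beta>)) \<union> (X - eventually_in (C \<alpha>))"
      using eventually_in_disjoint[OF ab *(4)] by auto
    ultimately have "X \<in> null_sets (M \<alpha>)" using null_sets.Un by metis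
    then have "emeasure (M \<alpha>) X = 0" by auto
    moreover have "emeasure (M \<alpha>) X = \<infinity>"
      using M_IEM[OF *(1)] unfolding infinite_ergodic_measures_def infinite_measure_def by auto
    ultimately show False by simp
  qed
  have surj: "\<exists>\<alpha>\<in>?good. proportional `` {L} = proportional `` {M \<alpha>}" if L: "L \<in> infinite_ergodic_measures B" for L
  proof -
    have sL: "sets L = sets (path_borel B)" and spL: "space L = X" and inv: "tail_invariant B L"
      and erg: "tail_ergodic B L" and inf: "emeasure L X = \<infinity>" and na: "nonatomic L"
      using L unfolding infinite_ergodic_measures_def infinite_measure_def by auto
    obtain U where U: "openin (path_topology B) U" "0 < emeasure L U" "emeasure L U < \<infinity>"
      using L unfolding infinite_ergodic_measures_def by auto
    have ev: "eventually_in (C \<gamma>) \<in> sets L" for \<gamma> using eventually_in_measurable sL by auto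
    \<comment> \<open>Finitely many saturated sets cover the path space, so one of them is not null;
      ergodicity then makes its complement null.\<close>
    have "\<exists>\<alpha><m. eventually_in (C \<alpha>) \<notin> null_sets L"
    proof (rule ccontr)
      assume "\<not> ?thesis"
      then have "(\<Union>\<alpha><m. eventually_in (C \<alpha>)) \<in> null_sets L" by (intro null_sets_UN') auto
      then have "X \<in> null_sets L" unfolding eventually_in_some_class[symmetric] .
      then show False using inf by auto
    qed
    then obtain \<alpha> where \<alpha>: "\<alpha> < m" "eventually_in (C \<alpha>) \<notin> null_sets L" by auto
    have sat: "tail_rel B `` eventually_in (C \<alpha>) = eventually_in (C \<alpha>)"
    proof (intro equalityI subsetI)
      fix y assume "y \<in> tail_rel B `` eventually_in (C \<alpha>)"
      then obtain x n where "x \<in> eventually_in (C \<alpha>)" "x \<in> X" "y \<in> X" "\<forall>i\<ge>n. x i = y i"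
        by (auto simp: tail_rel_def)
      then show "y \<in> eventually_in (C \<alpha>)" using eventually_in_tail by blast
    next
      fix y assume "y \<in> eventually_in (C \<alpha>)"
      moreover from this have "(y, y) \<in> tail_rel B" by (auto simp: tail_rel_def eventually_in_def)
      ultimately show "y \<in> tail_rel B `` eventually_in (C \<alpha>)" by blast
    qed
    have null: "emeasure L (X - eventually_in (C \<alpha>)) = 0"
      using erg ev sat \<alpha>(2) spL unfolding tail_ergodic_def by auto
    have ne: "eventually_in (C \<alpha>) \<noteq> {}" using \<alpha>(2) by auto
    \<comment> \<open>A single such path uses an edge inside the class, so the block is nonzero and
      hence primitive. This excludes the blocks \<open>[0]\<close>.\<close>
    then obtain x where "x \<in> eventually_in (C \<alpha>)" by auto
    then have pr: "primitive_on (C \<alpha>) (\<lambda>v u. real (adj v u))" by (rule primitive_on_if_path[OF \<alpha>(1)])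
    note p = \<alpha>(1) pr
    note cl_facts = no_return_class[OF \<alpha>(1)] C_subset[OF \<alpha>(1)]
    obtain z k where z: "z \<in> X" "k \<ge> 1" "lab z k \<in> C \<alpha>" "emeasure L (cyl z k) < \<infinity>"
      using finite_cylinder_in_class[OF sL null U] by blast
    have cinv: "emeasure L (cyl x n) = emeasure L (cyl y n)" if "x \<in> X" "y \<in> X" "src B (x n) = src B (y n)" for x y n
      by (rule switch_invariant_cyl[OF sL tail_invariant_imp_switch_invariant[OF sL inv] that])
    obtain c where c: "c \<ge> 0" "L = scale_measure (ennreal c) (M \<alpha>)"
      using measure_eq_scaled_class_measure[OF cl_facts pr \<xi>[OF p] M[OF p] sL null cinv z] by blast
    have c0: "c > 0"
    proof (rule ccontr)
      assume "\<not> c > 0"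
      then have "emeasure L X = 0" unfolding c(2) using c(1) by simp
      with inf show False by simp
    qed
    have r: "\<rho> \<alpha> > 0" by (rule primitive_eigenvalue_pos[OF pr \<xi>[OF p]])
    have r1: "\<rho> \<alpha> > 1" by (rule class_measure_nonatomic_imp[OF cl_facts(2) r M[OF p] c(2) c0 \<xi>(1)[OF p] na ne])
    have "\<not> distinguished A m C \<alpha>"
    proof
      assume "distinguished A m C \<alpha>"
      then have "emeasure (M \<alpha>) X < \<infinity>"
        by (rule distinguished_class_measure_finite[OF \<alpha>(1) _ r \<xi>[OF p] M[OF p]])
      then have "emeasure L X < \<infinity>" unfolding c(2) by (simp add: ennreal_mult_less_top)
      with inf show False by simp
    qed
    with \<alpha>(1) r1 have "\<alpha> \<in> ?good" using good by simp
    moreover have "proportional `` {L} = proportional `` {M \<alpha>}" unfolding c(2) by (rule class_eq[OF c0])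
    ultimately show ?thesis by blast
  qed
  have "bij_betw (\<lambda>\<alpha>. proportional `` {M \<alpha>}) ?good (infinite_ergodic_measures B // proportional)"
    unfolding bij_betw_def
  proof (intro conjI inj equalityI subsetI)
    fix Q assume "Q \<in> (\<lambda>\<alpha>. proportional `` {M \<alpha>}) ` ?good"
    then show "Q \<in> infinite_ergodic_measures B // proportional" using M_IEM by (auto intro: quotientI)
  next
    fix Q assume "Q \<in> infinite_ergodic_measures B // proportional"
    then obtain L where L: "L \<in> infinite_ergodic_measures B" "Q = proportional `` {L}" by (rule quotientE)
    then show "Q \<in> (\<lambda>\<alpha>. proportional `` {M \<alpha>}) ` ?good" using surj by blast
  qed
  then show ?thesis by blast
qed

end

theorem theorem4p3:
  fixes B :: "('v, 'e) bratteli" and N s m :: nat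
    and \<nu> :: "nat \<Rightarrow> nat \<Rightarrow> 'v" and C :: "nat \<Rightarrow> nat set" and F A :: "nat mat"
  assumes "bratteli_diagram B"
    and "no_isolated_points B"
    and "stationary B N \<nu>"
    and "F = incidence_matrix B N \<nu> 1"
    and "aperiodic B"
    and "condition_P F s m C"
    and "A = transpose_mat F"
  shows "\<exists>\<phi>. bij_betw \<phi> (infinite_ergodic_measures B // proportional)
               (nondistinguished_vertices A m C \<inter> nondegenerate_vertices A m C)"
proof -
  interpret D: diagram_classes B N \<nu> s m C
    using assms by unfold_locales simp_all
  have "D.F = F" using assms(4) by (simp only: D.F_def)
  then show ?thesis
    using D.infinite_ergodic_measures_correspondence bij_betw_inv assms(7) by blast
qed

end
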